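(* Let $f$ be an attachment rule in the case of weak preference, i.e. $\sum_{k=0}^\infty f(k)^{-2}=\infty$. Then, for all $s\in\mathbb T$, $$\Big(\frac{Z[s,s+\varphi^*_{\kappa t}]-\varphi^*_{\kappa t}}{\sqrt\kappa}\colon t\ge0\Big)\Rightarrow (W_t\colon t\ge0)\qquad\text{as }\kappa\to\infty,$$ in distribution on $\mathcal L[0,\infty)$, where $(W_t\colon t\ge0)$ is a standard Brownian motion and $(\varphi^*_t)_{t\ge0}$ is the inverse of $(\varphi_t)_{t\ge0}$ given by $$\varphi_t=\int_0^{\Phi^{-1}(t)}\frac1{f(u)^2}\,du .$$
   Context: $\mathbb Z_+=\{0,1,2,\dots\}$, $\mathbb N=\{1,2,\dots\}$. An attachment rule is a monotonically increasing (nondecreasing) function $f:\mathbb Z_+\to(0,\infty)$ with $f(n)\le n+1$ for all $n\in\mathbb Z_+$; it is extended to $[0,\infty)$ by $f(u):=f(\lfloor u\rfloor)$. The network evolves as follows: at time $n=1$ it consists of a single vertex, labelled $1$, without edges. In the step $n\to n+1$ a new vertex labelled $n+1$ is added and, independently for each old vertex $m\in\{1,\dots,n\}$ (given the graph at time $n$), a directed edge $n+1\to m$ is inserted with probability $f(\text{indegree of } m \text{ at time } n)/n$. For $m\le n$, $\mathcal Z[m,n]$ denotes the indegree of vertex $m$ after insertion of vertex $n$. Artificial scales: $\Psi(n)=\sum_{m=1}^{n-1}\frac1m$ for $n\in\mathbb N$, $\Phi(u)=\int_0^u\frac{dv}{f(v)}$ for $u\ge0$ (so $\Phi(j)=\sum_{k=0}^{j-1}1/f(k)$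 for integers $j$, and $\Phi:[0,\infty)\to[0,\infty)$ is a bijection), $\mathbb T=\{\Psi(n):n\in\mathbb N\}$. For $s=\Psi(m)$, $t=\Psi(n)$ with $m\le n$ put $Z[s,t]:=\Phi(\mathcal Z[m,n])$, and for arbitrary real $t\ge0$ put $Z[s,t]:=Z[s,s\vee\max(\mathbb T\cap[0,t])]$. $\mathcal L[0,\infty)$ is the space of càdlàg functions $x:[0,\infty)\to\mathbb R$ with the topology of uniform convergence on compact subsets of $[0,\infty)$. *)

theory Defs
  imports "HOL-Probability.Probability" "Graph_Theory.Pair_Digraph"
begin

section \<open>The network\<close>

definition attachment_rule :: "(nat \<Rightarrow> real) \<Rightarrow> bool" where
  "attachment_rule f \<longleftrightarrow> mono f \<and> (\<forall>n. 0 < f n \<and> f n \<le> real n + 1)"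

text \<open>An arc \<open>(k, m)\<close> points from the younger vertex \<open>k\<close> to the older vertex \<open>m\<close>.\<close>

definition initial_network :: "nat pair_pre_digraph" where
  "initial_network = \<lparr>pverts = {1}, parcs = {}\<rparr>"

definition add_vertex :: "nat \<Rightarrow> (nat \<Rightarrow> bool) \<Rightarrow> nat pair_pre_digraph \<Rightarrow> nat pair_pre_digraph" where
  "add_vertex k b g =
     \<lparr>pverts = insert k (pverts g), parcs = parcs g \<union> {(k, m) |m. m \<in> pverts g \<and> b m}\<rparr>"

text \<open>The law of the network at time \<open>n + 1\<close>, given that it is \<open>g\<close> at time \<open>n\<close>. For an
  attachment rule the Bernoulli parameters are genuine probabilities, because the indegree of
  a vertex at time \<open>n\<close> is at most \<open>n - 1\<close>.\<close>

definition step_law :: "(nat \<Rightarrow> real) \<Rightarrow> nat \<Rightarrow> nat pair_pre_digraph \<Rightarrow> nat pair_pre_digraph pmf" where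
  "step_law f n g =
     map_pmf (\<lambda>b. add_vertex (Suc n) b g)
       (Pi_pmf {1..n} False (\<lambda>m. bernoulli_pmf (f (in_degree (with_proj g) m) / real n)))"

text \<open>Conditioning on the network at time \<open>n\<close> is conditioning on the whole past: the network at
  an earlier time \<open>k\<close> is almost surely its restriction to the vertices \<open>1, \<dots>, k\<close>.
  The value \<open>G 0\<close> plays no role.\<close>

locale preferential_attachment = prob_space M
  for M :: "'a measure" and f :: "nat \<Rightarrow> real" and G :: "nat \<Rightarrow> 'a \<Rightarrow> nat pair_pre_digraph" +
  assumes random_network: "\<And>n. 1 \<le> n \<Longrightarrow> random_variable (count_space UNIV) (G n)"
    and initial: "AE \<omega> in M. G 1 \<omega> = initial_network"
    and step: "\<And>n g h. \<lbrakk>1 \<le> n; \<P>(\<omega> in M. G n \<omega> = g) > 0\<rbrakk> \<Longrightarrow>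
      \<P>(\<omega> in M. G (Suc n) \<omega> = h \<bar> G n \<omega> = g) = pmf (step_law f n g) h"


section \<open>Artificial scales\<close>

definition Psi :: "nat \<Rightarrow> real" where
  "Psi n = (\<Sum>m\<in>{1..<n}. 1 / real m)"

definition extend :: "(nat \<Rightarrow> real) \<Rightarrow> real \<Rightarrow> real" where
  "extend f u = f (nat \<lfloor>u\<rfloor>)"

definition Phi :: "(nat \<Rightarrow> real) \<Rightarrow> real \<Rightarrow> real" where
  "Phi f u = integral {0..u} (\<lambda>v. 1 / extend f v)"

definition time_set :: "real set" where
  "time_set = Psi ` {1..}"

abbreviation vertex_at :: "real \<Rightarrow> nat" where
  "vertex_at \<equiv> the_inv_into {1..} Psi"

text \<open>Degree evolution on the artificial scales along one realisation \<open>\<Gamma>\<close> of the network, for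
  \<open>s \<in> time_set\<close> and \<open>t \<ge> 0\<close>.\<close>

definition scaled_indegree ::
  "(nat \<Rightarrow> real) \<Rightarrow> (nat \<Rightarrow> nat pair_pre_digraph) \<Rightarrow> real \<Rightarrow> real \<Rightarrow> real" where
  "scaled_indegree f \<Gamma> s t =
     Phi f (real (in_degree (with_proj (\<Gamma> (vertex_at (max s (Max (time_set \<inter> {0..t}))))))
                            (vertex_at s)))"

definition phi :: "(nat \<Rightarrow> real) \<Rightarrow> real \<Rightarrow> real" where
  "phi f t = integral {0..the_inv_into {0..} (Phi f) t} (\<lambda>u. 1 / (extend f u)\<^sup>2)"

definition phi_star :: "(nat \<Rightarrow> real) \<Rightarrow> real \<Rightarrow> real" where
  "phi_star f = the_inv_into {0..} (phi f)"


section \<open>Brownian motion\<close>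

locale standard_brownian_motion = prob_space N
  for N :: "'b measure" and W :: "real \<Rightarrow> 'b \<Rightarrow> real" +
  assumes random_variable_W: "\<And>t. 0 \<le> t \<Longrightarrow> random_variable borel (W t)"
    and start: "AE \<omega> in N. W 0 \<omega> = 0"
    and normal_increments: "\<And>s t. \<lbrakk>0 \<le> s; s < t\<rbrakk> \<Longrightarrow>
      distributed N lborel (\<lambda>\<omega>. W t \<omega> - W s \<omega>) (normal_density 0 (sqrt (t - s)))"
    and independent_increments: "\<And>n u. \<lbrakk>0 \<le> u 0; \<And>i. i < n \<Longrightarrow> u i < u (Suc i)\<rbrakk> \<Longrightarrow>
      indep_vars (\<lambda>_. borel) (\<lambda>i \<omega>. W (u (Suc i)) \<omega> - W (u i) \<omega>) {..<n::nat}"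
    and continuous_paths: "\<And>\<omega>. \<omega> \<in> space N \<Longrightarrow> continuous_on {0..} (\<lambda>t. W t \<omega>)"


section \<open>The space of right-continuous paths with left limits\<close>

text \<open>Functions on \<open>[0, \<infinity>)\<close> are represented by functions on the reals that are
  \<open>undefined\<close> at negative arguments.\<close>

definition cadlag_paths :: "(real \<Rightarrow> real) set" where
  "cadlag_paths = {x \<in> extensional {0..}.
     (\<forall>t\<ge>0. (x \<longlongrightarrow> x t) (at_right t)) \<and> (\<forall>t>0. \<exists>l. (x \<longlongrightarrow> l) (at_left t))}"

definition cadlag_open :: "(real \<Rightarrow> real) set \<Rightarrow> bool" where
  "cadlag_open U \<longleftrightarrow> U \<subseteq> cadlag_paths \<and>
     (\<forall>x\<in>U. \<exists>K e. compact K \<and> K \<subseteq> {0..} \<and> e > 0 \<and>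
        (\<forall>y\<in>cadlag_paths. (\<forall>t\<in>K. \<bar>y t - x t\<bar> < e) \<longrightarrow> y \<in> U))"

definition cadlag_topology :: "(real \<Rightarrow> real) topology" where
  "cadlag_topology = topology cadlag_open"

lemma istopology_cadlag_open: "istopology cadlag_open"
  unfolding istopology_def
proof (intro conjI allI impI)
  fix S T assume S: "cadlag_open S" and T: "cadlag_open T"
  show "cadlag_open (S \<inter> T)"
    unfolding cadlag_open_def
  proof (intro conjI ballI)
    show "S \<inter> T \<subseteq> cadlag_paths" using S by (auto simp: cadlag_open_def)
    fix x assume x: "x \<in> S \<inter> T"
    obtain K e where K: "compact K" "K \<subseteq> {0..}" "e > 0"
      "\<forall>y\<in>cadlag_paths. (\<forall>t\<in>K. \<bar>y t - x t\<bar> < e) \<longrightarrow> y \<in> S"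
      using S x unfolding cadlag_open_def by (meson IntD1)
    obtain L d where L: "compact L" "L \<subseteq> {0..}" "d > 0"
      "\<forall>y\<in>cadlag_paths. (\<forall>t\<in>L. \<bar>y t - x t\<bar> < d) \<longrightarrow> y \<in> T"
      using T x unfolding cadlag_open_def by (meson IntD2)
    show "\<exists>K e. compact K \<and> K \<subseteq> {0..} \<and> e > 0 \<and>
        (\<forall>y\<in>cadlag_paths. (\<forall>t\<in>K. \<bar>y t - x t\<bar> < e) \<longrightarrow> y \<in> S \<inter> T)"
      using K L by (intro exI[of _ "K \<union> L"] exI[of _ "min e d"]) (auto simp: compact_Un)
  qed
next
  fix \<K> assume \<K>: "\<forall>K\<in>\<K>. cadlag_open K"
  show "cadlag_open (\<Union>\<K>)"
    unfolding cadlag_open_def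
  proof (intro conjI ballI)
    show "\<Union>\<K> \<subseteq> cadlag_paths" using \<K> by (auto simp: cadlag_open_def)
    fix x assume "x \<in> \<Union>\<K>"
    then obtain U where U: "U \<in> \<K>" "x \<in> U" by blast
    then obtain K e where "compact K" "K \<subseteq> {0..}" "e > 0"
      "\<forall>y\<in>cadlag_paths. (\<forall>t\<in>K. \<bar>y t - x t\<bar> < e) \<longrightarrow> y \<in> U"
      using \<K> unfolding cadlag_open_def by meson
    then show "\<exists>K e. compact K \<and> K \<subseteq> {0..} \<and> e > 0 \<and>
        (\<forall>y\<in>cadlag_paths. (\<forall>t\<in>K. \<bar>y t - x t\<bar> < e) \<longrightarrow> y \<in> \<Union>\<K>)"
      using U by blast
  qed
qed

lemma openin_cadlag_topology: "openin cadlag_topology = cadlag_open"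
  by (simp add: cadlag_topology_def topology_inverse' istopology_cadlag_open)

lemma topspace_cadlag_topology: "topspace cadlag_topology = cadlag_paths"
proof -
  have "cadlag_open cadlag_paths"
    unfolding cadlag_open_def by (auto intro!: exI[of _ "{}"] exI[of _ "1::real"])
  then show ?thesis
    unfolding topspace_def openin_cadlag_topology
    by (metis (no_types, lifting) Sup_upper cadlag_open_def mem_Collect_eq Sup_least subset_antisym)
qed


section \<open>Convergence in distribution\<close>

definition borel_of :: "'c topology \<Rightarrow> 'c measure" where
  "borel_of X = sigma (topspace X) {U. openin X U}"

text \<open>Weak convergence of the laws on the (possibly non-separable) space \<open>T\<close>; all random elements
  involved are required to be Borel measurable.\<close>

definition converges_in_distribution ::
  "'c topology \<Rightarrow> 'i filter \<Rightarrow> 'a measure \<Rightarrow> ('i \<Rightarrow> 'a \<Rightarrow> 'c) \<Rightarrow> 'b measure \<Rightarrow> ('b \<Rightarrow> 'c) \<Rightarrow> bool" where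
  "converges_in_distribution T F M X N Y \<longleftrightarrow>
     (\<forall>\<^sub>F i in F. X i \<in> M \<rightarrow>\<^sub>M borel_of T) \<and> Y \<in> N \<rightarrow>\<^sub>M borel_of T \<and>
     (\<forall>h. continuous_map T euclideanreal h \<and> bounded (h ` topspace T) \<longrightarrow>
        ((\<lambda>i. LINT \<omega>|M. h (X i \<omega>)) \<longlongrightarrow> (LINT \<omega>|N. h (Y \<omega>))) F)"

end

theory Submission
  imports Defs
begin

text \<open>If the indegree of a fixed vertex is \<open>k\<close> when the network has \<open>n\<close> vertices, then \<open>\<Phi>\<close> of the
  indegree jumps by \<open>1 / f k\<close> with probability \<open>f k / n\<close>. Its mean growth \<open>1 / n\<close> is the growth of
  the clock \<open>\<Psi>\<close>, so the degree evolution on the artificial scales is the clock plus a martingale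
  with bounded increments. The conditional variance of an increment is \<open>1 / (n f k) - 1 / n\<^sup>2\<close>.

  Up to a bounded term the accumulated variance is the compensator of the sum of the squared
  jumps, and that sum equals \<open>\<phi>\<close> evaluated at the position of the process. Since \<open>\<phi>\<close> is Lipschitz
  continuous, replacing the position by the clock costs at most a multiple of the martingale
  itself. Both errors have second moments of the order of the accumulated variance, hence \<open>L\<^sup>1\<close>
  norms of the order of its square root (\<open>bracket_estimate\<close>). On the time scale \<open>\<phi>\<^sup>*\<close>, which is
  defined on all of \<open>[0, \<infinity>)\<close> by weak preference, the accumulated variance at time \<open>r\<close> is therefore
  \<open>r + O(\<surd>r)\<close>.

  A martingale with bounded increments whose accumulated variance at time \<open>r\<close> is \<open>r + o(r)\<close> in \<open>L\<^sup>1\<close>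
  converges to Brownian motion after rescaling (\<open>functional_clt\<close>). Compensating the
  characteristic function of an increment over a block of time by the Gaussian factor for the
  variance that is still to come shows that the increment is asymptotically normal and
  independent of the past (\<open>weighted_characteristic_bound\<close>, \<open>weighted_clt\<close>). Freezing one
  coordinate after the other gives the joint law of the increments over a grid
  (\<open>finite_dimensional_convergence\<close>). Doob's maximal inequality together with the Gaussian
  fourth moment bounds the probability of a large oscillation in a grid cell of length \<open>\<delta>\<close> by a
  multiple of \<open>\<delta>\<^sup>2\<close> (\<open>oscillation_bound\<close>), so that a path is close to its values on a fine grid.
  The topology of locally uniform convergence on cadlag paths is metrizable, and bounded
  Lipschitz functionals suffice to test convergence (\<open>converges_in_distribution_lipschitzI\<close>).
  Measurability, delicate on this non-separable space, holds because all paths involved are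
  limits of paths that depend on finitely many random variables.

  The network at time \<open>n\<close> almost surely determines its own past, so the arrows into the fixed
  vertex form a sequence of events with the conditional probabilities used above
  (\<open>arrows_form_chain\<close>).\<close>

section \<open>A metric for locally uniform convergence\<close>

text \<open>Capping the discrepancy at time \<open>t\<close> by \<open>1 / (1 + t)\<close> makes late times count little. A distance
  below \<open>\<epsilon>\<close> therefore amounts to uniform closeness on an interval of length about \<open>1 / \<epsilon>\<close>.\<close>

definition path_dist :: "(real \<Rightarrow> real) \<Rightarrow> (real \<Rightarrow> real) \<Rightarrow> real" where
  "path_dist x y = (SUP t\<in>{0..}. min \<bar>x t - y t\<bar> (1 / (1 + t)))"

lemma path_dist_bdd: "bdd_above ((\<lambda>t. min \<bar>x t - y t\<bar> (1 / (1 + t))) ` {0::real..})"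
proof (rule bdd_aboveI2)
  fix t :: real assume "t \<in> {0..}"
  then have "1 / (1 + t) \<le> 1" by (simp add: field_simps)
  then show "min \<bar>x t - y t\<bar> (1 / (1 + t)) \<le> 1" by linarith
qed

lemma path_dist_ge: "t \<ge> 0 \<Longrightarrow> min \<bar>x t - y t\<bar> (1 / (1 + t)) \<le> path_dist x y"
  unfolding path_dist_def by (rule cSUP_upper[OF _ path_dist_bdd]) simp

lemma path_dist_le: "(\<And>t. t \<ge> 0 \<Longrightarrow> min \<bar>x t - y t\<bar> (1 / (1 + t)) \<le> e) \<Longrightarrow> path_dist x y \<le> e"
  unfolding path_dist_def by (rule cSUP_least) auto

lemma path_dist_nonneg: "0 \<le> path_dist x y"
  using path_dist_ge[of 0 x y] by (smt (verit) divide_nonneg_nonneg)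

lemma path_dist_refl [simp]: "path_dist x x = 0"
proof -
  have "path_dist x x \<le> 0" by (rule path_dist_le) simp
  then show ?thesis using path_dist_nonneg[of x x] by linarith
qed

lemma path_dist_commute: "path_dist x y = path_dist y x"
  unfolding path_dist_def by (simp add: abs_minus_commute)

lemma path_dist_triangle: "path_dist x z \<le> path_dist x y + path_dist y z"
proof (rule path_dist_le)
  fix t :: real assume t: "t \<ge> 0"
  have "min \<bar>x t - z t\<bar> (1 / (1 + t)) \<le> min \<bar>x t - y t\<bar> (1 / (1 + t)) + min \<bar>y t - z t\<bar> (1 / (1 + t))"
    using t by (auto simp: min_def)
  also have "\<dots> \<le> path_dist x y + path_dist y z"
    using path_dist_ge[OF t] by (intro add_mono) auto
  finally show "min \<bar>x t - z t\<bar> (1 / (1 + t)) \<le> path_dist x y + path_dist y z" .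
qed

lemma path_dist_le_uniform:
  assumes "\<And>t. 0 \<le> t \<Longrightarrow> t < T \<Longrightarrow> \<bar>x t - y t\<bar> \<le> e" "1 / (1 + T) \<le> e" "0 \<le> T"
  shows "path_dist x y \<le> e"
proof (rule path_dist_le)
  fix t :: real assume t: "t \<ge> 0"
  show "min \<bar>x t - y t\<bar> (1 / (1 + t)) \<le> e"
  proof (cases "t < T")
    case True then show ?thesis using assms(1)[of t] t by simp
  next
    case False
    then have "1 / (1 + t) \<le> 1 / (1 + T)" using assms(3) by (intro divide_left_mono) auto
    then show ?thesis using assms(2) by linarith
  qed
qed

lemma path_dist_less_imp:
  assumes "path_dist x y < e" "e \<le> 1 / (1 + T)" "0 \<le> t" "t \<le> T"
  shows "\<bar>x t - y t\<bar> < e"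
proof -
  have "1 / (1 + T) \<le> 1 / (1 + t)" using assms by (intro divide_left_mono) auto
  then show ?thesis using path_dist_ge[of t x y] assms by linarith
qed

text \<open>A compact set of times is bounded, by \<open>T\<close> say, and below the level \<open>1 / (1 + T)\<close> the metric
  controls the paths uniformly up to time \<open>T\<close>. Conversely, uniform control up to time \<open>2 / \<epsilon>\<close>
  controls the metric up to \<open>\<epsilon>\<close>, which gives \<open>cadlag_open_if_balls\<close>.\<close>

lemma cadlag_open_ball:
  assumes "cadlag_open U" "x \<in> U"
  obtains e where "e > 0" "\<And>y. y \<in> cadlag_paths \<Longrightarrow> path_dist x y < e \<Longrightarrow> y \<in> U"
proof -
  obtain K e where K: "compact K" "K \<subseteq> {0..}" "e > 0"
      "\<forall>y\<in>cadlag_paths. (\<forall>t\<in>K. \<bar>y t - x t\<bar> < e) \<longrightarrow> y \<in> U"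
    using assms unfolding cadlag_open_def by meson
  obtain R where R: "\<And>t. t \<in> K \<Longrightarrow> \<bar>t\<bar> \<le> R"
    using compact_imp_bounded[OF K(1)] unfolding bounded_iff by auto
  define T where "T = max R 0"
  show ?thesis
  proof (rule that[of "min e (1 / (1 + T))"])
    show "min e (1 / (1 + T)) > 0" using K(3) by (auto simp: T_def)
    fix y assume y: "y \<in> cadlag_paths" "path_dist x y < min e (1 / (1 + T))"
    have "\<bar>y t - x t\<bar> < e" if "t \<in> K" for t
    proof -
      have "0 \<le> t" "t \<le> T" using K(2) that R[OF that] by (auto simp: T_def)
      then have "\<bar>x t - y t\<bar> < min e (1 / (1 + T))"
        using y(2) by (intro path_dist_less_imp[where T = T]) auto
      then show ?thesis by linarith
    qed
    then show "y \<in> U" using K(4) y(1) by blast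
  qed
qed

lemma cadlag_open_if_balls:
  assumes "U \<subseteq> cadlag_paths"
    and "\<And>x. x \<in> U \<Longrightarrow> \<exists>e>0. \<forall>y\<in>cadlag_paths. path_dist x y < e \<longrightarrow> y \<in> U"
  shows "cadlag_open U"
  unfolding cadlag_open_def
proof (intro conjI ballI assms(1))
  fix x assume "x \<in> U"
  then obtain e where e: "e > 0" "\<forall>y\<in>cadlag_paths. path_dist x y < e \<longrightarrow> y \<in> U" using assms(2) by blast
  show "\<exists>K e. compact K \<and> K \<subseteq> {0..} \<and> e > 0 \<and>
        (\<forall>y\<in>cadlag_paths. (\<forall>t\<in>K. \<bar>y t - x t\<bar> < e) \<longrightarrow> y \<in> U)"
  proof (intro exI[of _ "{0..2 / e}"] exI[of _ "e / 2"] conjI ballI impI)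
    fix y assume y: "y \<in> cadlag_paths" "\<forall>t\<in>{0..2 / e}. \<bar>y t - x t\<bar> < e / 2"
    have "path_dist x y \<le> e / 2"
      by (rule path_dist_le_uniform[of "2 / e"])
        (use y e in \<open>auto simp: abs_minus_commute less_imp_le field_simps\<close>)
    then show "y \<in> U" using e y(1) by auto
  qed (use e in auto)
qed

definition path_lipschitz :: "real \<Rightarrow> ((real \<Rightarrow> real) \<Rightarrow> real) \<Rightarrow> bool" where
  "path_lipschitz L h \<longleftrightarrow> 0 < L \<and>
     (\<forall>x\<in>cadlag_paths. \<forall>y\<in>cadlag_paths. \<bar>h x - h y\<bar> \<le> L * path_dist x y)"

lemma path_lipschitz_continuous:
  assumes "path_lipschitz L h"
  shows "continuous_map cadlag_topology euclideanreal h"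
  unfolding continuous_map_def topspace_cadlag_topology openin_cadlag_topology
proof (intro conjI allI impI)
  fix U :: "real set" assume "openin euclidean U"
  then have U: "open U" by simp
  show "cadlag_open {x \<in> cadlag_paths. h x \<in> U}"
  proof (rule cadlag_open_if_balls)
    fix x assume x: "x \<in> {x \<in> cadlag_paths. h x \<in> U}"
    then obtain e where e: "e > 0" "\<And>z. \<bar>z - h x\<bar> < e \<Longrightarrow> z \<in> U"
      using U unfolding open_dist by (auto simp: dist_real_def)
    have L: "L > 0" using assms by (simp add: path_lipschitz_def)
    show "\<exists>e>0. \<forall>y\<in>cadlag_paths. path_dist x y < e \<longrightarrow> y \<in> {x \<in> cadlag_paths. h x \<in> U}"
    proof (intro exI[of _ "e / L"] conjI ballI impI)
      fix y assume y: "y \<in> cadlag_paths" "path_dist x y < e / L"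
      have "\<bar>h y - h x\<bar> \<le> L * path_dist x y"
        using assms x y by (auto simp: path_lipschitz_def abs_minus_commute)
      also have "\<dots> < e" using y L by (simp add: field_simps)
      finally show "y \<in> {x \<in> cadlag_paths. h x \<in> U}" using y e by auto
    qed (use e L in auto)
  qed auto
qed auto

lemma measurable_borel_of_continuous:
  assumes "continuous_map T euclideanreal h"
  shows "h \<in> borel_measurable (borel_of T)"
proof (rule borel_measurableI)
  fix S :: "real set" assume "open S"
  then have "openin T {x \<in> topspace T. h x \<in> S}" using assms by (auto simp: continuous_map_def)
  moreover have "{U. openin T U} \<subseteq> Pow (topspace T)" by (auto dest: openin_subset)
  moreover from this have "h -` S \<inter> space (borel_of T) = {x \<in> topspace T. h x \<in> S}"
    by (auto simp: borel_of_def space_measure_of)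
  ultimately show "h -` S \<inter> space (borel_of T) \<in> sets (borel_of T)"
    by (auto simp: borel_of_def)
qed

lemma space_borel_of: "space (borel_of T) = topspace T"
proof -
  have "{U. openin T U} \<subseteq> Pow (topspace T)" by (auto dest: openin_subset)
  then show ?thesis by (simp add: borel_of_def space_measure_of)
qed

text \<open>The distance to the complement recognizes an open set. It reduces measurability of
  path-valued maps to that of real-valued ones.\<close>

lemma path_lipschitz_separates:
  assumes "cadlag_open U" "U \<noteq> cadlag_paths"
  obtains g where "path_lipschitz 1 g" "\<And>x. x \<in> cadlag_paths \<Longrightarrow> x \<in> U \<longleftrightarrow> g x > 0"
proof -
  define F where "F = cadlag_paths - U"
  have U: "U \<subseteq> cadlag_paths" using assms(1) by (simp add: cadlag_open_def)
  have F: "F \<noteq> {}" using U assms(2) by (auto simp: F_def)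
  define g where "g x = (INF y\<in>F. path_dist x y)" for x
  have bdd: "bdd_below (path_dist x ` F)" for x
    by (rule bdd_belowI2[where m = 0]) (rule path_dist_nonneg)
  have gle: "g x \<le> path_dist x y + g y" for x y
  proof -
    have "g x - path_dist x y \<le> path_dist y z" if "z \<in> F" for z
      using cINF_lower[OF bdd that, of x] path_dist_triangle[of x z y] by (simp add: g_def)
    then have "g x - path_dist x y \<le> g y" unfolding g_def[of y] by (intro cINF_greatest[OF F])
    then show ?thesis by linarith
  qed
  show ?thesis
  proof (rule that[of g])
    show "path_lipschitz 1 g"
      unfolding path_lipschitz_def
    proof (intro conjI ballI)
      fix x y show "\<bar>g x - g y\<bar> \<le> 1 * path_dist x y"
        using gle[of x y] gle[of y x] path_dist_commute[of x y] by linarith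
    qed simp
    fix x assume x: "x \<in> cadlag_paths"
    show "x \<in> U \<longleftrightarrow> g x > 0"
    proof
      assume "x \<in> U"
      then obtain e where e: "e > 0" "\<And>y. y \<in> cadlag_paths \<Longrightarrow> path_dist x y < e \<Longrightarrow> y \<in> U"
        using cadlag_open_ball[OF assms(1)] by metis
      have "e \<le> g x" unfolding g_def
        by (rule cINF_greatest[OF F]) (use e(2) in \<open>force simp: F_def not_less[symmetric]\<close>)
      then show "g x > 0" using e by linarith
    next
      assume "g x > 0"
      then show "x \<in> U" using cINF_lower[OF bdd, of x x] x by (auto simp: F_def g_def)
    qed
  qed
qed

lemma measurable_cadlag_lipschitzI:
  assumes "\<And>\<omega>. \<omega> \<in> space M \<Longrightarrow> X \<omega> \<in> cadlag_paths"
    and "\<And>g. path_lipschitz 1 g \<Longrightarrow> (\<lambda>\<omega>. g (X \<omega>)) \<in> borel_measurable M"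
  shows "X \<in> M \<rightarrow>\<^sub>M borel_of cadlag_topology"
  unfolding borel_of_def
proof (rule measurable_measure_of)
  fix U assume "U \<in> {U. openin cadlag_topology U}"
  then have U: "cadlag_open U" by (simp add: openin_cadlag_topology)
  show "X -` U \<inter> space M \<in> sets M"
  proof (cases "U = cadlag_paths")
    case True
    then have "X -` U \<inter> space M = space M" using assms(1) by auto
    then show ?thesis by simp
  next
    case False
    then obtain g where g: "path_lipschitz 1 g" "\<And>x. x \<in> cadlag_paths \<Longrightarrow> x \<in> U \<longleftrightarrow> g x > 0"
      using path_lipschitz_separates[OF U] by metis
    have "X -` U \<inter> space M = {\<omega> \<in> space M. g (X \<omega>) > 0}" using g(2) assms(1) by auto
    then show ?thesis using assms(2)[OF g(1)] by simp
  qed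
qed (use assms(1) in \<open>auto simp: openin_cadlag_topology cadlag_open_def topspace_cadlag_topology\<close>)

lemma path_lipschitz_measurable:
  assumes "path_lipschitz L g" "X \<in> M \<rightarrow>\<^sub>M borel_of cadlag_topology"
  shows "(\<lambda>\<omega>. g (X \<omega>)) \<in> borel_measurable M"
  using measurable_compose[OF assms(2) measurable_borel_of_continuous[OF path_lipschitz_continuous[OF assms(1)]]] .

lemma path_lipschitz_limit:
  assumes "path_lipschitz L g" "\<And>n. x n \<in> cadlag_paths" "y \<in> cadlag_paths"
    and "(\<lambda>n. path_dist (x n) y) \<longlonglongrightarrow> 0"
  shows "(\<lambda>n. g (x n)) \<longlonglongrightarrow> g y"
proof (rule LIM_zero_cancel, rule Lim_null_comparison)
  show "\<forall>\<^sub>F n in sequentially. norm (g (x n) - g y) \<le> L * path_dist (x n) y"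
    using assms by (auto simp: path_lipschitz_def)
  show "(\<lambda>n. L * path_dist (x n) y) \<longlonglongrightarrow> 0" using tendsto_mult_left[OF assms(4), of L] by simp
qed

text \<open>The path space is not separable, so measurability does not follow from that of the
  coordinates, but it passes to limits: both the rescaled degree process and Brownian motion
  are limits of paths that depend on finitely many random variables.\<close>

lemma measurable_cadlag_limit:
  assumes "\<And>n. X n \<in> M \<rightarrow>\<^sub>M borel_of cadlag_topology"
    and Y: "\<And>\<omega>. \<omega> \<in> space M \<Longrightarrow> Y \<omega> \<in> cadlag_paths"
    and "\<And>\<omega>. \<omega> \<in> space M \<Longrightarrow> (\<lambda>n. path_dist (X n \<omega>) (Y \<omega>)) \<longlonglongrightarrow> 0"
  shows "Y \<in> M \<rightarrow>\<^sub>M borel_of cadlag_topology"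
proof (rule measurable_cadlag_lipschitzI[OF Y])
  fix g assume g: "path_lipschitz 1 g"
  show "(\<lambda>\<omega>. g (Y \<omega>)) \<in> borel_measurable M"
  proof (rule borel_measurable_LIMSEQ_real)
    fix \<omega> assume w: "\<omega> \<in> space M"
    have "X n \<omega> \<in> cadlag_paths" for n
      using measurable_space[OF assms(1) w] by (simp add: space_borel_of topspace_cadlag_topology)
    then show "(\<lambda>n. g (X n \<omega>)) \<longlonglongrightarrow> g (Y \<omega>)"
      using path_lipschitz_limit[OF g _ Y[OF w] assms(3)[OF w]] by blast
  qed (rule path_lipschitz_measurable[OF g assms(1)])
qed

text \<open>Inf-convolution with a multiple of the metric: the \<open>k\<close>-th minorant at \<open>x\<close> is the infimum of \<open>h y
  + (k + 1) d(x, y)\<close> over \<open>y\<close>. When the slope is large, only \<open>y\<close> near \<open>x\<close> matter, and there \<open>h\<close> is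
  nearly constant.\<close>

lemma lipschitz_minorants:
  assumes h: "continuous_map cadlag_topology euclideanreal h" and B: "\<And>x. x \<in> cadlag_paths \<Longrightarrow> \<bar>h x\<bar> \<le> B"
  obtains g where "\<And>k. path_lipschitz (real (Suc k)) (g k)"
    "\<And>k x. x \<in> cadlag_paths \<Longrightarrow> \<bar>g k x\<bar> \<le> B" "\<And>k x. x \<in> cadlag_paths \<Longrightarrow> g k x \<le> h x"
    "\<And>x. x \<in> cadlag_paths \<Longrightarrow> (\<lambda>k. g k x) \<longlonglongrightarrow> h x"
proof -
  define g where "g k x = (INF y\<in>cadlag_paths. h y + real (Suc k) * path_dist x y)" for k x
  have ne: "cadlag_paths \<noteq> {}"
  proof -
    have "(\<lambda>t\<in>{0..}. 0) \<in> cadlag_paths" unfolding cadlag_paths_def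
    proof (intro CollectI conjI allI impI)
      fix t :: real assume t: "t \<ge> 0"
      have "\<forall>\<^sub>F s in at_right t. (\<lambda>t\<in>{0..}. 0::real) s = 0"
        using t by (auto simp: eventually_at_filter)
      then show "((\<lambda>t\<in>{0..}. 0::real) \<longlongrightarrow> (\<lambda>t\<in>{0..}. 0) t) (at_right t)"
        using t by (simp add: tendsto_eventually)
    next
      fix t :: real assume t: "t > 0"
      have "\<forall>\<^sub>F s in at_left t. (\<lambda>t\<in>{0..}. 0::real) s = 0"
        using eventually_at_left_real[OF t] by eventually_elim auto
      then show "\<exists>l. ((\<lambda>t\<in>{0..}. 0::real) \<longlongrightarrow> l) (at_left t)"
        using tendsto_eventually by blast
    qed simp
    then show ?thesis by blast
  qed
  have low: "- B \<le> h y + real (Suc k) * path_dist x y" if "y \<in> cadlag_paths" for k x y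
    using B[OF that] mult_nonneg_nonneg[OF of_nat_0_le_iff[of "Suc k"] path_dist_nonneg[of x y]] by linarith
  have bdd: "bdd_below ((\<lambda>y. h y + real (Suc k) * path_dist x y) ` cadlag_paths)" for k x
    by (rule bdd_belowI2[where m = "- B"]) (rule low)
  have gh: "g k x \<le> h x" if "x \<in> cadlag_paths" for k x
    using cINF_lower[OF bdd that, of k x] by (simp add: g_def)
  have gB: "- B \<le> g k x" for k x
    unfolding g_def by (rule cINF_greatest[OF ne low])
  have gle: "g k x \<le> real (Suc k) * path_dist x y + g k y" for k x y
  proof -
    have "g k x - real (Suc k) * path_dist x y \<le> h z + real (Suc k) * path_dist y z" if "z \<in> cadlag_paths" for z
    proof -
      have "g k x \<le> h z + real (Suc k) * path_dist x z"
        using cINF_lower[OF bdd that, of k x] by (simp add: g_def)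
      also have "\<dots> \<le> h z + real (Suc k) * (path_dist x y + path_dist y z)"
        by (intro add_left_mono mult_left_mono path_dist_triangle) auto
      finally show ?thesis by (simp add: algebra_simps)
    qed
    then have "g k x - real (Suc k) * path_dist x y \<le> g k y"
      unfolding g_def[of k y] by (intro cINF_greatest[OF ne])
    then show ?thesis by linarith
  qed
  show ?thesis
  proof (rule that[of g])
    show "path_lipschitz (real (Suc k)) (g k)" for k
      unfolding path_lipschitz_def
    proof (intro conjI ballI)
      fix x y show "\<bar>g k x - g k y\<bar> \<le> real (Suc k) * path_dist x y"
        using gle[of k x y] gle[of k y x] path_dist_commute[of x y] by (simp add: abs_le_iff)
    qed simp
    show "\<bar>g k x\<bar> \<le> B" if "x \<in> cadlag_paths" for k x
      using gB[of k x] gh[OF that, of k] B[OF that] by linarith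
    fix x assume x: "x \<in> cadlag_paths"
    show "g k x \<le> h x" for k by (rule gh[OF x])
    show "(\<lambda>k. g k x) \<longlonglongrightarrow> h x"
    proof (rule LIMSEQ_I)
      fix e :: real assume e: "e > 0"
      \<comment> \<open>Near \<open>x\<close> continuity bounds \<open>h\<close> from below; far from \<open>x\<close> the penalty exceeds the oscillation \<open>2 B\<close>.\<close>
      have "cadlag_open {y \<in> cadlag_paths. h y \<in> {h x - e / 2<..}}"
        using h unfolding continuous_map_def topspace_cadlag_topology openin_cadlag_topology
        by (metis open_greaterThan open_openin)
      then obtain r where r: "r > 0"
        "\<And>y. y \<in> cadlag_paths \<Longrightarrow> path_dist x y < r \<Longrightarrow> h y > h x - e / 2"
        by (rule cadlag_open_ball[of _ x]) (use x e in auto)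
      obtain k0 where k0: "real k0 > 2 * B / r" using reals_Archimedean2 by blast
      have "norm (g k x - h x) < e" if k: "k \<ge> k0" for k
      proof -
        have "h x - e / 2 \<le> g k x" unfolding g_def
        proof (rule cINF_greatest[OF ne])
          fix y assume y: "y \<in> cadlag_paths"
          show "h x - e / 2 \<le> h y + real (Suc k) * path_dist x y"
          proof (cases "path_dist x y < r")
            case True
            moreover have "real (Suc k) * path_dist x y \<ge> 0" by (simp add: path_dist_nonneg)
            ultimately show ?thesis using r(2)[OF y] by linarith
          next
            case False
            have "2 * B \<le> real (Suc k) * r"
            proof -
              have "2 * B / r \<le> real (Suc k)" using k0 k by simp
              then show ?thesis using r by (simp add: field_simps)
            qed
            also have "\<dots> \<le> real (Suc k) * path_dist x y" using False by (intro mult_left_mono) auto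
            finally show ?thesis using B[OF x] B[OF y] e by linarith
          qed
        qed
        then show ?thesis using gh[OF x, of k] e by simp
      qed
      then show "\<exists>no. \<forall>n\<ge>no. norm (g n x - h x) < e" by blast
    qed
  qed
qed

lemma cadlag_random_element_in_paths:
  "X \<in> M \<rightarrow>\<^sub>M borel_of cadlag_topology \<Longrightarrow> \<omega> \<in> space M \<Longrightarrow> X \<omega> \<in> cadlag_paths"
  using measurable_space[of X M "borel_of cadlag_topology" \<omega>]
  by (simp add: space_borel_of topspace_cadlag_topology)

text \<open>Increasing approximation by Lipschitz functionals bounds the lower limit of the expectations
  from below for every bounded continuous functional. Applied to the functional and to its
  negative, this gives convergence.\<close>

lemma converges_in_distribution_lipschitzI:
  assumes "prob_space M" "prob_space N"
    and X: "\<forall>\<^sub>F i in F. X i \<in> M \<rightarrow>\<^sub>M borel_of cadlag_topology"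
    and Y: "Y \<in> N \<rightarrow>\<^sub>M borel_of cadlag_topology"
    and conv: "\<And>L B h. path_lipschitz L h \<Longrightarrow> (\<And>x. x \<in> cadlag_paths \<Longrightarrow> \<bar>h x\<bar> \<le> B) \<Longrightarrow>
        ((\<lambda>i. LINT \<omega>|M. h (X i \<omega>)) \<longlongrightarrow> (LINT \<omega>|N. h (Y \<omega>))) F"
  shows "converges_in_distribution cadlag_topology F M X N Y"
proof -
  interpret M: prob_space M by fact
  interpret N: prob_space N by fact
  have low: "\<forall>\<^sub>F i in F. (LINT \<omega>|M. h (X i \<omega>)) > (LINT \<omega>|N. h (Y \<omega>)) - e"
    if h: "continuous_map cadlag_topology euclideanreal h" and B: "\<And>x. x \<in> cadlag_paths \<Longrightarrow> \<bar>h x\<bar> \<le> B"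
      and e: "e > 0" for h B e
  proof -
    obtain g where g: "\<And>k. path_lipschitz (real (Suc k)) (g k)"
      "\<And>k x. x \<in> cadlag_paths \<Longrightarrow> \<bar>g k x\<bar> \<le> B" "\<And>k x. x \<in> cadlag_paths \<Longrightarrow> g k x \<le> h x"
      "\<And>x. x \<in> cadlag_paths \<Longrightarrow> (\<lambda>k. g k x) \<longlonglongrightarrow> h x"
      using lipschitz_minorants[OF h B] by metis
    have mN: "(\<lambda>\<omega>. g k (Y \<omega>)) \<in> borel_measurable N" for k
      by (rule path_lipschitz_measurable[OF g(1) Y])
    have hm: "h \<in> borel_measurable (borel_of cadlag_topology)" by (rule measurable_borel_of_continuous[OF h])
    have "(\<lambda>k. LINT \<omega>|N. g k (Y \<omega>)) \<longlonglongrightarrow> (LINT \<omega>|N. h (Y \<omega>))"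
    proof (rule integral_dominated_convergence[where w = "\<lambda>_. B"])
      show "(\<lambda>\<omega>. h (Y \<omega>)) \<in> borel_measurable N" using measurable_compose[OF Y hm] .
    qed (use mN g cadlag_random_element_in_paths[OF Y] in auto)
    then have "\<forall>\<^sub>F k in sequentially. (LINT \<omega>|N. g k (Y \<omega>)) > (LINT \<omega>|N. h (Y \<omega>)) - e"
      using e by (intro order_tendstoD) auto
    then obtain k where k: "(LINT \<omega>|N. g k (Y \<omega>)) > (LINT \<omega>|N. h (Y \<omega>)) - e"
      using eventually_happens trivial_limit_sequentially by blast
    have "\<forall>\<^sub>F i in F. (LINT \<omega>|M. g k (X i \<omega>)) > (LINT \<omega>|N. h (Y \<omega>)) - e"
      using conv[OF g(1) g(2)] k by (intro order_tendstoD) auto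
    then show ?thesis using X
    proof eventually_elim
      case (elim i)
      have "(LINT \<omega>|M. g k (X i \<omega>)) \<le> (LINT \<omega>|M. h (X i \<omega>))"
      proof (rule integral_mono)
        show "integrable M (\<lambda>\<omega>. g k (X i \<omega>))"
          by (rule M.integrable_const_bound[where B = B])
            (use g(2) cadlag_random_element_in_paths[OF elim(2)] path_lipschitz_measurable[OF g(1) elim(2)] in auto)
        show "integrable M (\<lambda>\<omega>. h (X i \<omega>))"
          by (rule M.integrable_const_bound[where B = B])
            (use B cadlag_random_element_in_paths[OF elim(2)] measurable_compose[OF elim(2) hm] in auto)
      qed (use g(3) cadlag_random_element_in_paths[OF elim(2)] in auto)
      then show ?case using elim by linarith
    qed
  qed
  show ?thesis unfolding converges_in_distribution_def
  proof (intro conjI X Y allI impI)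
    fix h assume h: "continuous_map cadlag_topology euclideanreal h \<and> bounded (h ` topspace cadlag_topology)"
    then obtain B where B: "\<And>x. x \<in> cadlag_paths \<Longrightarrow> \<bar>h x\<bar> \<le> B"
      by (auto simp: bounded_iff topspace_cadlag_topology)
    have h': "continuous_map cadlag_topology euclideanreal (\<lambda>x. - h x)"
      using h by (simp add: continuous_map_minus)
    have B': "\<bar>- h x\<bar> \<le> B" if "x \<in> cadlag_paths" for x using B[OF that] by simp
    show "((\<lambda>i. LINT \<omega>|M. h (X i \<omega>)) \<longlongrightarrow> (LINT \<omega>|N. h (Y \<omega>))) F"
    proof (rule tendstoI)
      fix e :: real assume e: "e > 0"
      have "\<forall>\<^sub>F i in F. (LINT \<omega>|M. h (X i \<omega>)) > (LINT \<omega>|N. h (Y \<omega>)) - e"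
        by (rule low[OF conjunct1[OF h] _ e]) (rule B)
      moreover have "\<forall>\<^sub>F i in F. (LINT \<omega>|M. - h (X i \<omega>)) > (LINT \<omega>|N. - h (Y \<omega>)) - e"
        by (rule low[OF h' _ e]) (rule B')
      ultimately show "\<forall>\<^sub>F i in F. dist (LINT \<omega>|M. h (X i \<omega>)) (LINT \<omega>|N. h (Y \<omega>)) < e"
        by eventually_elim (simp add: dist_real_def)
    qed
  qed
qed



section \<open>Martingales with bounded increments\<close>

text \<open>Conditional expectations are expressed by testing with bounded \<open>F n\<close>-measurable weights; \<open>v n\<close>
  is the conditional variance of \<open>\<xi> n\<close>.\<close>

locale martingale_differences = prob_space M
  for M :: "'a measure" and F :: "nat \<Rightarrow> 'a measure" and \<xi> v :: "nat \<Rightarrow> 'a \<Rightarrow> real" and c :: real +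
  assumes subalgebra_F: "\<And>n. subalgebra M (F n)"
    and increasing_F: "\<And>n. subalgebra (F (Suc n)) (F n)"
    and adapted: "\<And>n. \<xi> n \<in> borel_measurable (F (Suc n))"
    and predictable: "\<And>n. v n \<in> borel_measurable (F n)"
    and bounded_xi: "\<And>n \<omega>. \<omega> \<in> space M \<Longrightarrow> \<bar>\<xi> n \<omega>\<bar> \<le> c"
    and v_nonneg: "\<And>n \<omega>. \<omega> \<in> space M \<Longrightarrow> 0 \<le> v n \<omega>"
    and v_le: "\<And>n \<omega>. \<omega> \<in> space M \<Longrightarrow> v n \<omega> \<le> c\<^sup>2"
    and centred: "\<And>n Y B. Y \<in> borel_measurable (F n) \<Longrightarrow> (\<And>\<omega>. \<omega> \<in> space M \<Longrightarrow> \<bar>Y \<omega>\<bar> \<le> B) \<Longrightarrow>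
      expectation (\<lambda>\<omega>. Y \<omega> * \<xi> n \<omega>) = 0"
    and conditional_variance: "\<And>n Y B. Y \<in> borel_measurable (F n) \<Longrightarrow> (\<And>\<omega>. \<omega> \<in> space M \<Longrightarrow> \<bar>Y \<omega>\<bar> \<le> B) \<Longrightarrow>
      expectation (\<lambda>\<omega>. Y \<omega> * (\<xi> n \<omega>)\<^sup>2) = expectation (\<lambda>\<omega>. Y \<omega> * v n \<omega>)"
begin

definition S :: "nat \<Rightarrow> 'a \<Rightarrow> real" where "S n \<omega> = (\<Sum>l<n. \<xi> l \<omega>)"

definition V :: "nat \<Rightarrow> 'a \<Rightarrow> real" where "V n \<omega> = (\<Sum>l<n. v l \<omega>)"

lemma S_Suc: "S (Suc n) \<omega> = S n \<omega> + \<xi> n \<omega>" by (simp add: S_def)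
lemma V_Suc: "V (Suc n) \<omega> = V n \<omega> + v n \<omega>" by (simp add: V_def)

lemma c_nonneg: "0 \<le> c"
proof -
  obtain \<omega> where "\<omega> \<in> space M" using not_empty by blast
  then show ?thesis using bounded_xi[of \<omega> 0] by linarith
qed

lemma F_mono: assumes "m \<le> n" shows "subalgebra (F n) (F m)"
  using assms
proof (induction n rule: dec_induct)
  case base then show ?case by (simp add: subalgebra_def)
next
  case (step n) then show ?case using increasing_F[of n] by (auto simp: subalgebra_def)
qed

lemma measurable_F_mono: "m \<le> n \<Longrightarrow> Y \<in> F m \<rightarrow>\<^sub>M N \<Longrightarrow> Y \<in> F n \<rightarrow>\<^sub>M N"
  using measurable_from_subalg[OF F_mono] .

lemma measurable_F_M: "Y \<in> F m \<rightarrow>\<^sub>M N \<Longrightarrow> Y \<in> M \<rightarrow>\<^sub>M N"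
  using measurable_from_subalg[OF subalgebra_F] .

lemma space_F [simp]: "space (F n) = space M" using subalgebra_F by (simp add: subalgebra_def)

lemma S_measurable_F: "m \<le> n \<Longrightarrow> S m \<in> borel_measurable (F n)"
  unfolding S_def by (intro borel_measurable_sum measurable_F_mono[OF _ adapted]) auto

lemma V_measurable_F: "m \<le> Suc n \<Longrightarrow> V m \<in> borel_measurable (F n)"
  unfolding V_def by (intro borel_measurable_sum measurable_F_mono[OF _ predictable]) auto

lemma S_measurable [measurable]: "S n \<in> borel_measurable M"
  by (rule measurable_F_M[OF S_measurable_F[OF order_refl]])

lemma V_measurable [measurable]: "V n \<in> borel_measurable M"
  by (rule measurable_F_M[OF V_measurable_F[of n n]]) simp

lemma xi_measurable [measurable]: "\<xi> n \<in> borel_measurable M"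
  by (rule measurable_F_M[OF adapted])

lemma v_measurable [measurable]: "v n \<in> borel_measurable M"
  by (rule measurable_F_M[OF predictable])

lemma S_bound: "\<omega> \<in> space M \<Longrightarrow> \<bar>S n \<omega>\<bar> \<le> real n * c"
proof (induction n)
  case (Suc n) then show ?case using bounded_xi[of \<omega> n] by (simp add: S_Suc algebra_simps)
qed (simp add: S_def)

lemma V_bound: "\<omega> \<in> space M \<Longrightarrow> \<bar>V n \<omega>\<bar> \<le> real n * c\<^sup>2"
proof (induction n)
  case (Suc n) then show ?case using v_le[of \<omega> n] v_nonneg[of \<omega> n] by (simp add: V_Suc algebra_simps)
qed (simp add: V_def)

lemma V_mono: "m \<le> n \<Longrightarrow> \<omega> \<in> space M \<Longrightarrow> V m \<omega> \<le> V n \<omega>"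
  unfolding V_def by (rule sum_mono2) (auto simp: v_nonneg)

lemma integrable_boundedI:
  fixes X :: "'a \<Rightarrow> 'b::{banach, second_countable_topology}"
  shows "X \<in> borel_measurable M \<Longrightarrow> (\<And>\<omega>. \<omega> \<in> space M \<Longrightarrow> norm (X \<omega>) \<le> B) \<Longrightarrow> integrable M X"
  by (rule integrable_const_bound[where B = B]) auto

lemma integrable_S [intro, simp]: "integrable M (S n)"
  by (rule integrable_boundedI[where B = "real n * c"]) (auto simp: S_bound)

lemma integrable_V [intro, simp]: "integrable M (V n)"
  by (rule integrable_boundedI[where B = "real n * c\<^sup>2"]) (auto simp: V_bound)

lemma integrable_v [intro, simp]: "integrable M (v n)"
  by (rule integrable_boundedI[where B = "c\<^sup>2"]) (auto simp: v_nonneg v_le)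

lemma xi_sq_le: "\<omega> \<in> space M \<Longrightarrow> (\<xi> n \<omega>)\<^sup>2 \<le> c\<^sup>2"
  using bounded_xi[of \<omega> n] by (metis abs_ge_zero power2_abs power_mono)

lemma integrable_xi_sq [intro, simp]: "integrable M (\<lambda>\<omega>. (\<xi> n \<omega>)\<^sup>2)"
  by (rule integrable_boundedI[where B = "c\<^sup>2"]) (auto simp: xi_sq_le)

lemma centred_sum:
  assumes "m \<le> n" "Y \<in> borel_measurable (F m)" "\<And>\<omega>. \<omega> \<in> space M \<Longrightarrow> \<bar>Y \<omega>\<bar> \<le> B"
  shows "expectation (\<lambda>\<omega>. Y \<omega> * (S n \<omega> - S m \<omega>)) = 0"
  using assms(1)
proof (induction n rule: dec_induct)
  case (step n)
  have [measurable]: "Y \<in> borel_measurable M" using measurable_F_M[OF assms(2)] .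
  have i1: "integrable M (\<lambda>\<omega>. Y \<omega> * (S n \<omega> - S m \<omega>))"
  proof (rule integrable_boundedI[where B = "B * (real n * c + real m * c)"])
    fix \<omega> assume w: "\<omega> \<in> space M"
    have "\<bar>S n \<omega> - S m \<omega>\<bar> \<le> real n * c + real m * c" using S_bound[OF w, of n] S_bound[OF w, of m] by linarith
    then show "norm (Y \<omega> * (S n \<omega> - S m \<omega>)) \<le> B * (real n * c + real m * c)"
      using assms(3)[OF w] by (auto simp: abs_mult intro!: mult_mono)
  qed simp
  have i2: "integrable M (\<lambda>\<omega>. Y \<omega> * \<xi> n \<omega>)"
  proof (rule integrable_boundedI[where B = "B * c"])
    fix \<omega> assume w: "\<omega> \<in> space M"
    show "norm (Y \<omega> * \<xi> n \<omega>) \<le> B * c"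
      using assms(3)[OF w] bounded_xi[OF w, of n] by (auto simp: abs_mult intro!: mult_mono)
  qed simp
  have "expectation (\<lambda>\<omega>. Y \<omega> * (S (Suc n) \<omega> - S m \<omega>)) =
      expectation (\<lambda>\<omega>. Y \<omega> * (S n \<omega> - S m \<omega>) + Y \<omega> * \<xi> n \<omega>)"
    by (simp add: S_Suc algebra_simps)
  also have "\<dots> = 0"
    using i1 i2 step centred[OF measurable_F_mono[OF step(1) assms(2)] assms(3)] by simp
  finally show ?case .
qed simp

lemma variance_sum:
  assumes "m \<le> n"
  shows "expectation (\<lambda>\<omega>. (S n \<omega> - S m \<omega>)\<^sup>2) = expectation (\<lambda>\<omega>. V n \<omega> - V m \<omega>)"
  using assms
proof (induction n rule: dec_induct)
  case (step n)
  define Y where "Y \<omega> = S n \<omega> - S m \<omega>" for \<omega>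
  have Y: "Y \<in> borel_measurable (F n)" unfolding Y_def
    using S_measurable_F[of n n] S_measurable_F[OF step(1)] by measurable
  have [measurable]: "Y \<in> borel_measurable M" using measurable_F_M[OF Y] .
  have YB: "\<bar>Y \<omega>\<bar> \<le> real n * c + real m * c" if w: "\<omega> \<in> space M" for \<omega>
    unfolding Y_def using S_bound[OF w, of n] S_bound[OF w, of m] by linarith
  have i1: "integrable M (\<lambda>\<omega>. (Y \<omega>)\<^sup>2)"
  proof (rule integrable_boundedI[where B = "(real n * c + real m * c)\<^sup>2"])
    fix \<omega> assume w: "\<omega> \<in> space M"
    show "norm ((Y \<omega>)\<^sup>2) \<le> (real n * c + real m * c)\<^sup>2"
      using power_mono[OF YB[OF w], of 2] by simp
  qed simp
  have i2: "integrable M (\<lambda>\<omega>. Y \<omega> * \<xi> n \<omega>)"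
  proof (rule integrable_boundedI[where B = "(real n * c + real m * c) * c"])
    fix \<omega> assume w: "\<omega> \<in> space M"
    show "norm (Y \<omega> * \<xi> n \<omega>) \<le> (real n * c + real m * c) * c"
      using YB[OF w] bounded_xi[OF w, of n] c_nonneg by (auto simp: abs_mult intro!: mult_mono)
  qed simp
  have e2: "expectation (\<lambda>\<omega>. Y \<omega> * \<xi> n \<omega>) = 0" by (rule centred[OF Y YB])
  have e3: "expectation (\<lambda>\<omega>. (\<xi> n \<omega>)\<^sup>2) = expectation (v n)"
    using conditional_variance[of "\<lambda>_. 1" n 1] by simp
  have "expectation (\<lambda>\<omega>. (S (Suc n) \<omega> - S m \<omega>)\<^sup>2) =
      expectation (\<lambda>\<omega>. (Y \<omega>)\<^sup>2 + 2 * (Y \<omega> * \<xi> n \<omega>) + (\<xi> n \<omega>)\<^sup>2)"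
    by (rule Bochner_Integration.integral_cong) (auto simp: S_Suc Y_def power2_eq_square algebra_simps)
  also have "\<dots> = expectation (\<lambda>\<omega>. (Y \<omega>)\<^sup>2) + expectation (v n)"
    using i1 i2 e2 e3 by simp
  also have "\<dots> = expectation (\<lambda>\<omega>. V (Suc n) \<omega> - V m \<omega>)"
    using step by (simp add: Y_def V_Suc)
  finally show ?case .
qed simp

lemma complex_expectation_zeroI:
  fixes X :: "'a \<Rightarrow> complex"
  assumes "integrable M X" "expectation (\<lambda>\<omega>. Re (X \<omega>)) = 0" "expectation (\<lambda>\<omega>. Im (X \<omega>)) = 0"
  shows "integral\<^sup>L M X = 0"
  using assms by (simp add: complex_eq_iff)

lemma norm_expectation_le:
  fixes X :: "'a \<Rightarrow> 'b::{banach, second_countable_topology}"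
  assumes "integrable M X" "integrable M Y" "\<And>\<omega>. \<omega> \<in> space M \<Longrightarrow> norm (X \<omega>) \<le> Y \<omega>"
  shows "norm (integral\<^sup>L M X) \<le> expectation Y"
  using assms by (intro order_trans[OF integral_norm_bound] integral_mono) auto

text \<open>Second order Taylor expansion of both exponentials. The linear term vanishes since \<open>\<xi> n\<close> is
  centred, the quadratic terms match up to the difference \<open>v n - r\<close>, and the remainders are
  bounded by multiples of \<open>\<xi>\<^sup>2\<close> and \<open>v\<close> because the increments are bounded.\<close>

lemma characteristic_step:
  fixes P :: "'a \<Rightarrow> complex" and \<theta> :: real
  assumes P: "P \<in> borel_measurable (F n)" and P1: "\<And>\<omega>. \<omega> \<in> space M \<Longrightarrow> cmod (P \<omega>) \<le> 1"
    and r: "r \<in> borel_measurable (F n)" "\<And>\<omega>. \<omega> \<in> space M \<Longrightarrow> 0 \<le> r \<omega>" "\<And>\<omega>. \<omega> \<in> space M \<Longrightarrow> r \<omega> \<le> v n \<omega>"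
  shows "cmod (CLINT \<omega>|M. P \<omega> * (iexp (\<theta> * \<xi> n \<omega>) - of_real (exp (- \<theta>\<^sup>2 * r \<omega> / 2))))
    \<le> (\<bar>\<theta>\<bar>^3 * c / 6 + \<theta>^4 * c\<^sup>2 / 8) * expectation (v n) + \<theta>\<^sup>2 / 2 * expectation (\<lambda>\<omega>. v n \<omega> - r \<omega>)"
proof -
  have [measurable]: "P \<in> borel_measurable M" using measurable_F_M[OF P] .
  have [measurable]: "r \<in> borel_measurable M" using measurable_F_M[OF r(1)] .
  define D where "D \<omega> = P \<omega> * (iexp (\<theta> * \<xi> n \<omega>) - of_real (exp (- \<theta>\<^sup>2 * r \<omega> / 2)))" for \<omega>
  \<comment> \<open>\<open>A\<close> and \<open>B\<close> are the parts of the expansion with mean zero; \<open>U\<close> bounds what is left.\<close>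
  define A where "A \<omega> = \<i> * \<theta> * (P \<omega> * \<xi> n \<omega>)" for \<omega>
  define B where "B \<omega> = \<theta>\<^sup>2 / 2 * (P \<omega> * of_real ((\<xi> n \<omega>)\<^sup>2 - v n \<omega>))" for \<omega>
  have [measurable]: "D \<in> borel_measurable M" "A \<in> borel_measurable M" "B \<in> borel_measurable M"
    unfolding D_def[abs_def] A_def[abs_def] B_def[abs_def] by measurable
  have PX: "integrable M (\<lambda>\<omega>. P \<omega> * of_real (X \<omega>))"
    if [measurable]: "X \<in> borel_measurable M" and X: "\<And>\<omega>. \<omega> \<in> space M \<Longrightarrow> \<bar>X \<omega>\<bar> \<le> b" for X b
  proof (rule integrable_boundedI[where B = "1 * b"])
    fix \<omega> assume w: "\<omega> \<in> space M"
    show "cmod (P \<omega> * of_real (X \<omega>)) \<le> 1 * b"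
      unfolding norm_mult using P1[OF w] X[OF w] by (intro mult_mono) auto
  qed measurable
  have Re: "(\<lambda>\<omega>. Re (P \<omega>)) \<in> borel_measurable (F n)" "\<And>\<omega>. \<omega> \<in> space M \<Longrightarrow> \<bar>Re (P \<omega>)\<bar> \<le> 1"
  proof -
    show "(\<lambda>\<omega>. Re (P \<omega>)) \<in> borel_measurable (F n)" using P by measurable
    show "\<bar>Re (P \<omega>)\<bar> \<le> 1" if "\<omega> \<in> space M" for \<omega>
      using abs_Re_le_cmod[of "P \<omega>"] P1[OF that] by linarith
  qed
  have Im: "(\<lambda>\<omega>. Im (P \<omega>)) \<in> borel_measurable (F n)" "\<And>\<omega>. \<omega> \<in> space M \<Longrightarrow> \<bar>Im (P \<omega>)\<bar> \<le> 1"
  proof -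
    show "(\<lambda>\<omega>. Im (P \<omega>)) \<in> borel_measurable (F n)" using P by measurable
    show "\<bar>Im (P \<omega>)\<bar> \<le> 1" if "\<omega> \<in> space M" for \<omega>
      using abs_Im_le_cmod[of "P \<omega>"] P1[OF that] by linarith
  qed
  have iA: "integrable M (\<lambda>\<omega>. P \<omega> * \<xi> n \<omega>)" by (rule PX) (auto intro: bounded_xi)
  have vb: "\<bar>(\<xi> n \<omega>)\<^sup>2 - v n \<omega>\<bar> \<le> c\<^sup>2" if "\<omega> \<in> space M" for \<omega>
    using xi_sq_le[OF that, of n] v_le[OF that, of n] v_nonneg[OF that, of n] zero_le_power2[of "\<xi> n \<omega>"] by linarith
  have iB: "integrable M (\<lambda>\<omega>. P \<omega> * of_real ((\<xi> n \<omega>)\<^sup>2 - v n \<omega>))" by (rule PX) (auto intro: vb)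
  have eA: "integral\<^sup>L M A = 0" and intA: "integrable M A"
  proof -
    have "(CLINT \<omega>|M. P \<omega> * \<xi> n \<omega>) = 0"
      by (rule complex_expectation_zeroI[OF iA]) (use centred[OF Re] centred[OF Im] in auto)
    then show "integral\<^sup>L M A = 0" using iA by (simp add: A_def[abs_def])
    show "integrable M A" using iA by (simp add: A_def[abs_def])
  qed
  have real_B: "expectation (\<lambda>\<omega>. Y \<omega> * ((\<xi> n \<omega>)\<^sup>2 - v n \<omega>)) = 0"
    if Y: "Y \<in> borel_measurable (F n)" "\<And>\<omega>. \<omega> \<in> space M \<Longrightarrow> \<bar>Y \<omega>\<bar> \<le> 1" for Y
  proof -
    have [measurable]: "Y \<in> borel_measurable M" using measurable_F_M[OF Y(1)] .
    have "integrable M (\<lambda>\<omega>. Y \<omega> * (\<xi> n \<omega>)\<^sup>2)"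
    proof (rule integrable_boundedI[where B = "1 * c\<^sup>2"])
      fix \<omega> assume "\<omega> \<in> space M"
      then show "norm (Y \<omega> * (\<xi> n \<omega>)\<^sup>2) \<le> 1 * c\<^sup>2" unfolding norm_mult
        using Y(2) xi_sq_le by (intro mult_mono) auto
    qed simp
    moreover have "integrable M (\<lambda>\<omega>. Y \<omega> * v n \<omega>)"
    proof (rule integrable_boundedI[where B = "1 * c\<^sup>2"])
      fix \<omega> assume "\<omega> \<in> space M"
      then show "norm (Y \<omega> * v n \<omega>) \<le> 1 * c\<^sup>2" unfolding norm_mult
        using Y(2) v_le v_nonneg by (intro mult_mono) auto
    qed simp
    ultimately show ?thesis using conditional_variance[OF Y] by (simp add: right_diff_distrib)
  qed
  have eB: "integral\<^sup>L M B = 0" and intB: "integrable M B"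
  proof -
    have "(CLINT \<omega>|M. P \<omega> * of_real ((\<xi> n \<omega>)\<^sup>2 - v n \<omega>)) = 0"
      by (rule complex_expectation_zeroI[OF iB]) (use real_B[OF Re] real_B[OF Im] in simp_all)
    then show "integral\<^sup>L M B = 0" using iB by (simp add: B_def[abs_def] del: of_real_diff)
    show "integrable M B" using iB by (simp add: B_def[abs_def] del: of_real_diff)
  qed
  have intD: "integrable M D"
  proof (rule integrable_boundedI[where B = "1 * 2"])
    fix \<omega> assume w: "\<omega> \<in> space M"
    have "cmod (iexp (\<theta> * \<xi> n \<omega>) - of_real (exp (- \<theta>\<^sup>2 * r \<omega> / 2))) \<le> 1 + 1"
      using r(2)[OF w] by (intro order_trans[OF norm_triangle_ineq4] add_mono) (auto simp: norm_exp_eq_Re)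
    then show "cmod (D \<omega>) \<le> 1 * 2"
      unfolding D_def norm_mult using P1[OF w] by (intro mult_mono) auto
  qed measurable
  define U where "U \<omega> = \<bar>\<theta>\<bar>^3 * c / 6 * (\<xi> n \<omega>)\<^sup>2 + \<theta>^4 * c\<^sup>2 / 8 * v n \<omega> + \<theta>\<^sup>2 / 2 * (v n \<omega> - r \<omega>)" for \<omega>
  have ir: "integrable M r"
    by (rule integrable_boundedI[where B = "c\<^sup>2"]) (use r order_trans[OF r(3) v_le] in auto)
  have intU: "integrable M U" using ir by (simp add: U_def[abs_def])
  have pt: "cmod (D \<omega> - A \<omega> + B \<omega>) \<le> U \<omega>" if w: "\<omega> \<in> space M" for \<omega>
  proof -
    define x where "x = \<theta> * \<xi> n \<omega>"
    define y where "y = \<theta>\<^sup>2 * r \<omega> / 2"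
    define R1 where "R1 = iexp x - (1 + \<i> * x - of_real (x\<^sup>2 / 2))"
    define R2 where "R2 = exp (- y) - (1 - y)"
    have y0: "0 \<le> y" using r(2)[OF w] by (simp add: y_def)
    have "R1 = iexp x - (\<Sum>k \<le> 2. (\<i> * x)^k / fact k)"
      by (simp add: R1_def numeral_2_eq_2 power_mult_distrib)
    then have R1: "cmod R1 \<le> \<bar>x\<bar>^3 / 6"
      using iexp_approx1[of x 2] by (simp add: fact_numeral numeral_3_eq_3)
    have R2: "\<bar>R2\<bar> \<le> y\<^sup>2 / 2"
    proof -
      have "exp (- y) \<ge> 1 - y" using exp_ge_add_one_self[of "- y"] by simp
      moreover have "exp (- y) \<le> 1 - y + y\<^sup>2 / 2"
      proof -
        have "1 + y + y\<^sup>2 / 2 \<le> exp y" using exp_lower_Taylor_quadratic[OF y0] by simp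
        moreover have "1 \<le> (1 + y + y\<^sup>2 / 2) * (1 - y + y\<^sup>2 / 2)"
          using zero_le_power2[of "y\<^sup>2"] by (simp add: algebra_simps power2_eq_square)
        moreover have p: "0 \<le> 1 - y + y\<^sup>2 / 2"
        proof -
          have "0 \<le> (1 - y)\<^sup>2 + 1" by simp
          then show ?thesis by (simp add: power2_eq_square algebra_simps)
        qed
        ultimately have "1 \<le> exp y * (1 - y + y\<^sup>2 / 2)"
          using mult_right_mono[of "1 + y + y\<^sup>2 / 2" "exp y" "1 - y + y\<^sup>2 / 2"] by linarith
        then show ?thesis by (simp add: exp_minus field_simps)
      qed
      ultimately show ?thesis by (simp add: R2_def)
    qed
    have "D \<omega> - A \<omega> + B \<omega> = P \<omega> * R1 - P \<omega> * of_real R2 - P \<omega> * of_real (\<theta>\<^sup>2 / 2 * (v n \<omega> - r \<omega>))"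
      unfolding D_def A_def B_def R1_def R2_def x_def y_def
      by (simp add: algebra_simps power_mult_distrib add_divide_distrib diff_divide_distrib)
    also have "cmod \<dots> \<le> cmod (P \<omega> * R1) + cmod (P \<omega> * of_real R2) + cmod (P \<omega> * of_real (\<theta>\<^sup>2 / 2 * (v n \<omega> - r \<omega>)))"
      by (meson add_mono norm_triangle_ineq4 order_trans order_refl)
    also have "\<dots> \<le> 1 * cmod R1 + 1 * \<bar>R2\<bar> + 1 * (\<theta>\<^sup>2 / 2 * (v n \<omega> - r \<omega>))"
    proof -
      have "cmod (of_real (\<theta>\<^sup>2 / 2 * (v n \<omega> - r \<omega>))) = \<theta>\<^sup>2 / 2 * (v n \<omega> - r \<omega>)"
        using r(3)[OF w] by (subst norm_of_real) simp
      moreover have "0 \<le> \<theta>\<^sup>2 / 2 * (v n \<omega> - r \<omega>)" using r(3)[OF w] by simp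
      ultimately show ?thesis
        unfolding norm_mult[of "P \<omega>"] using P1[OF w]
        by (intro add_mono mult_mono) (auto simp del: of_real_mult of_real_diff of_real_divide)
    qed
    also have "\<dots> \<le> \<bar>\<theta>\<bar>^3 * c / 6 * (\<xi> n \<omega>)\<^sup>2 + \<theta>^4 * c\<^sup>2 / 8 * v n \<omega> + \<theta>\<^sup>2 / 2 * (v n \<omega> - r \<omega>)"
    proof -
      have "\<bar>x\<bar>^3 = \<bar>\<theta>\<bar>^3 * (\<bar>\<xi> n \<omega>\<bar> * (\<xi> n \<omega>)\<^sup>2)"
      proof -
        have "\<bar>\<xi> n \<omega>\<bar>^3 = \<bar>\<xi> n \<omega>\<bar> * \<bar>\<xi> n \<omega>\<bar>\<^sup>2" by (simp add: power3_eq_cube power2_eq_square)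
        then show ?thesis by (simp add: x_def abs_mult power_mult_distrib)
      qed
      also have "\<dots> \<le> \<bar>\<theta>\<bar>^3 * (c * (\<xi> n \<omega>)\<^sup>2)"
        using bounded_xi[OF w, of n] by (intro mult_left_mono mult_right_mono) auto
      finally have 1: "\<bar>x\<bar>^3 / 6 \<le> \<bar>\<theta>\<bar>^3 * c / 6 * (\<xi> n \<omega>)\<^sup>2" by simp
      have "y\<^sup>2 / 2 = \<theta>^4 / 8 * (r \<omega> * r \<omega>)"
        by (simp add: y_def power2_eq_square power4_eq_xxxx)
      also have "\<dots> \<le> \<theta>^4 / 8 * (c\<^sup>2 * v n \<omega>)"
        using r(2,3)[OF w] v_le[OF w, of n] by (intro mult_left_mono mult_mono) auto
      finally show ?thesis using 1 R1 R2 by simp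
    qed
    finally show ?thesis by (simp add: U_def)
  qed
  have "cmod (CLINT \<omega>|M. D \<omega>) = cmod (CLINT \<omega>|M. D \<omega> - A \<omega> + B \<omega>)"
    using intD intA intB eA eB by simp
  also have "\<dots> \<le> expectation U"
    by (rule norm_expectation_le) (use intD intA intB intU pt in auto)
  also have "\<dots> = (\<bar>\<theta>\<bar>^3 * c / 6 + \<theta>^4 * c\<^sup>2 / 8) * expectation (v n) + \<theta>\<^sup>2 / 2 * expectation (\<lambda>\<omega>. v n \<omega> - r \<omega>)"
  proof -
    have "expectation (\<lambda>\<omega>. (\<xi> n \<omega>)\<^sup>2) = expectation (v n)"
      using conditional_variance[of "\<lambda>_. 1" n 1] by simp
    then show ?thesis using ir by (simp add: U_def[abs_def] algebra_simps)
  qed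
  finally show ?thesis by (simp add: D_def)
qed

text \<open>The conditional variances are random, so the Gaussian factor that compensates the
  characteristic function has to be random as well. Here \<open>\<rho> n\<close> is the part of the target
  variance \<open>T\<close> that is still unused, cut off at zero, and \<open>Q n\<close> attaches to the partial sum the
  characteristic function of a Gaussian variable of variance \<open>\<rho> n\<close>. The expectation of \<open>Q\<close> is
  nearly constant in \<open>n\<close>: it starts with the Gaussian value and ends near the characteristic
  function of the increment, as \<open>\<rho>\<close> is then small. The excess and the deficit of the accumulated
  variance add up to its distance to \<open>T\<close>.\<close>

lemma weighted_characteristic_bound:
  fixes \<theta> T :: real
  assumes "n0 \<le> n1" and w: "w \<in> borel_measurable (F n0)" "\<And>\<omega>. \<omega> \<in> space M \<Longrightarrow> \<bar>w \<omega>\<bar> \<le> 1" and "0 \<le> T"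
  shows "cmod ((CLINT \<omega>|M. w \<omega> * iexp (\<theta> * (S n1 \<omega> - S n0 \<omega>))) - of_real (expectation w * exp (- \<theta>\<^sup>2 * T / 2)))
    \<le> \<theta>\<^sup>2 / 2 * expectation (\<lambda>\<omega>. \<bar>V n1 \<omega> - V n0 \<omega> - T\<bar>)
      + (\<bar>\<theta>\<bar>^3 * c / 6 + \<theta>^4 * c\<^sup>2 / 8) * expectation (\<lambda>\<omega>. V n1 \<omega> - V n0 \<omega>)"
proof -
  define K where "K = \<bar>\<theta>\<bar>^3 * c / 6 + \<theta>^4 * c\<^sup>2 / 8"
  define \<rho> where "\<rho> n \<omega> = max 0 (T - (V n \<omega> - V n0 \<omega>))" for n \<omega>
  define g where "g n \<omega> = of_real (w \<omega>) * iexp (\<theta> * (S n \<omega> - S n0 \<omega>))" for n \<omega>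
  define Q where "Q n \<omega> = g n \<omega> * of_real (exp (- \<theta>\<^sup>2 * \<rho> n \<omega> / 2))" for n \<omega>
  have wM [measurable]: "w \<in> borel_measurable M" using measurable_F_M[OF w(1)] .
  have rF: "\<rho> n \<in> borel_measurable (F k)" if "n \<le> Suc k" "n0 \<le> k" for n k
  proof -
    have [measurable]: "V n \<in> borel_measurable (F k)" "V n0 \<in> borel_measurable (F k)"
      using V_measurable_F that by auto
    show ?thesis unfolding \<rho>_def by measurable
  qed
  have rM [measurable]: "\<rho> n \<in> borel_measurable M" for n
    unfolding \<rho>_def by measurable
  have gM [measurable]: "g n \<in> borel_measurable M" for n unfolding g_def by measurable
  have QM [measurable]: "Q n \<in> borel_measurable M" for n unfolding Q_def by measurable
  have r0: "0 \<le> \<rho> n \<omega>" for n \<omega> by (simp add: \<rho>_def)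
  have g1: "cmod (g n \<omega>) \<le> 1" if "\<omega> \<in> space M" for n \<omega>
    using w(2)[OF that] by (simp add: g_def norm_mult)
  have e1: "cmod (of_real (exp (- \<theta>\<^sup>2 * \<rho> n \<omega> / 2))) \<le> 1" for n \<omega>
    using r0[of n \<omega>] by simp
  have Q1: "cmod (Q n \<omega>) \<le> 1" if "\<omega> \<in> space M" for n \<omega>
    unfolding Q_def norm_mult using mult_mono[OF g1[OF that] e1] by fastforce
  have intQ: "integrable M (Q n)" and intg: "integrable M (g n)" for n
    by (rule integrable_boundedI[where B = 1]; use Q1 g1 in simp)+
  have rT: "\<bar>\<rho> n \<omega>\<bar> \<le> T" if "\<omega> \<in> space M" "n0 \<le> n" for n \<omega>
    using V_mono[OF that(2,1)] \<open>0 \<le> T\<close> by (simp add: \<rho>_def)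
  have intr: "integrable M (\<rho> n)" if "n0 \<le> n" for n
    by (rule integrable_boundedI[where B = T]) (use rT that in auto)
  have step: "cmod (integral\<^sup>L M (Q n) - integral\<^sup>L M (Q n0)) \<le>
      K * expectation (\<lambda>\<omega>. V n \<omega> - V n0 \<omega>) + \<theta>\<^sup>2 / 2 * expectation (\<lambda>\<omega>. V n \<omega> - V n0 \<omega> - (\<rho> n0 \<omega> - \<rho> n \<omega>))"
    if "n0 \<le> n" for n
    using that
  proof (induction n rule: dec_induct)
    case (step n)
    define P where "P \<omega> = g n \<omega> * of_real (exp (- \<theta>\<^sup>2 * \<rho> (Suc n) \<omega> / 2))" for \<omega>
    define r where "r \<omega> = \<rho> n \<omega> - \<rho> (Suc n) \<omega>" for \<omega>
    have PF: "P \<in> borel_measurable (F n)"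
      unfolding P_def g_def
      using rF[of "Suc n" n] S_measurable_F[of n n] S_measurable_F[OF step(1)] measurable_F_mono[OF step(1) w(1)] step(1)
      by measurable
    have rF': "r \<in> borel_measurable (F n)" unfolding r_def using rF[of "Suc n" n] rF[of n n] step(1) by measurable
    have "integral\<^sup>L M (Q (Suc n)) - integral\<^sup>L M (Q n) = (CLINT \<omega>|M. Q (Suc n) \<omega> - Q n \<omega>)"
      using intQ by simp
    also have "\<dots> = (CLINT \<omega>|M. P \<omega> * (iexp (\<theta> * \<xi> n \<omega>) - of_real (exp (- \<theta>\<^sup>2 * r \<omega> / 2))))"
    proof (rule Bochner_Integration.integral_cong[OF refl])
      fix \<omega>
      have "exp (- \<theta>\<^sup>2 * \<rho> n \<omega> / 2) = exp (- \<theta>\<^sup>2 * \<rho> (Suc n) \<omega> / 2) * exp (- \<theta>\<^sup>2 * r \<omega> / 2)"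
        by (simp add: r_def exp_add[symmetric] algebra_simps add_divide_distrib[symmetric] diff_divide_distrib[symmetric])
      moreover have "g (Suc n) \<omega> = g n \<omega> * iexp (\<theta> * \<xi> n \<omega>)"
        by (simp add: g_def S_Suc exp_add[symmetric] algebra_simps)
      ultimately show "Q (Suc n) \<omega> - Q n \<omega> = P \<omega> * (iexp (\<theta> * \<xi> n \<omega>) - of_real (exp (- \<theta>\<^sup>2 * r \<omega> / 2)))"
        by (simp add: Q_def P_def right_diff_distrib mult_ac)
    qed
    also have "cmod \<dots> \<le> K * expectation (v n) + \<theta>\<^sup>2 / 2 * expectation (\<lambda>\<omega>. v n \<omega> - r \<omega>)"
      unfolding K_def
    proof (rule characteristic_step[OF PF _ rF'])
      fix \<omega> assume w: "\<omega> \<in> space M"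
      show "cmod (P \<omega>) \<le> 1" unfolding P_def norm_mult using mult_mono[OF g1[OF w] e1] by fastforce
      show "0 \<le> r \<omega>" "r \<omega> \<le> v n \<omega>"
        using v_nonneg[OF w, of n] by (auto simp: r_def \<rho>_def V_Suc)
    qed
    finally have "cmod (integral\<^sup>L M (Q (Suc n)) - integral\<^sup>L M (Q n)) \<le>
       K * expectation (v n) + \<theta>\<^sup>2 / 2 * expectation (\<lambda>\<omega>. v n \<omega> - r \<omega>)" .
    then have "cmod (integral\<^sup>L M (Q (Suc n)) - integral\<^sup>L M (Q n0)) \<le>
       (K * expectation (v n) + \<theta>\<^sup>2 / 2 * expectation (\<lambda>\<omega>. v n \<omega> - r \<omega>)) +
      (K * expectation (\<lambda>\<omega>. V n \<omega> - V n0 \<omega>) + \<theta>\<^sup>2 / 2 * expectation (\<lambda>\<omega>. V n \<omega> - V n0 \<omega> - (\<rho> n0 \<omega> - \<rho> n \<omega>)))"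
      using norm_triangle_ineq[of "integral\<^sup>L M (Q (Suc n)) - integral\<^sup>L M (Q n)" "integral\<^sup>L M (Q n) - integral\<^sup>L M (Q n0)"]
        step.IH by simp
    also have "\<dots> = K * expectation (\<lambda>\<omega>. V (Suc n) \<omega> - V n0 \<omega>) + \<theta>\<^sup>2 / 2 * expectation (\<lambda>\<omega>. V (Suc n) \<omega> - V n0 \<omega> - (\<rho> n0 \<omega> - \<rho> (Suc n) \<omega>))"
      using intr[of n] intr[of "Suc n"] intr[of n0] step(1) by (simp add: V_Suc r_def[abs_def] algebra_simps)
    finally show ?case .
  qed simp
  have Q0: "integral\<^sup>L M (Q n0) = of_real (expectation w * exp (- \<theta>\<^sup>2 * T / 2))"
  proof -
    have "Q n0 = (\<lambda>\<omega>. of_real (w \<omega> * exp (- \<theta>\<^sup>2 * T / 2)))"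
      using \<open>0 \<le> T\<close> by (auto simp: Q_def g_def \<rho>_def fun_eq_iff)
    then show ?thesis by (simp del: of_real_mult)
  qed
  have fin: "cmod (integral\<^sup>L M (g n1) - integral\<^sup>L M (Q n1)) \<le> \<theta>\<^sup>2 / 2 * expectation (\<rho> n1)"
  proof -
    have "cmod (CLINT \<omega>|M. g n1 \<omega> - Q n1 \<omega>) \<le> expectation (\<lambda>\<omega>. \<theta>\<^sup>2 / 2 * \<rho> n1 \<omega>)"
    proof (rule norm_expectation_le)
      fix \<omega> assume w: "\<omega> \<in> space M"
      define y where "y = \<theta>\<^sup>2 * \<rho> n1 \<omega> / 2"
      have "y \<ge> 0" using r0[of n1 \<omega>] by (simp add: y_def)
      have "g n1 \<omega> - Q n1 \<omega> = g n1 \<omega> * of_real (1 - exp (- y))" by (simp add: Q_def y_def algebra_simps)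
      also have "cmod \<dots> \<le> 1 * \<bar>1 - exp (- y)\<bar>" unfolding norm_mult norm_of_real using g1[OF w]
        by (intro mult_mono) auto
      also have "\<dots> \<le> y" using \<open>y \<ge> 0\<close> exp_ge_add_one_self[of "- y"] by simp
      finally show "cmod (g n1 \<omega> - Q n1 \<omega>) \<le> \<theta>\<^sup>2 / 2 * \<rho> n1 \<omega>" by (simp add: y_def)
    qed (use intg intQ intr assms(1) in auto)
    then show ?thesis using intg intQ by simp
  qed
  have "cmod (integral\<^sup>L M (g n1) - of_real (expectation w * exp (- \<theta>\<^sup>2 * T / 2))) \<le>
     \<theta>\<^sup>2 / 2 * expectation (\<rho> n1) + (K * expectation (\<lambda>\<omega>. V n1 \<omega> - V n0 \<omega>) + \<theta>\<^sup>2 / 2 * expectation (\<lambda>\<omega>. V n1 \<omega> - V n0 \<omega> - (\<rho> n0 \<omega> - \<rho> n1 \<omega>)))"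
    using norm_triangle_ineq[of "integral\<^sup>L M (g n1) - integral\<^sup>L M (Q n1)" "integral\<^sup>L M (Q n1) - integral\<^sup>L M (Q n0)"]
      fin step[OF assms(1)] Q0 by simp
  also have "\<theta>\<^sup>2 / 2 * expectation (\<rho> n1) + (K * expectation (\<lambda>\<omega>. V n1 \<omega> - V n0 \<omega>) + \<theta>\<^sup>2 / 2 * expectation (\<lambda>\<omega>. V n1 \<omega> - V n0 \<omega> - (\<rho> n0 \<omega> - \<rho> n1 \<omega>)))
     = K * expectation (\<lambda>\<omega>. V n1 \<omega> - V n0 \<omega>) + \<theta>\<^sup>2 / 2 * expectation (\<lambda>\<omega>. \<rho> n1 \<omega> + (V n1 \<omega> - V n0 \<omega> - (\<rho> n0 \<omega> - \<rho> n1 \<omega>)))"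
    using intr[of n0] intr[of n1] assms(1) by (simp add: algebra_simps)
  also have "expectation (\<lambda>\<omega>. \<rho> n1 \<omega> + (V n1 \<omega> - V n0 \<omega> - (\<rho> n0 \<omega> - \<rho> n1 \<omega>))) = expectation (\<lambda>\<omega>. \<bar>V n1 \<omega> - V n0 \<omega> - T\<bar>)"
    using \<open>0 \<le> T\<close> by (intro Bochner_Integration.integral_cong) (auto simp: \<rho>_def max_def)
  finally show ?thesis by (simp add: g_def K_def)
qed

text \<open>Doob's inequality for the excess of \<open>\<bar>S - S n0\<bar>\<close> over \<open>e\<close>, a submartingale, by decomposing
  according to the first time \<open>l\<close> at which the level \<open>2 e\<close> is reached. On that event \<open>S n1\<close> has
  conditional mean \<open>S l\<close>, so the terminal excess over \<open>e\<close> is still at least \<open>e\<close> in the mean.\<close>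

lemma maximal_inequality:
  assumes "n0 \<le> n1" "0 < e"
  shows "e * prob {\<omega> \<in> space M. \<exists>l\<in>{n0..n1}. \<bar>S l \<omega> - S n0 \<omega>\<bar> \<ge> 2 * e}
    \<le> expectation (\<lambda>\<omega>. max 0 (\<bar>S n1 \<omega> - S n0 \<omega>\<bar> - e))"
proof -
  define A where "A l = {\<omega> \<in> space M. \<bar>S l \<omega> - S n0 \<omega>\<bar> \<ge> 2 * e \<and> (\<forall>j\<in>{n0..<l}. \<bar>S j \<omega> - S n0 \<omega>\<bar> < 2 * e)}" for l
  have AF: "A l \<in> sets (F l)" if "n0 \<le> l" for l
  proof -
    have m: "S j \<in> borel_measurable (F l)" if "j \<le> l" for j using S_measurable_F[OF that] .
    have "A l = {\<omega> \<in> space (F l). \<bar>S l \<omega> - S n0 \<omega>\<bar> \<ge> 2 * e} \<inter> {\<omega> \<in> space (F l). \<forall>j\<in>{n0..<l}. \<bar>S j \<omega> - S n0 \<omega>\<bar> < 2 * e}"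
      by (auto simp: A_def)
    also have "\<dots> \<in> sets (F l)"
    proof (rule sets.Int)
      show "{\<omega> \<in> space (F l). \<bar>S l \<omega> - S n0 \<omega>\<bar> \<ge> 2 * e} \<in> sets (F l)"
        using m[of l] m[OF that] by measurable
      have "{\<omega> \<in> space (F l). \<bar>S j \<omega> - S n0 \<omega>\<bar> < 2 * e} \<in> sets (F l)" if "j \<in> {n0..<l}" for j
      proof -
        have [measurable]: "S j \<in> borel_measurable (F l)" "S n0 \<in> borel_measurable (F l)"
          using m that by auto
        show ?thesis by measurable
      qed
      then show "{\<omega> \<in> space (F l). \<forall>j\<in>{n0..<l}. \<bar>S j \<omega> - S n0 \<omega>\<bar> < 2 * e} \<in> sets (F l)"
        using that by (cases "{n0..<l} = {}") (auto simp del: space_F intro!: sets.sets_Collect_finite_All')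
    qed
    finally show ?thesis .
  qed
  have AM: "A l \<in> events" if "n0 \<le> l" for l
    using AF[OF that] subalgebra_F[of l] by (auto simp: subalgebra_def)
  define X where "X \<omega> = max 0 (\<bar>S n1 \<omega> - S n0 \<omega>\<bar> - e)" for \<omega>
  have [measurable]: "X \<in> borel_measurable M" unfolding X_def by measurable
  have SB: "\<bar>S l \<omega> - S n0 \<omega>\<bar> \<le> real l * c + real n0 * c" if "\<omega> \<in> space M" for l \<omega>
    using S_bound[OF that, of l] S_bound[OF that, of n0] by linarith
  have intX: "integrable M X"
  proof (rule integrable_boundedI[where B = "real n1 * c + real n0 * c"])
    fix \<omega> assume "\<omega> \<in> space M"
    then show "norm (X \<omega>) \<le> real n1 * c + real n0 * c" using SB[of \<omega> n1] assms(2) c_nonneg by (auto simp: X_def)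
  qed simp
  have ineq: "e * prob (A l) \<le> expectation (\<lambda>\<omega>. indicator (A l) \<omega> * X \<omega>)" if l: "l \<in> {n0..n1}" for l
  proof -
    define Y where "Y \<omega> = indicator (A l) \<omega> * sgn (S l \<omega> - S n0 \<omega>)" for \<omega>
    have Y: "Y \<in> borel_measurable (F l)"
    proof -
      have [measurable]: "A l \<in> sets (F l)" "S n0 \<in> borel_measurable (F l)" "S l \<in> borel_measurable (F l)"
        using AF S_measurable_F l by auto
      show ?thesis unfolding Y_def by measurable
    qed
    have YB: "\<bar>Y \<omega>\<bar> \<le> 1" for \<omega> by (auto simp: Y_def indicator_def sgn_real_def)
    have [measurable]: "A l \<in> events" using AM l by simp
    have [measurable]: "Y \<in> borel_measurable M" using measurable_F_M[OF Y] .
    have z: "expectation (\<lambda>\<omega>. Y \<omega> * (S n1 \<omega> - S l \<omega>)) = 0"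
      by (rule centred_sum[OF _ Y YB]) (use l in auto)
    have intY: "integrable M (\<lambda>\<omega>. Y \<omega> * (S k \<omega> - S n0 \<omega>))" for k
    proof (rule integrable_boundedI[where B = "1 * (real k * c + real n0 * c)"])
      fix \<omega> assume "\<omega> \<in> space M"
      then show "norm (Y \<omega> * (S k \<omega> - S n0 \<omega>)) \<le> 1 * (real k * c + real n0 * c)"
        unfolding real_norm_def abs_mult using SB YB by (intro mult_mono) auto
    qed simp
    have "expectation (\<lambda>\<omega>. Y \<omega> * (S l \<omega> - S n0 \<omega>)) = expectation (\<lambda>\<omega>. Y \<omega> * (S n1 \<omega> - S n0 \<omega>) - Y \<omega> * (S n1 \<omega> - S l \<omega>))"
      by (simp add: algebra_simps)
    also have "\<dots> = expectation (\<lambda>\<omega>. Y \<omega> * (S n1 \<omega> - S n0 \<omega>)) - 0"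
    proof -
      have "integrable M (\<lambda>\<omega>. Y \<omega> * (S n1 \<omega> - S n0 \<omega>) - Y \<omega> * (S l \<omega> - S n0 \<omega>))" using intY by simp
      then have "integrable M (\<lambda>\<omega>. Y \<omega> * (S n1 \<omega> - S l \<omega>))" by (simp add: algebra_simps)
      then show ?thesis using intY z by simp
    qed
    finally have eq: "expectation (\<lambda>\<omega>. Y \<omega> * (S l \<omega> - S n0 \<omega>)) = expectation (\<lambda>\<omega>. Y \<omega> * (S n1 \<omega> - S n0 \<omega>))" by simp
    have iI: "integrable M (\<lambda>\<omega>. k * indicator (A l) \<omega> :: real)" for k
      by (rule integrable_boundedI[where B = "\<bar>k\<bar>"]) (auto simp: indicator_def)
    have iIX: "integrable M (\<lambda>\<omega>. indicator (A l) \<omega> * X \<omega>)"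
      using integrable_real_mult_indicator[of "A l" M X] intX by (simp add: mult.commute)
    have "2 * e * prob (A l) = expectation (\<lambda>\<omega>. 2 * e * indicator (A l) \<omega>)" by simp
    also have "\<dots> \<le> expectation (\<lambda>\<omega>. Y \<omega> * (S l \<omega> - S n0 \<omega>))"
    proof (rule integral_mono[OF iI intY])
      fix \<omega>
      show "2 * e * indicator (A l) \<omega> \<le> Y \<omega> * (S l \<omega> - S n0 \<omega>)"
        by (cases "\<omega> \<in> A l") (auto simp: Y_def A_def sgn_real_def)
    qed
    also have "\<dots> \<le> expectation (\<lambda>\<omega>. indicator (A l) \<omega> * X \<omega> + e * indicator (A l) \<omega>)"
      unfolding eq
    proof (rule integral_mono[OF intY Bochner_Integration.integrable_add[OF iIX iI]])
      fix \<omega>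
      show "Y \<omega> * (S n1 \<omega> - S n0 \<omega>) \<le> indicator (A l) \<omega> * X \<omega> + e * indicator (A l) \<omega>"
        using assms(2) by (cases "\<omega> \<in> A l") (auto simp: Y_def X_def sgn_real_def)
    qed
    also have "\<dots> = expectation (\<lambda>\<omega>. indicator (A l) \<omega> * X \<omega>) + e * prob (A l)"
      using iIX iI by simp
    finally show ?thesis by simp
  qed
  have disj: "A i \<inter> A j = {}" if "i < j" "n0 \<le> i" for i j using that by (force simp: A_def)
  have U: "{\<omega> \<in> space M. \<exists>l\<in>{n0..n1}. \<bar>S l \<omega> - S n0 \<omega>\<bar> \<ge> 2 * e} = (\<Union>l\<in>{n0..n1}. A l)" (is "?L = ?R")
  proof (intro set_eqI iffI)
    fix \<omega> assume w: "\<omega> \<in> ?L"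
    define p where "p l \<longleftrightarrow> l \<in> {n0..n1} \<and> \<bar>S l \<omega> - S n0 \<omega>\<bar> \<ge> 2 * e" for l
    have "\<exists>l. p l" using w by (auto simp: p_def)
    then have "p (LEAST l. p l)" "\<forall>j<(LEAST l. p l). \<not> p j" using LeastI_ex not_less_Least by blast+
    then have "\<omega> \<in> A (LEAST l. p l)" "(LEAST l. p l) \<in> {n0..n1}" using w by (auto simp: A_def p_def not_le)
    then show "\<omega> \<in> ?R" by blast
  qed (auto simp: A_def)
  have dis: "disjoint_family_on A {n0..n1}" unfolding disjoint_family_on_def
    using disj by (metis atLeastAtMost_iff Int_commute linorder_neqE_nat)
  have "e * prob (\<Union>l\<in>{n0..n1}. A l) = (\<Sum>l\<in>{n0..n1}. e * prob (A l))"
    using AM dis by (subst finite_measure_finite_Union) (auto simp: sum_distrib_left)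
  also have "\<dots> \<le> (\<Sum>l\<in>{n0..n1}. expectation (\<lambda>\<omega>. indicator (A l) \<omega> * X \<omega>))" by (intro sum_mono ineq)
  also have "\<dots> = expectation (\<lambda>\<omega>. \<Sum>l\<in>{n0..n1}. indicator (A l) \<omega> * X \<omega>)"
    using AM intX integrable_real_mult_indicator[of _ M X]
    by (intro Bochner_Integration.integral_sum[symmetric]) (auto simp: mult.commute)
  also have "\<dots> \<le> expectation X"
  proof (rule integral_mono)
    show "integrable M (\<lambda>\<omega>. \<Sum>l\<in>{n0..n1}. indicator (A l) \<omega> * X \<omega>)"
      using AM intX integrable_real_mult_indicator[of _ M X]
      by (intro Bochner_Integration.integrable_sum) (auto simp: mult.commute)
    fix \<omega>
    have "(\<Sum>l\<in>{n0..n1}. indicator (A l) \<omega> * X \<omega>) = indicator (\<Union>l\<in>{n0..n1}. A l) \<omega> * X \<omega>"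
      using dis by (simp add: sum_distrib_right[symmetric] indicator_UN_disjoint)
    then show "(\<Sum>l\<in>{n0..n1}. indicator (A l) \<omega> * X \<omega>) \<le> X \<omega>" by (auto simp: indicator_def X_def)
  qed (rule intX)
  finally show ?thesis unfolding U by (simp add: X_def[abs_def])
qed

end



section \<open>The central limit theorem on a linear variance scale\<close>

locale time_changed_martingale = martingale_differences +
  fixes \<tau> :: "real \<Rightarrow> nat"
  assumes tau_mono: "\<And>r r'. 0 \<le> r \<Longrightarrow> r \<le> r' \<Longrightarrow> \<tau> r \<le> \<tau> r'"
    and tau_0: "\<tau> 0 = 0"
    and bracket: "((\<lambda>r. expectation (\<lambda>\<omega>. \<bar>V (\<tau> r) \<omega> - r\<bar>) / r) \<longlongrightarrow> 0) at_top"
begin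

lemma bracket_at:
  assumes "0 \<le> a"
  shows "((\<lambda>\<kappa>. expectation (\<lambda>\<omega>. \<bar>V (\<tau> (\<kappa> * a)) \<omega> - \<kappa> * a\<bar>) / \<kappa>) \<longlongrightarrow> 0) at_top"
proof (cases "a = 0")
  case True
  then show ?thesis by (simp add: tau_0 V_def)
next
  case False
  then have a: "a > 0" using assms by simp
  have "filterlim (\<lambda>\<kappa>. \<kappa> * a) at_top at_top"
    using a by (rule filterlim_at_top_mult_tendsto_pos[OF tendsto_const _ filterlim_ident])
  from filterlim_compose[OF bracket this]
  have "((\<lambda>\<kappa>. a * (expectation (\<lambda>\<omega>. \<bar>V (\<tau> (\<kappa> * a)) \<omega> - \<kappa> * a\<bar>) / (\<kappa> * a))) \<longlongrightarrow> a * 0) at_top"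
    by (intro tendsto_intros) simp
  then show ?thesis using a by simp
qed

lemma bracket_increment:
  assumes "0 \<le> a" "a \<le> b"
  shows "((\<lambda>\<kappa>. expectation (\<lambda>\<omega>. \<bar>V (\<tau> (\<kappa> * b)) \<omega> - V (\<tau> (\<kappa> * a)) \<omega> - \<kappa> * (b - a)\<bar>) / \<kappa>) \<longlongrightarrow> 0) at_top"
proof (rule Lim_null_comparison)
  let ?f = "\<lambda>b \<kappa>. expectation (\<lambda>\<omega>. \<bar>V (\<tau> (\<kappa> * b)) \<omega> - \<kappa> * b\<bar>) / \<kappa>"
  show "((\<lambda>\<kappa>. ?f b \<kappa> + ?f a \<kappa>) \<longlongrightarrow> 0) at_top"
    using tendsto_add[OF bracket_at[of b] bracket_at[of a]] assms by simp
  show "\<forall>\<^sub>F \<kappa> in at_top. norm (expectation (\<lambda>\<omega>. \<bar>V (\<tau> (\<kappa> * b)) \<omega> - V (\<tau> (\<kappa> * a)) \<omega> - \<kappa> * (b - a)\<bar>) / \<kappa>) \<le> ?f b \<kappa> + ?f a \<kappa>"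
    using eventually_gt_at_top[of 0]
  proof eventually_elim
    case (elim \<kappa>)
    have "expectation (\<lambda>\<omega>. \<bar>V (\<tau> (\<kappa> * b)) \<omega> - V (\<tau> (\<kappa> * a)) \<omega> - \<kappa> * (b - a)\<bar>)
      \<le> expectation (\<lambda>\<omega>. \<bar>V (\<tau> (\<kappa> * b)) \<omega> - \<kappa> * b\<bar> + \<bar>V (\<tau> (\<kappa> * a)) \<omega> - \<kappa> * a\<bar>)"
      by (intro integral_mono) (auto simp: algebra_simps)
    also have "\<dots> = expectation (\<lambda>\<omega>. \<bar>V (\<tau> (\<kappa> * b)) \<omega> - \<kappa> * b\<bar>) + expectation (\<lambda>\<omega>. \<bar>V (\<tau> (\<kappa> * a)) \<omega> - \<kappa> * a\<bar>)"
      by simp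
    finally show ?case using elim by (simp add: divide_right_mono add_divide_distrib[symmetric])
  qed
qed

definition incr :: "real \<Rightarrow> real \<Rightarrow> real \<Rightarrow> 'a \<Rightarrow> real" where
  "incr \<kappa> a b \<omega> = (S (\<tau> (\<kappa> * b)) \<omega> - S (\<tau> (\<kappa> * a)) \<omega>) / sqrt \<kappa>"

lemma incr_measurable [measurable]: "incr \<kappa> a b \<in> borel_measurable M"
  unfolding incr_def by measurable

lemma incr_measurable_F:
  assumes "0 \<le> \<kappa>" "0 \<le> a" "a \<le> b" "b \<le> b'"
  shows "incr \<kappa> a b \<in> borel_measurable (F (\<tau> (\<kappa> * b')))"
proof -
  have "\<tau> (\<kappa> * a) \<le> \<tau> (\<kappa> * b')" "\<tau> (\<kappa> * b) \<le> \<tau> (\<kappa> * b')"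
    using assms by (auto intro!: tau_mono mult_left_mono)
  then have [measurable]: "S (\<tau> (\<kappa> * a)) \<in> borel_measurable (F (\<tau> (\<kappa> * b')))" "S (\<tau> (\<kappa> * b)) \<in> borel_measurable (F (\<tau> (\<kappa> * b')))"
    by (auto intro: S_measurable_F)
  show ?thesis unfolding incr_def by measurable
qed

lemma incr_bound: "\<omega> \<in> space M \<Longrightarrow> \<bar>incr \<kappa> a b \<omega>\<bar> \<le> (real (\<tau> (\<kappa> * b)) * c + real (\<tau> (\<kappa> * a)) * c) / sqrt \<bar>\<kappa>\<bar>"
proof -
  assume w: "\<omega> \<in> space M"
  have "\<bar>S (\<tau> (\<kappa> * b)) \<omega> - S (\<tau> (\<kappa> * a)) \<omega>\<bar> \<le> real (\<tau> (\<kappa> * b)) * c + real (\<tau> (\<kappa> * a)) * c"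
    using S_bound[OF w, of "\<tau> (\<kappa> * b)"] S_bound[OF w, of "\<tau> (\<kappa> * a)"] by linarith
  moreover have "\<bar>sqrt \<kappa>\<bar> = sqrt \<bar>\<kappa>\<bar>" by (simp add: real_sqrt_abs2 abs_if real_sqrt_minus)
  ultimately show ?thesis by (simp add: incr_def abs_divide divide_right_mono)
qed

lemma integrable_incr_power [intro, simp]: "integrable M (\<lambda>\<omega>. (incr \<kappa> a b \<omega>) ^ k)"
proof (rule integrable_boundedI[where B = "((real (\<tau> (\<kappa> * b)) * c + real (\<tau> (\<kappa> * a)) * c) / sqrt \<bar>\<kappa>\<bar>) ^ k"])
  fix \<omega> assume "\<omega> \<in> space M"
  from power_mono[OF incr_bound[OF this, of \<kappa> a b] abs_ge_zero, of k]
  show "norm (incr \<kappa> a b \<omega> ^ k) \<le> ((real (\<tau> (\<kappa> * b)) * c + real (\<tau> (\<kappa> * a)) * c) / sqrt \<bar>\<kappa>\<bar>) ^ k"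
    by (simp add: power_abs)
qed measurable

lemma second_moment:
  assumes "0 \<le> a" "a \<le> b"
  shows "((\<lambda>\<kappa>. expectation (\<lambda>\<omega>. (incr \<kappa> a b \<omega>)\<^sup>2)) \<longlongrightarrow> b - a) at_top"
proof (rule LIM_zero_cancel, rule Lim_null_comparison[OF _ bracket_increment[OF assms]])
  show "\<forall>\<^sub>F \<kappa> in at_top. norm (expectation (\<lambda>\<omega>. (incr \<kappa> a b \<omega>)\<^sup>2) - (b - a)) \<le>
    expectation (\<lambda>\<omega>. \<bar>V (\<tau> (\<kappa> * b)) \<omega> - V (\<tau> (\<kappa> * a)) \<omega> - \<kappa> * (b - a)\<bar>) / \<kappa>"
    using eventually_gt_at_top[of 0]
  proof eventually_elim
    case (elim \<kappa>)
    have le: "\<tau> (\<kappa> * a) \<le> \<tau> (\<kappa> * b)" using elim assms by (intro tau_mono) auto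
    have "expectation (\<lambda>\<omega>. (incr \<kappa> a b \<omega>)\<^sup>2) = expectation (\<lambda>\<omega>. (S (\<tau> (\<kappa> * b)) \<omega> - S (\<tau> (\<kappa> * a)) \<omega>)\<^sup>2) / \<kappa>"
      using elim by (simp add: incr_def power_divide)
    also have "\<dots> = expectation (\<lambda>\<omega>. V (\<tau> (\<kappa> * b)) \<omega> - V (\<tau> (\<kappa> * a)) \<omega>) / \<kappa>"
      by (simp only: variance_sum[OF le])
    also have "\<dots> - (b - a) = expectation (\<lambda>\<omega>. V (\<tau> (\<kappa> * b)) \<omega> - V (\<tau> (\<kappa> * a)) \<omega> - \<kappa> * (b - a)) / \<kappa>"
      using elim by (simp add: prob_space field_simps)
    finally have eq: "expectation (\<lambda>\<omega>. (incr \<kappa> a b \<omega>)\<^sup>2) - (b - a) = \<dots>" .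
    have "\<bar>expectation (\<lambda>\<omega>. V (\<tau> (\<kappa> * b)) \<omega> - V (\<tau> (\<kappa> * a)) \<omega> - \<kappa> * (b - a))\<bar>
        \<le> expectation (\<lambda>\<omega>. \<bar>V (\<tau> (\<kappa> * b)) \<omega> - V (\<tau> (\<kappa> * a)) \<omega> - \<kappa> * (b - a)\<bar>)"
      by (rule integral_abs_bound)
    then show ?case unfolding eq using elim by (simp add: abs_divide divide_right_mono)
  qed
qed

lemma weighted_characteristic_limit:
  fixes \<theta> :: real and w :: "real \<Rightarrow> 'a \<Rightarrow> real"
  assumes ab: "0 \<le> a" "a < b"
    and w: "\<And>\<kappa>. 0 < \<kappa> \<Longrightarrow> w \<kappa> \<in> borel_measurable (F (\<tau> (\<kappa> * a)))"
      "\<And>\<kappa> \<omega>. 0 < \<kappa> \<Longrightarrow> \<omega> \<in> space M \<Longrightarrow> \<bar>w \<kappa> \<omega>\<bar> \<le> 1"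
  shows "((\<lambda>\<kappa>. (CLINT \<omega>|M. w \<kappa> \<omega> * iexp (\<theta> * (incr \<kappa> a b \<omega> / sqrt (b - a))))
      - of_real (expectation (w \<kappa>) * exp (- \<theta>\<^sup>2 / 2))) \<longlongrightarrow> 0) at_top"
proof (rule Lim_null_comparison)
  define \<delta> where "\<delta> = b - a"
  have d: "\<delta> > 0" using ab by (simp add: \<delta>_def)
  define q where "q \<kappa> = expectation (\<lambda>\<omega>. \<bar>V (\<tau> (\<kappa> * b)) \<omega> - V (\<tau> (\<kappa> * a)) \<omega> - \<kappa> * \<delta>\<bar>) / \<kappa>" for \<kappa>
  have q: "(q \<longlongrightarrow> 0) at_top" unfolding q_def[abs_def] \<delta>_def using bracket_increment[of a b] ab by simp
  define R where "R \<kappa> = \<theta>\<^sup>2 / (2 * \<delta>) * q \<kappa> + (\<bar>\<theta>\<bar>^3 * c / (6 * \<delta> * sqrt \<delta>) / sqrt \<kappa> + \<theta>^4 * c\<^sup>2 / (8 * \<delta>\<^sup>2) / \<kappa>) * (\<delta> + q \<kappa>)" for \<kappa>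
  have "(R \<longlongrightarrow> \<theta>\<^sup>2 / (2 * \<delta>) * 0 + (0 + 0) * (\<delta> + 0)) at_top"
    unfolding R_def[abs_def]
    by (intro tendsto_intros q tendsto_divide_0[OF tendsto_const] filterlim_at_top_imp_at_infinity sqrt_at_top filterlim_ident)
  then show "(R \<longlongrightarrow> 0) at_top" by simp
  show "\<forall>\<^sub>F \<kappa> in at_top. norm ((CLINT \<omega>|M. w \<kappa> \<omega> * iexp (\<theta> * (incr \<kappa> a b \<omega> / sqrt (b - a))))
      - of_real (expectation (w \<kappa>) * exp (- \<theta>\<^sup>2 / 2))) \<le> R \<kappa>"
    using eventually_gt_at_top[of 0]
  proof eventually_elim
    case (elim \<kappa>)
    define \<eta> where "\<eta> = \<theta> / sqrt (\<kappa> * \<delta>)"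
    have le: "\<tau> (\<kappa> * a) \<le> \<tau> (\<kappa> * b)" using elim ab by (intro tau_mono) auto
    have kd: "\<kappa> * \<delta> > 0" using elim d by simp
    have "\<theta> * (incr \<kappa> a b \<omega> / sqrt (b - a)) = \<eta> * (S (\<tau> (\<kappa> * b)) \<omega> - S (\<tau> (\<kappa> * a)) \<omega>)" for \<omega>
      using kd by (simp add: incr_def \<eta>_def \<delta>_def real_sqrt_mult)
    moreover have "exp (- \<theta>\<^sup>2 / 2) = exp (- \<eta>\<^sup>2 * (\<kappa> * \<delta>) / 2)"
      using elim d by (simp add: \<eta>_def power_divide)
    ultimately have "norm ((CLINT \<omega>|M. w \<kappa> \<omega> * iexp (\<theta> * (incr \<kappa> a b \<omega> / sqrt (b - a))))
      - of_real (expectation (w \<kappa>) * exp (- \<theta>\<^sup>2 / 2)))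
      = norm ((CLINT \<omega>|M. w \<kappa> \<omega> * iexp (\<eta> * (S (\<tau> (\<kappa> * b)) \<omega> - S (\<tau> (\<kappa> * a)) \<omega>)))
      - of_real (expectation (w \<kappa>) * exp (- \<eta>\<^sup>2 * (\<kappa> * \<delta>) / 2)))" by simp
    also have "\<dots> \<le> \<eta>\<^sup>2 / 2 * expectation (\<lambda>\<omega>. \<bar>V (\<tau> (\<kappa> * b)) \<omega> - V (\<tau> (\<kappa> * a)) \<omega> - \<kappa> * \<delta>\<bar>)
      + (\<bar>\<eta>\<bar>^3 * c / 6 + \<eta>^4 * c\<^sup>2 / 8) * expectation (\<lambda>\<omega>. V (\<tau> (\<kappa> * b)) \<omega> - V (\<tau> (\<kappa> * a)) \<omega>)"
      by (rule weighted_characteristic_bound[OF le w(1)[OF elim] w(2)[OF elim]]) (use kd in auto)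
    also have "\<dots> \<le> \<eta>\<^sup>2 / 2 * (\<kappa> * q \<kappa>) + (\<bar>\<eta>\<bar>^3 * c / 6 + \<eta>^4 * c\<^sup>2 / 8) * (\<kappa> * (\<delta> + q \<kappa>))"
    proof (intro add_mono mult_left_mono)
      show "expectation (\<lambda>\<omega>. \<bar>V (\<tau> (\<kappa> * b)) \<omega> - V (\<tau> (\<kappa> * a)) \<omega> - \<kappa> * \<delta>\<bar>) \<le> \<kappa> * q \<kappa>"
        using elim by (simp add: q_def)
      have "expectation (\<lambda>\<omega>. V (\<tau> (\<kappa> * b)) \<omega> - V (\<tau> (\<kappa> * a)) \<omega>) \<le>
         expectation (\<lambda>\<omega>. \<kappa> * \<delta> + \<bar>V (\<tau> (\<kappa> * b)) \<omega> - V (\<tau> (\<kappa> * a)) \<omega> - \<kappa> * \<delta>\<bar>)"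
        by (intro integral_mono) auto
      also have "\<dots> = \<kappa> * (\<delta> + q \<kappa>)" using elim by (simp add: q_def prob_space field_simps)
      finally show "expectation (\<lambda>\<omega>. V (\<tau> (\<kappa> * b)) \<omega> - V (\<tau> (\<kappa> * a)) \<omega>) \<le> \<kappa> * (\<delta> + q \<kappa>)" .
    qed (use c_nonneg in auto)
    also have "\<dots> = R \<kappa>"
    proof -
      have 1: "\<eta>\<^sup>2 / 2 * (\<kappa> * q \<kappa>) = \<theta>\<^sup>2 / (2 * \<delta>) * q \<kappa>"
        using elim d by (simp add: \<eta>_def power_divide)
      have "\<eta> ^ 4 = \<theta> ^ 4 / (\<kappa> * \<delta>)\<^sup>2"
      proof -
        have "\<eta>\<^sup>2 = \<theta>\<^sup>2 / (\<kappa> * \<delta>)" using elim d by (simp add: \<eta>_def power_divide)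
        then have "(\<eta>\<^sup>2)\<^sup>2 = (\<theta>\<^sup>2 / (\<kappa> * \<delta>))\<^sup>2" by simp
        then show ?thesis by (simp add: power_divide flip: power_mult)
      qed
      then have 2: "\<eta> ^ 4 * c\<^sup>2 / 8 * \<kappa> = \<theta>^4 * c\<^sup>2 / (8 * \<delta>\<^sup>2) / \<kappa>"
        using elim d by (simp add: field_simps power2_eq_square)
      have "\<bar>\<eta>\<bar>^3 = \<bar>\<theta>\<bar>^3 / (sqrt \<kappa> * \<kappa> * (sqrt \<delta> * \<delta>))"
        using elim d by (simp add: \<eta>_def abs_divide power_divide real_sqrt_mult power3_eq_cube mult_ac)
      then have 3: "\<bar>\<eta>\<bar>^3 * c / 6 * \<kappa> = \<bar>\<theta>\<bar>^3 * c / (6 * \<delta> * sqrt \<delta>) / sqrt \<kappa>"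
        using elim d by (simp add: field_simps)
      have "(\<bar>\<eta>\<bar>^3 * c / 6 + \<eta>^4 * c\<^sup>2 / 8) * (\<kappa> * (\<delta> + q \<kappa>)) = (\<bar>\<eta>\<bar>^3 * c / 6 * \<kappa> + \<eta>^4 * c\<^sup>2 / 8 * \<kappa>) * (\<delta> + q \<kappa>)"
        by (simp add: algebra_simps)
      then show ?thesis unfolding R_def 1 2 3 by simp
    qed
    finally show ?case .
  qed
qed

text \<open>A positive weight with values in a compact subset of \<open>(0, \<infinity>)\<close> is, up to normalization, a
  change of measure. Under the tilted measures the characteristic functions of the increment
  converge to the Gaussian one, so Levy's continuity theorem applies.\<close>

lemma weighted_clt_positive:
  fixes w :: "real \<Rightarrow> 'a \<Rightarrow> real"
  assumes ab: "0 \<le> a" "a < b"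
    and w: "\<And>\<kappa>. 0 < \<kappa> \<Longrightarrow> w \<kappa> \<in> borel_measurable (F (\<tau> (\<kappa> * a)))"
      "\<And>\<kappa> \<omega>. 0 < \<kappa> \<Longrightarrow> \<omega> \<in> space M \<Longrightarrow> \<bar>w \<kappa> \<omega> - 2 / 3\<bar> \<le> 1 / 3"
    and \<psi>: "\<And>x. isCont \<psi> x" "\<And>x. \<bar>\<psi> x\<bar> \<le> K"
  shows "((\<lambda>\<kappa>. expectation (\<lambda>\<omega>. w \<kappa> \<omega> * \<psi> (incr \<kappa> a b \<omega>))
      - expectation (w \<kappa>) * (LINT x|std_normal_distribution. \<psi> (sqrt (b - a) * x))) \<longlongrightarrow> 0) at_top"
    (is "(?f \<longlongrightarrow> 0) at_top")
proof -
  \<comment> \<open>Levy's theorem is about sequences of laws, all of which have to be defined; hence the cut-off at 1.\<close>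
  have "((\<lambda>\<kappa>. ?f (max 1 \<kappa>)) \<longlongrightarrow> 0) at_top"
  proof (rule tendsto_at_topI_sequentially)
    fix X :: "nat \<Rightarrow> real" assume X: "filterlim X at_top sequentially"
    define \<kappa> where "\<kappa> n = max 1 (X n)" for n
    have k0: "\<kappa> n > 0" for n by (simp add: \<kappa>_def)
    have kl: "filterlim \<kappa> at_top sequentially"
      using X by (rule filterlim_at_top_mono) (auto simp: \<kappa>_def)
    \<comment> \<open>Outside the space the weight is set to a constant so that its bounds hold everywhere.\<close>
    define u where "u n \<omega> = (if \<omega> \<in> space M then w (\<kappa> n) \<omega> else 2/3)" for n \<omega>
    have uM [measurable]: "u n \<in> borel_measurable M" for n
    proof -
      have [measurable]: "w (\<kappa> n) \<in> borel_measurable M" using measurable_F_M[OF w(1)[OF k0]] .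
      show ?thesis unfolding u_def by measurable
    qed
    have u1: "1 / 3 \<le> u n \<omega>" "u n \<omega> \<le> 1" for n \<omega>
    proof -
      have "\<bar>w (\<kappa> n) \<omega> - 2 / 3\<bar> \<le> 1 / 3" if "\<omega> \<in> space M" by (rule w(2)[OF k0 that])
      then show "1 / 3 \<le> u n \<omega>" "u n \<omega> \<le> 1" 
        by (cases "\<omega> \<in> space M"; simp only: u_def if_True if_False; linarith)+
    qed
    have intu: "integrable M (u n)" for n
    proof (rule integrable_boundedI[where B = 1])
      show "norm (u n \<omega>) \<le> 1" for \<omega> using u1[of n \<omega>] by simp
    qed simp
    define p where "p n = expectation (u n)" for n
    have p1: "1 / 3 \<le> p n" "p n \<le> 1" for n
    proof -
      have "expectation (\<lambda>_. 1/3) \<le> p n" unfolding p_def by (rule integral_mono) (use intu u1 in auto)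
      then show "1 / 3 \<le> p n" by (simp add: prob_space)
      have "p n \<le> expectation (\<lambda>_. 1)" unfolding p_def by (rule integral_mono) (use intu u1 in auto)
      then show "p n \<le> 1" by (simp add: prob_space)
    qed
    have p0: "p n > 0" for n using p1(1)[of n] by linarith
    define Y where "Y n \<omega> = incr (\<kappa> n) a b \<omega> / sqrt (b - a)" for n \<omega>
    have [measurable]: "Y n \<in> borel_measurable M" for n unfolding Y_def by measurable
    define D where "D n = density M (\<lambda>\<omega>. ennreal (u n \<omega> / p n))" for n
    define \<mu> where "\<mu> n = distr (D n) borel (Y n)" for n
    have nn: "0 \<le> u n \<omega> / p n" for n \<omega> using u1(1)[of n \<omega>] p0[of n] by (simp add: divide_nonneg_pos)
    have PD: "prob_space (D n)" for n
    proof
      have "emeasure (D n) (space (D n)) = (\<integral>\<^sup>+\<omega>. ennreal (u n \<omega> / p n) \<partial>M)"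
        unfolding D_def space_density by (subst emeasure_density) (auto intro!: nn_integral_cong)
      also have "\<dots> = ennreal (expectation (\<lambda>\<omega>. u n \<omega> / p n))"
        by (rule nn_integral_eq_integral) (use intu nn in auto)
      also have "\<dots> = 1" using p0[of n] by (simp add: p_def[symmetric])
      finally show "emeasure (D n) (space (D n)) = 1" .
    qed
    have YD: "Y n \<in> borel_measurable (D n)" for n by (simp add: D_def)
    have RD: "real_distribution (\<mu> n)" for n
      unfolding \<mu>_def using prob_space.real_distribution_distr[OF PD YD] .
    have int_mu: "integral\<^sup>L (\<mu> n) g = expectation (\<lambda>\<omega>. u n \<omega> * g (Y n \<omega>)) / p n"
      if [measurable]: "g \<in> borel_measurable borel" for g :: "real \<Rightarrow> real" and n
    proof -
      have "integral\<^sup>L (\<mu> n) g = (LINT \<omega>|D n. g (Y n \<omega>))"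
        unfolding \<mu>_def by (rule integral_distr) (use YD in auto)
      also have "\<dots> = (LINT \<omega>|M. (u n \<omega> / p n) *\<^sub>R g (Y n \<omega>))"
        unfolding D_def by (rule integral_density) (use nn in auto)
      finally show ?thesis by simp
    qed
    have char_mu: "char (\<mu> n) \<theta> = (CLINT \<omega>|M. u n \<omega> * iexp (\<theta> * Y n \<omega>)) / p n" for n \<theta>
    proof -
      have "char (\<mu> n) \<theta> = (CLINT \<omega>|D n. iexp (\<theta> * Y n \<omega>))"
        unfolding \<mu>_def char_def by (rule integral_distr) (use YD in auto)
      also have "\<dots> = (CLINT \<omega>|M. (u n \<omega> / p n) *\<^sub>R iexp (\<theta> * Y n \<omega>))"
        unfolding D_def by (rule integral_density) (use nn in auto)
      finally show ?thesis by (simp add: scaleR_conv_of_real)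
    qed
    have "weak_conv_m \<mu> std_normal_distribution"
    proof (rule levy_continuity[OF RD real_dist_normal_dist])
      fix \<theta>
      have w1: "\<bar>w \<kappa> \<omega>\<bar> \<le> 1" if "0 < \<kappa>" "\<omega> \<in> space M" for \<kappa> \<omega> using w(2)[OF that] by linarith
      from filterlim_compose[OF weighted_characteristic_limit[OF ab w(1) w1, of \<theta>] kl]
      have l: "(\<lambda>n. (CLINT \<omega>|M. w (\<kappa> n) \<omega> * iexp (\<theta> * Y n \<omega>)) - of_real (expectation (w (\<kappa> n)) * exp (- \<theta>\<^sup>2 / 2))) \<longlonglongrightarrow> 0"
        by (simp add: Y_def)
      have e1: "(CLINT \<omega>|M. w (\<kappa> n) \<omega> * iexp (\<theta> * Y n \<omega>)) = (CLINT \<omega>|M. u n \<omega> * iexp (\<theta> * Y n \<omega>))" for n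
        by (rule Bochner_Integration.integral_cong) (auto simp: u_def)
      have e2: "expectation (w (\<kappa> n)) = p n" for n unfolding p_def
        by (rule Bochner_Integration.integral_cong) (auto simp: u_def)
      have l': "(\<lambda>n. p n * (char (\<mu> n) \<theta> - char std_normal_distribution \<theta>)) \<longlonglongrightarrow> 0"
        using l p0[THEN less_imp_neq] unfolding e1 e2 char_mu char_std_normal_distribution
        by (simp add: right_diff_distrib less_imp_neq[OF p0, symmetric])
      have "(\<lambda>n. char (\<mu> n) \<theta> - char std_normal_distribution \<theta>) \<longlonglongrightarrow> 0"
      proof (rule Lim_null_comparison)
        show "(\<lambda>n. 3 * norm (p n * (char (\<mu> n) \<theta> - char std_normal_distribution \<theta>))) \<longlonglongrightarrow> 0"
          using tendsto_mult_left[OF tendsto_norm_zero[OF l'], of 3] by simp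
        have "norm z \<le> 3 * norm (p n * z)" for z :: complex and n
        proof -
          have "1 * norm z \<le> (3 * p n) * norm z" using p1(1)[of n] by (intro mult_right_mono) auto
          then show ?thesis using p0[of n] by (simp add: norm_mult)
        qed
        then show "\<forall>\<^sub>F n in sequentially. norm (char (\<mu> n) \<theta> - char std_normal_distribution \<theta>)
          \<le> 3 * norm (p n * (char (\<mu> n) \<theta> - char std_normal_distribution \<theta>))" by simp
      qed
      then show "(\<lambda>n. char (\<mu> n) \<theta>) \<longlonglongrightarrow> char std_normal_distribution \<theta>" by (rule LIM_zero_cancel)
    qed
    then have "(\<lambda>n. integral\<^sup>L (\<mu> n) (\<lambda>x. \<psi> (sqrt (b - a) * x))) \<longlonglongrightarrow> (LINT x|std_normal_distribution. \<psi> (sqrt (b - a) * x))"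
      by (rule weak_conv_imp_integral_bdd_continuous_conv[OF RD real_dist_normal_dist, where B = K])
        (auto intro!: continuous_intros isCont_o2[OF _ \<psi>(1)] \<psi>(2))
    moreover have "(\<lambda>x. \<psi> (sqrt (b - a) * x)) \<in> borel_measurable borel"
      by (intro borel_measurable_continuous_onI continuous_at_imp_continuous_on ballI isCont_o2[OF _ \<psi>(1)] continuous_intros)
    moreover have "\<psi> (sqrt (b - a) * Y n \<omega>) = \<psi> (incr (\<kappa> n) a b \<omega>)" for n \<omega> using ab by (simp add: Y_def)
    ultimately have "(\<lambda>n. expectation (\<lambda>\<omega>. u n \<omega> * \<psi> (incr (\<kappa> n) a b \<omega>)) / p n) \<longlonglongrightarrow> (LINT x|std_normal_distribution. \<psi> (sqrt (b - a) * x))"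
      by (simp add: int_mu)
    then have l: "(\<lambda>n. expectation (\<lambda>\<omega>. u n \<omega> * \<psi> (incr (\<kappa> n) a b \<omega>)) / p n - (LINT x|std_normal_distribution. \<psi> (sqrt (b - a) * x))) \<longlonglongrightarrow> 0"
      by (rule LIM_zero)
    have "(\<lambda>n. expectation (\<lambda>\<omega>. u n \<omega> * \<psi> (incr (\<kappa> n) a b \<omega>)) - p n * (LINT x|std_normal_distribution. \<psi> (sqrt (b - a) * x))) \<longlonglongrightarrow> 0"
    proof (rule Lim_null_comparison[OF _ tendsto_norm_zero[OF l]], intro always_eventually allI)
      fix n
      let ?A = "expectation (\<lambda>\<omega>. u n \<omega> * \<psi> (incr (\<kappa> n) a b \<omega>))" and ?B = "LINT x|std_normal_distribution. \<psi> (sqrt (b - a) * x)"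
      have "norm (?A - p n * ?B) = p n * norm (?A / p n - ?B)"
      proof -
        have "?A - p n * ?B = p n * (?A / p n - ?B)" using p0[of n] by (simp add: field_simps)
        then show ?thesis using p0[of n] by (simp only: norm_mult) simp
      qed
      also have "\<dots> \<le> 1 * norm (?A / p n - ?B)" using p1(2) by (intro mult_right_mono) auto
      finally show "norm (?A - p n * ?B) \<le> norm (?A / p n - ?B)" by simp
    qed
    moreover have "expectation (\<lambda>\<omega>. w (\<kappa> n) \<omega> * \<psi> (incr (\<kappa> n) a b \<omega>)) = expectation (\<lambda>\<omega>. u n \<omega> * \<psi> (incr (\<kappa> n) a b \<omega>))" for n
      by (rule Bochner_Integration.integral_cong) (auto simp: u_def)
    moreover have "expectation (w (\<kappa> n)) = p n" for n unfolding p_def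
      by (rule Bochner_Integration.integral_cong) (auto simp: u_def)
    ultimately show "(\<lambda>n. ?f (max 1 (X n))) \<longlonglongrightarrow> 0" by (simp add: \<kappa>_def)
  qed
  moreover have "\<forall>\<^sub>F \<kappa> in at_top. ?f (max 1 \<kappa>) = ?f \<kappa>"
    using eventually_ge_at_top[of 1] by eventually_elim (simp add: max_absorb2)
  ultimately show ?thesis by (rule Lim_transform_eventually)
qed

text \<open>Both sides are linear in the weight, so a bounded weight is first scaled and shifted into
  \<open>[1/3, 1]\<close>; the contribution of the shift is the case of a constant weight. Allowing weights
  from the past says that the increment is asymptotically independent of the past.\<close>

lemma weighted_clt:
  fixes w :: "real \<Rightarrow> 'a \<Rightarrow> real"
  assumes ab: "0 \<le> a" "a < b"
    and w: "\<And>\<kappa>. 0 < \<kappa> \<Longrightarrow> w \<kappa> \<in> borel_measurable (F (\<tau> (\<kappa> * a)))"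
      "\<And>\<kappa> \<omega>. 0 < \<kappa> \<Longrightarrow> \<omega> \<in> space M \<Longrightarrow> \<bar>w \<kappa> \<omega>\<bar> \<le> B"
    and \<psi>: "\<And>x. isCont \<psi> x" "\<And>x. \<bar>\<psi> x\<bar> \<le> K"
  shows "((\<lambda>\<kappa>. expectation (\<lambda>\<omega>. w \<kappa> \<omega> * \<psi> (incr \<kappa> a b \<omega>))
      - expectation (w \<kappa>) * (LINT x|std_normal_distribution. \<psi> (sqrt (b - a) * x))) \<longlongrightarrow> 0) at_top"
proof -
  define B' where "B' = max 1 B"
  have B': "B' > 0" "B \<le> B'" by (auto simp: B'_def)
  let ?I = "LINT x|std_normal_distribution. \<psi> (sqrt (b - a) * x)"
  define u where "u \<kappa> \<omega> = 2 / 3 + w \<kappa> \<omega> / (3 * B')" for \<kappa> \<omega>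
  have u: "u \<kappa> \<in> borel_measurable (F (\<tau> (\<kappa> * a)))" if "\<kappa> > 0" for \<kappa>
    unfolding u_def using w(1)[OF that] by measurable
  have u': "\<bar>u \<kappa> \<omega> - 2 / 3\<bar> \<le> 1 / 3" if "\<kappa> > 0" "\<omega> \<in> space M" for \<kappa> \<omega>
    using w(2)[OF that] B' by (simp add: u_def abs_divide field_simps)
  have psim [measurable]: "\<psi> \<in> borel_measurable borel"
    by (intro borel_measurable_continuous_onI continuous_at_imp_continuous_on ballI \<psi>)
  have 1: "((\<lambda>\<kappa>. expectation (\<lambda>\<omega>. u \<kappa> \<omega> * \<psi> (incr \<kappa> a b \<omega>)) - expectation (u \<kappa>) * ?I) \<longlongrightarrow> 0) at_top"
    by (rule weighted_clt_positive[OF ab u u' \<psi>])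
  have 2: "((\<lambda>\<kappa>. expectation (\<lambda>\<omega>. 2 / 3 * \<psi> (incr \<kappa> a b \<omega>)) - expectation (\<lambda>_. 2 / 3) * ?I) \<longlongrightarrow> 0) at_top"
    by (rule weighted_clt_positive[OF ab _ _ \<psi>]) auto
  have "((\<lambda>\<kappa>. 3 * B' * ((expectation (\<lambda>\<omega>. u \<kappa> \<omega> * \<psi> (incr \<kappa> a b \<omega>)) - expectation (u \<kappa>) * ?I)
     - (expectation (\<lambda>\<omega>. 2 / 3 * \<psi> (incr \<kappa> a b \<omega>)) - expectation (\<lambda>_. 2 / 3) * ?I))) \<longlongrightarrow> 3 * B' * (0 - 0)) at_top"
    by (intro tendsto_intros 1 2)
  moreover have "\<forall>\<^sub>F \<kappa> in at_top. 3 * B' * ((expectation (\<lambda>\<omega>. u \<kappa> \<omega> * \<psi> (incr \<kappa> a b \<omega>)) - expectation (u \<kappa>) * ?I)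
     - (expectation (\<lambda>\<omega>. 2 / 3 * \<psi> (incr \<kappa> a b \<omega>)) - expectation (\<lambda>_. 2 / 3) * ?I))
    = expectation (\<lambda>\<omega>. w \<kappa> \<omega> * \<psi> (incr \<kappa> a b \<omega>)) - expectation (w \<kappa>) * ?I"
    using eventually_gt_at_top[of 0]
  proof eventually_elim
    case (elim \<kappa>)
    have [measurable]: "w \<kappa> \<in> borel_measurable M" using measurable_F_M[OF w(1)[OF elim]] .
    have iw: "integrable M (w \<kappa>)" by (rule integrable_boundedI[where B = B]) (use w(2)[OF elim] in auto)
    have ip: "integrable M (\<lambda>\<omega>. \<psi> (incr \<kappa> a b \<omega>))" by (rule integrable_boundedI[where B = K]) (use \<psi> in auto)
    have iwp: "integrable M (\<lambda>\<omega>. w \<kappa> \<omega> * \<psi> (incr \<kappa> a b \<omega>))"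
    proof (rule integrable_boundedI[where B = "B * K"])
      fix \<omega> assume "\<omega> \<in> space M"
      then show "norm (w \<kappa> \<omega> * \<psi> (incr \<kappa> a b \<omega>)) \<le> B * K"
        using w(2)[OF elim, of \<omega>] \<psi>(2)[of "incr \<kappa> a b \<omega>"] by (auto simp: abs_mult intro!: mult_mono)
    qed measurable
    have "expectation (\<lambda>\<omega>. u \<kappa> \<omega> * \<psi> (incr \<kappa> a b \<omega>)) = 2 / 3 * expectation (\<lambda>\<omega>. \<psi> (incr \<kappa> a b \<omega>))
      + expectation (\<lambda>\<omega>. w \<kappa> \<omega> * \<psi> (incr \<kappa> a b \<omega>)) / (3 * B')"
      using ip iwp by (simp add: u_def distrib_right)
    moreover have "expectation (u \<kappa>) = 2 / 3 + expectation (w \<kappa>) / (3 * B')"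
      using iw by (simp add: u_def[abs_def] prob_space)
    moreover have "expectation (\<lambda>\<omega>. 2 / 3 * \<psi> (incr \<kappa> a b \<omega>)) = 2 / 3 * expectation (\<lambda>\<omega>. \<psi> (incr \<kappa> a b \<omega>))" by simp
    moreover have "expectation (\<lambda>_. 2 / 3) = (2 / 3 :: real)" by (simp add: prob_space)
    moreover have "3 * B' * ((2/3*p + q/(3*B') - (2/3+r/(3*B'))*I) - (2/3*p - 2/3*I)) = q - r*I" for p q r I
      using B'(1) by (simp add: field_simps)
    ultimately show ?case by (simp only:)
  qed
  ultimately show ?thesis by (simp add: tendsto_cong)
qed

text \<open>The maximal inequality reduces the oscillation to the mean excess of the rescaled increment
  over \<open>e\<close>. The limit of that mean is the one for a centred Gaussian variable of variance \<open>b - a\<close>,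
  whose fourth moment is \<open>3 (b - a)\<^sup>2\<close>. The excess is unbounded; truncating it at \<open>R\<close> costs at
  most the second moment divided by \<open>R\<close>.\<close>

lemma oscillation_bound:
  assumes ab: "0 \<le> a" "a < b" and e: "0 < e" and \<eta>: "0 < \<eta>"
  shows "\<forall>\<^sub>F \<kappa> in at_top. prob {\<omega> \<in> space M. \<exists>l\<in>{\<tau> (\<kappa> * a)..\<tau> (\<kappa> * b)}. \<bar>S l \<omega> - S (\<tau> (\<kappa> * a)) \<omega>\<bar> \<ge> 2 * (e * sqrt \<kappa>)}
    < 3 * (b - a)\<^sup>2 / e^4 + \<eta>"
proof -
  define \<delta> where "\<delta> = b - a"
  have d: "\<delta> > 0" using ab by (simp add: \<delta>_def)
  define R where "R = 2 * \<delta> / (e * \<eta>)"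
  have R: "R > 0" using d e \<eta> by (simp add: R_def)
  define \<psi> where "\<psi> y = min R (max 0 (\<bar>y\<bar> - e))" for y
  have p: "isCont \<psi> y" "\<bar>\<psi> y\<bar> \<le> R" for y
  proof -
    show "isCont \<psi> y" unfolding \<psi>_def by (intro continuous_intros)
    show "\<bar>\<psi> y\<bar> \<le> R" unfolding \<psi>_def using R by auto
  qed
  have psim [measurable]: "\<psi> \<in> borel_measurable borel"
    by (intro borel_measurable_continuous_onI continuous_at_imp_continuous_on ballI p)
  let ?I = "LINT x|std_normal_distribution. \<psi> (sqrt (b - a) * x)"
  have "((\<lambda>\<kappa>. expectation (\<lambda>\<omega>. 1 * \<psi> (incr \<kappa> a b \<omega>)) - expectation (\<lambda>_. 1) * ?I) \<longlongrightarrow> 0) at_top"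
    by (rule weighted_clt[OF ab _ _ p, of "\<lambda>_ _. 1" 1]) auto
  then have "((\<lambda>\<kappa>. expectation (\<lambda>\<omega>. \<psi> (incr \<kappa> a b \<omega>))) \<longlongrightarrow> ?I) at_top"
    by (simp add: prob_space LIM_zero_iff)
  moreover have "((\<lambda>\<kappa>. expectation (\<lambda>\<omega>. (incr \<kappa> a b \<omega>)\<^sup>2)) \<longlongrightarrow> \<delta>) at_top"
    unfolding \<delta>_def by (rule second_moment) (use ab in auto)
  ultimately have "((\<lambda>\<kappa>. (expectation (\<lambda>\<omega>. \<psi> (incr \<kappa> a b \<omega>)) + expectation (\<lambda>\<omega>. (incr \<kappa> a b \<omega>)\<^sup>2) / R) / e) \<longlongrightarrow> (?I + \<delta> / R) / e) at_top"
    using R e by (intro tendsto_intros) auto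
  moreover have "(?I + \<delta> / R) / e < 3 * (b - a)\<^sup>2 / e^4 + \<eta>"
  proof -
    have i4: "integrable std_normal_distribution (\<lambda>x. \<delta>\<^sup>2 / e^3 * x^4)"
      using integrable_std_normal_distribution_moment[of 4] by simp
    have "?I \<le> (LINT x|std_normal_distribution. \<delta>\<^sup>2 / e^3 * x^4)"
    proof (rule integral_mono'[OF i4])
      fix x
      define y where "y = sqrt \<delta> * x"
      have "y ^ 4 = (sqrt \<delta> ^ 2)^2 * x ^ 4" by (simp add: y_def power_mult_distrib)
      then have y4: "\<delta>\<^sup>2 / e^3 * x^4 = y ^ 4 / e^3" using d by (simp add: y_def)
      have "\<psi> y \<le> y ^ 4 / e ^ 3"
      proof (cases "\<bar>y\<bar> > e")
        case True
        have "\<psi> y * e ^ 3 \<le> \<bar>y\<bar> * \<bar>y\<bar> ^ 3"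
          using True e R by (intro mult_mono power_mono) (auto simp: \<psi>_def)
        also have "\<dots> = y ^ 4" by (simp add: power3_eq_cube power4_eq_xxxx)
        finally show ?thesis using e by (simp add: pos_le_divide_eq)
      next
        case False
        then have "\<psi> y = 0" using R by (simp add: \<psi>_def)
        then show ?thesis using e by simp
      qed
      then show "\<psi> (sqrt (b - a) * x) \<le> \<delta>\<^sup>2 / e^3 * x^4" unfolding y4 by (simp only: y_def \<delta>_def)
      show "0 \<le> \<delta>\<^sup>2 / e^3 * x^4" using e by simp
    qed
    also have "\<dots> = \<delta>\<^sup>2 / e^3 * 3"
      using std_normal_distribution_even_moments(1)[of 2] by (simp add: fact_numeral)
    finally have I: "?I \<le> \<delta>\<^sup>2 / e^3 * 3" .
    have "\<delta> / R / e = \<eta> / 2" using d e \<eta> by (simp add: R_def field_simps)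
    moreover have "?I / e \<le> \<delta>\<^sup>2 / e^3 * 3 / e" using I e by (intro divide_right_mono) auto
    moreover have "\<delta>\<^sup>2 / e^3 * 3 / e = 3 * (b - a)\<^sup>2 / e^4"
      by (simp add: \<delta>_def power4_eq_xxxx power3_eq_cube)
    ultimately show ?thesis using \<eta> by (simp add: add_divide_distrib)
  qed
  ultimately have "\<forall>\<^sub>F \<kappa> in at_top. (expectation (\<lambda>\<omega>. \<psi> (incr \<kappa> a b \<omega>)) + expectation (\<lambda>\<omega>. (incr \<kappa> a b \<omega>)\<^sup>2) / R) / e < 3 * (b - a)\<^sup>2 / e^4 + \<eta>"
    by (rule order_tendstoD(2))
  then show ?thesis using eventually_gt_at_top[of 0]
  proof eventually_elim
    case (elim \<kappa>)
    have le: "\<tau> (\<kappa> * a) \<le> \<tau> (\<kappa> * b)" using elim ab by (intro tau_mono) auto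
    let ?P = "prob {\<omega> \<in> space M. \<exists>l\<in>{\<tau> (\<kappa> * a)..\<tau> (\<kappa> * b)}. \<bar>S l \<omega> - S (\<tau> (\<kappa> * a)) \<omega>\<bar> \<ge> 2 * (e * sqrt \<kappa>)}"
    have "e * sqrt \<kappa> * ?P \<le> expectation (\<lambda>\<omega>. max 0 (\<bar>S (\<tau> (\<kappa> * b)) \<omega> - S (\<tau> (\<kappa> * a)) \<omega>\<bar> - e * sqrt \<kappa>))"
      by (rule maximal_inequality[OF le]) (use e elim in auto)
    also have "\<dots> = expectation (\<lambda>\<omega>. sqrt \<kappa> * max 0 (\<bar>incr \<kappa> a b \<omega>\<bar> - e))"
    proof (rule Bochner_Integration.integral_cong[OF refl])
      fix \<omega>
      have "sqrt \<kappa> * max 0 (\<bar>incr \<kappa> a b \<omega>\<bar> - e) = max 0 (sqrt \<kappa> * (\<bar>incr \<kappa> a b \<omega>\<bar> - e))"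
        using elim by (simp add: max_mult_distrib_left)
      also have "sqrt \<kappa> * (\<bar>incr \<kappa> a b \<omega>\<bar> - e) = \<bar>S (\<tau> (\<kappa> * b)) \<omega> - S (\<tau> (\<kappa> * a)) \<omega>\<bar> - e * sqrt \<kappa>"
        using elim by (simp add: incr_def abs_divide right_diff_distrib)
      finally show "max 0 (\<bar>S (\<tau> (\<kappa> * b)) \<omega> - S (\<tau> (\<kappa> * a)) \<omega>\<bar> - e * sqrt \<kappa>) = sqrt \<kappa> * max 0 (\<bar>incr \<kappa> a b \<omega>\<bar> - e)" by simp
    qed
    also have "\<dots> = sqrt \<kappa> * expectation (\<lambda>\<omega>. max 0 (\<bar>incr \<kappa> a b \<omega>\<bar> - e))" by simp
    finally have "e * ?P \<le> expectation (\<lambda>\<omega>. max 0 (\<bar>incr \<kappa> a b \<omega>\<bar> - e))"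
      using elim by (simp add: mult.assoc mult.left_commute[of e])
    also have "\<dots> \<le> expectation (\<lambda>\<omega>. \<psi> (incr \<kappa> a b \<omega>) + (incr \<kappa> a b \<omega>)\<^sup>2 / R)"
    proof (rule integral_mono')
      have ip: "integrable M (\<lambda>\<omega>. \<psi> (incr \<kappa> a b \<omega>))" by (rule integrable_boundedI[where B = R]) (use p in auto)
      then show "integrable M (\<lambda>\<omega>. \<psi> (incr \<kappa> a b \<omega>) + (incr \<kappa> a b \<omega>)\<^sup>2 / R)" by simp
      fix \<omega>
      let ?y = "incr \<kappa> a b \<omega>"
      show "max 0 (\<bar>?y\<bar> - e) \<le> \<psi> ?y + ?y\<^sup>2 / R"
      proof (cases "max 0 (\<bar>?y\<bar> - e) \<le> R")
        case True then show ?thesis using R by (simp add: \<psi>_def)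
      next
        case False
        then have "\<bar>?y\<bar> * R \<le> \<bar>?y\<bar> * \<bar>?y\<bar>" using e R by (intro mult_left_mono) auto
        then have "\<bar>?y\<bar> \<le> ?y\<^sup>2 / R" using R by (simp add: pos_le_divide_eq power2_eq_square)
        moreover have "\<psi> ?y \<ge> 0" using R by (simp add: \<psi>_def)
        ultimately show ?thesis using False e by linarith
      qed
      show "0 \<le> \<psi> ?y + ?y\<^sup>2 / R" using R by (simp add: \<psi>_def)
    qed
    also have "\<dots> = expectation (\<lambda>\<omega>. \<psi> (incr \<kappa> a b \<omega>)) + expectation (\<lambda>\<omega>. (incr \<kappa> a b \<omega>)\<^sup>2) / R"
    proof -
      have ip: "integrable M (\<lambda>\<omega>. \<psi> (incr \<kappa> a b \<omega>))" by (rule integrable_boundedI[where B = R]) (use p in auto)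
      then show ?thesis by simp
    qed
    finally have "?P \<le> (expectation (\<lambda>\<omega>. \<psi> (incr \<kappa> a b \<omega>)) + expectation (\<lambda>\<omega>. (incr \<kappa> a b \<omega>)\<^sup>2) / R) / e"
      using e by (simp add: pos_le_divide_eq mult.commute)
    then show ?case using elim by linarith
  qed
qed

end



section \<open>Finite-dimensional distributions\<close>

definition coord_lipschitz :: "nat \<Rightarrow> real \<Rightarrow> ((nat \<Rightarrow> real) \<Rightarrow> real) \<Rightarrow> bool" where
  "coord_lipschitz n L H \<longleftrightarrow> 0 \<le> L \<and> (\<forall>x y. \<bar>H x - H y\<bar> \<le> L * (\<Sum>i<n. \<bar>x i - y i\<bar>))"

lemma coord_lipschitz_measurable:
  assumes "coord_lipschitz n L H"
  shows "H \<in> borel_measurable borel"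
proof (rule borel_measurable_continuous_onI)
  show "continuous_on UNIV H"
    unfolding continuous_on_def
  proof (rule ballI, rule LIM_zero_cancel, rule Lim_null_comparison)
    fix y :: "nat \<Rightarrow> real"
    show "\<forall>\<^sub>F x in at y within UNIV. norm (H x - H y) \<le> L * (\<Sum>i<n. \<bar>x i - y i\<bar>)"
      using assms by (auto simp: coord_lipschitz_def)
    have "((\<lambda>x. x i) \<longlongrightarrow> y i) (at y within UNIV)" for i :: nat
      using continuous_on_product_coordinates[of i] unfolding continuous_on_def by blast
    then have "((\<lambda>x. L * (\<Sum>i<n. \<bar>x i - y i\<bar>)) \<longlongrightarrow> L * (\<Sum>i<n. \<bar>y i - y i\<bar>)) (at y within UNIV)"
      by (intro tendsto_intros)
    then show "((\<lambda>x. L * (\<Sum>i<n. \<bar>x i - y i\<bar>)) \<longlongrightarrow> 0) (at y within UNIV)" by simp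
  qed
qed

lemma coord_lipschitz_cong:
  assumes "coord_lipschitz n L H" "\<And>i. i < n \<Longrightarrow> x i = y i"
  shows "H x = H y"
proof -
  have "\<bar>H x - H y\<bar> \<le> L * (\<Sum>i<n. \<bar>x i - y i\<bar>)" using assms(1) by (simp add: coord_lipschitz_def)
  also have "\<dots> = 0" using assms(2) by simp
  finally show ?thesis by simp
qed

lemma borel_measurable_sequenceI:
  assumes "\<And>i. (\<lambda>\<omega>. f \<omega> i) \<in> borel_measurable M"
  shows "f \<in> M \<rightarrow>\<^sub>M (borel :: (nat \<Rightarrow> real) measure)"
  using assms by (rule measurable_coordinatewise_then_product)

text \<open>Tent functions centred at the multiples of \<open>\<eta>\<close>, a partition of unity.\<close>

definition hat :: "real \<Rightarrow> int \<Rightarrow> real \<Rightarrow> real" where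
  "hat \<eta> j x = max 0 (1 - \<bar>x / \<eta> - of_int j\<bar>)"

lemma hat_props: "isCont (hat \<eta> j) x" "\<bar>hat \<eta> j x\<bar> \<le> 1" "0 \<le> hat \<eta> j x"
proof -
  show "isCont (hat \<eta> j) x" unfolding hat_def[abs_def] divide_inverse by (intro continuous_intros)
qed (auto simp: hat_def)

lemma hat_far: "0 < \<eta> \<Longrightarrow> hat \<eta> j x \<noteq> 0 \<Longrightarrow> \<bar>x - of_int j * \<eta>\<bar> \<le> \<eta>"
proof -
  assume "0 < \<eta>" "hat \<eta> j x \<noteq> 0"
  then have "\<bar>x / \<eta> - of_int j\<bar> < 1" by (auto simp: hat_def max_def split: if_splits)
  moreover have "x - of_int j * \<eta> = \<eta> * (x / \<eta> - of_int j)" using \<open>0 < \<eta>\<close> by (simp add: field_simps)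
  ultimately show ?thesis using \<open>0 < \<eta>\<close> by (simp add: abs_mult)
qed

lemma hat_support: "hat \<eta> j x \<noteq> 0 \<Longrightarrow> j = \<lfloor>x / \<eta>\<rfloor> \<or> j = \<lfloor>x / \<eta>\<rfloor> + 1"
proof -
  assume "hat \<eta> j x \<noteq> 0"
  then have "\<bar>x / \<eta> - of_int j\<bar> < 1" by (auto simp: hat_def max_def split: if_splits)
  then show ?thesis by linarith
qed

lemma hat_pair: "hat \<eta> \<lfloor>x / \<eta>\<rfloor> x + hat \<eta> (\<lfloor>x / \<eta>\<rfloor> + 1) x = 1"
  unfolding hat_def by (simp add: max_def abs_if) linarith

lemma sum_hat_le: "(\<Sum>j\<in>{-J..J}. hat \<eta> j x) \<le> 1"
proof -
  let ?q = "\<lfloor>x / \<eta>\<rfloor>"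
  have "(\<Sum>j\<in>{-J..J}. hat \<eta> j x) = (\<Sum>j\<in>{-J..J} \<inter> {?q, ?q + 1}. hat \<eta> j x)"
    using hat_support by (intro sum.mono_neutral_right) auto
  also have "\<dots> \<le> (\<Sum>j\<in>{?q, ?q + 1}. hat \<eta> j x)"
    by (rule sum_mono2) (auto simp: hat_props)
  also have "\<dots> = 1" using hat_pair[of \<eta> x] by simp
  finally show ?thesis .
qed

lemma sum_hat_eq:
  assumes "\<bar>x\<bar> < of_int J * \<eta>" "0 < \<eta>"
  shows "(\<Sum>j\<in>{-J..J}. hat \<eta> j x) = 1"
proof -
  let ?q = "\<lfloor>x / \<eta>\<rfloor>"
  have "x / \<eta> < of_int J" "- of_int J < x / \<eta>" using assms by (auto simp: field_simps abs_less_iff)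
  then have "?q \<in> {-J..J}" "?q + 1 \<in> {-J..J}" by (auto simp: le_floor_iff floor_less_iff) linarith+
  then have "(\<Sum>j\<in>{-J..J}. hat \<eta> j x) = (\<Sum>j\<in>{?q, ?q + 1}. hat \<eta> j x)"
    using hat_support by (intro sum.mono_neutral_right) auto
  also have "\<dots> = 1" using hat_pair[of \<eta> x] by simp
  finally show ?thesis .
qed

text \<open>Interpolation by tent functions separates the variable \<open>z\<close> from all others on which \<open>g\<close> may
  depend. Beyond the outermost nodes the tents no longer sum up to 1; the mass they miss costs
  at most \<open>B\<close> and is absorbed by the quadratic term.\<close>

lemma hat_approximation:
  fixes g :: "real \<Rightarrow> real" and J :: int
  assumes "\<And>x y. \<bar>g x - g y\<bar> \<le> L * \<bar>x - y\<bar>" "\<And>x. \<bar>g x\<bar> \<le> B" "0 < \<eta>" "0 < J" "0 \<le> L"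
  shows "\<bar>g z - (\<Sum>j\<in>{-J..J}. g (of_int j * \<eta>) * hat \<eta> j z)\<bar> \<le> L * \<eta> + B * (z / (of_int J * \<eta>))\<^sup>2"
proof -
  let ?s = "\<Sum>j\<in>{-J..J}. hat \<eta> j z"
  have B: "0 \<le> B" using assms(2)[of 0] by linarith
  have "g z - (\<Sum>j\<in>{-J..J}. g (of_int j * \<eta>) * hat \<eta> j z)
    = (\<Sum>j\<in>{-J..J}. (g z - g (of_int j * \<eta>)) * hat \<eta> j z) + g z * (1 - ?s)"
    by (simp add: left_diff_distrib sum_subtractf right_diff_distrib sum_distrib_left)
  also have "\<bar>\<dots>\<bar> \<le> (\<Sum>j\<in>{-J..J}. \<bar>(g z - g (of_int j * \<eta>)) * hat \<eta> j z\<bar>) + \<bar>g z * (1 - ?s)\<bar>"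
    by (intro order_trans[OF abs_triangle_ineq] add_right_mono sum_abs)
  also have "\<dots> \<le> (\<Sum>j\<in>{-J..J}. L * \<eta> * hat \<eta> j z) + B * (z / (of_int J * \<eta>))\<^sup>2"
  proof (intro add_mono sum_mono)
    fix j
    show "\<bar>(g z - g (of_int j * \<eta>)) * hat \<eta> j z\<bar> \<le> L * \<eta> * hat \<eta> j z"
    proof (cases "hat \<eta> j z = 0")
      case False
      have "\<bar>g z - g (of_int j * \<eta>)\<bar> \<le> L * \<bar>z - of_int j * \<eta>\<bar>" by (rule assms(1))
      also have "\<dots> \<le> L * \<eta>" using hat_far[OF assms(3) False] assms(5) by (intro mult_left_mono) auto
      finally show ?thesis by (simp add: abs_mult hat_props mult_right_mono)
    qed simp
  next
    have 1: "0 \<le> 1 - ?s" using sum_hat_le[where J = J and \<eta> = \<eta> and x = z] by simp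
    have "1 - ?s \<le> (z / (of_int J * \<eta>))\<^sup>2"
    proof (cases "\<bar>z\<bar> < of_int J * \<eta>")
      case True
      then show ?thesis using sum_hat_eq[OF True assms(3)] by simp
    next
      case False
      have p: "0 < of_int J * \<eta>" using assms by simp
      then have "1 \<le> \<bar>z / (of_int J * \<eta>)\<bar>" using False assms by (simp add: abs_divide abs_mult pos_le_divide_eq)
      then have "1\<^sup>2 \<le> \<bar>z / (of_int J * \<eta>)\<bar>\<^sup>2" by (intro power_mono) auto
      moreover have "0 \<le> ?s" by (intro sum_nonneg) (simp add: hat_props)
      ultimately show ?thesis unfolding power2_abs by simp
    qed
    then show "\<bar>g z * (1 - ?s)\<bar> \<le> B * (z / (of_int J * \<eta>))\<^sup>2"
      using assms(2)[of z] 1 B by (auto simp: abs_mult intro!: mult_mono)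
  qed
  also have "(\<Sum>j\<in>{-J..J}. L * \<eta> * hat \<eta> j z) \<le> L * \<eta>"
    using sum_hat_le[where J = J and \<eta> = \<eta> and x = z] assms mult_left_mono[of ?s 1 "L * \<eta>"] by (simp add: sum_distrib_left)
  finally show ?thesis by simp
qed

lemma (in prob_space) abs_expectation_le:
  fixes X Y :: "'a \<Rightarrow> real"
  assumes "integrable M X" "integrable M Y" "\<And>\<omega>. \<omega> \<in> space M \<Longrightarrow> \<bar>X \<omega>\<bar> \<le> Y \<omega>"
  shows "\<bar>expectation X\<bar> \<le> expectation Y"
  using assms by (intro order_trans[OF integral_abs_bound] integral_mono) auto

lemma (in prob_space) normal_expectation:
  assumes "distributed M lborel X (normal_density 0 \<sigma>)" "0 < \<sigma>" and [measurable]: "g \<in> borel_measurable borel"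
  shows "expectation (\<lambda>\<omega>. g (X \<omega>)) = (LINT x|std_normal_distribution. g (\<sigma> * x) :: real)"
proof -
  have "distributed M lborel (\<lambda>x. (X x - 0) / \<sigma>) std_normal_density"
    using normal_standard_normal_convert[OF assms(2), of X 0] assms(1) by simp
  then have D: "distributed M lborel (\<lambda>x. X x / \<sigma>) std_normal_density" by simp
  have "(LINT x|std_normal_distribution. g (\<sigma> * x)) = (LINT x|lborel. std_normal_density x * g (\<sigma> * x))"
    by (subst integral_density) (auto simp: normal_density_nonneg)
  also have "\<dots> = expectation (\<lambda>\<omega>. g (\<sigma> * (X \<omega> / \<sigma>)))"
    by (rule distributed_integral[OF D]) (auto simp: normal_density_nonneg)
  finally show ?thesis using assms(2) by simp
qed

text \<open>The first \<open>k\<close> coordinates are frozen and the others are averaged out. Passing from \<open>k = n\<close> to \<open>k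
  = 0\<close> replaces the increments of the martingale by Gaussian ones, one at a time.\<close>

definition (in prob_space) tail_average :: "(nat \<Rightarrow> 'a \<Rightarrow> real) \<Rightarrow> ((nat \<Rightarrow> real) \<Rightarrow> real) \<Rightarrow> nat \<Rightarrow> (nat \<Rightarrow> real) \<Rightarrow> real" where
  "tail_average D H k y = expectation (\<lambda>\<omega>. H (\<lambda>i. if i < k then y i else D i \<omega>))"

locale gaussian_increments = prob_space N for N :: "'b measure" +
  fixes D :: "nat \<Rightarrow> 'b \<Rightarrow> real" and n :: nat and \<sigma> :: real
  assumes indep: "indep_vars (\<lambda>_. borel) D {..<n}"
    and normal: "\<And>i. i < n \<Longrightarrow> distributed N lborel (D i) (normal_density 0 \<sigma>)"
    and sigma_pos: "0 < \<sigma>"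
    and measurable_D: "\<And>i. D i \<in> borel_measurable N"
begin

lemma integrable_tail:
  assumes "coord_lipschitz n L H" "\<And>x. \<bar>H x\<bar> \<le> B"
  shows "integrable N (\<lambda>\<omega>. H (\<lambda>i. if i < k then y i else D i \<omega>))"
proof (rule integrable_const_bound[where B = B])
  have "(\<lambda>\<omega> i. if i < k then y i else D i \<omega>) \<in> N \<rightarrow>\<^sub>M borel"
  proof (rule borel_measurable_sequenceI)
    show "(\<lambda>\<omega>. if i < k then y i else D i \<omega>) \<in> borel_measurable N" for i
      using measurable_D by (cases "i < k") auto
  qed
  then show "(\<lambda>\<omega>. H (\<lambda>i. if i < k then y i else D i \<omega>)) \<in> borel_measurable N"
    using coord_lipschitz_measurable[OF assms(1)] by (rule measurable_compose)
qed (use assms(2) in auto)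

lemma tail_average_lipschitz:
  assumes H: "coord_lipschitz n L H" "\<And>x. \<bar>H x\<bar> \<le> B"
  shows "coord_lipschitz n L (tail_average D H k)"
  unfolding coord_lipschitz_def
proof (intro conjI allI)
  show "0 \<le> L" using H by (simp add: coord_lipschitz_def)
  fix x y
  have i: "integrable N (\<lambda>\<omega>. H (\<lambda>i. if i < k then x i else D i \<omega>))" for x by (rule integrable_tail[OF H])
  have "\<bar>tail_average D H k x - tail_average D H k y\<bar> = \<bar>expectation (\<lambda>\<omega>. H (\<lambda>i. if i < k then x i else D i \<omega>) - H (\<lambda>i. if i < k then y i else D i \<omega>))\<bar>"
    using i by (simp add: tail_average_def)
  also have "\<dots> \<le> expectation (\<lambda>\<omega>. \<bar>H (\<lambda>i. if i < k then x i else D i \<omega>) - H (\<lambda>i. if i < k then y i else D i \<omega>)\<bar>)"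
    by (rule integral_abs_bound)
  also have "\<dots> \<le> expectation (\<lambda>\<omega>. L * (\<Sum>i<n. \<bar>x i - y i\<bar>))"
  proof (rule integral_mono)
    fix \<omega>
    have "\<bar>H (\<lambda>i. if i < k then x i else D i \<omega>) - H (\<lambda>i. if i < k then y i else D i \<omega>)\<bar>
      \<le> L * (\<Sum>i<n. \<bar>(if i < k then x i else D i \<omega>) - (if i < k then y i else D i \<omega>)\<bar>)"
      using H(1) by (simp add: coord_lipschitz_def)
    also have "\<dots> \<le> L * (\<Sum>i<n. \<bar>x i - y i\<bar>)" using \<open>0 \<le> L\<close> by (intro mult_left_mono sum_mono) auto
    finally show "\<bar>H (\<lambda>i. if i < k then x i else D i \<omega>) - H (\<lambda>i. if i < k then y i else D i \<omega>)\<bar> \<le> L * (\<Sum>i<n. \<bar>x i - y i\<bar>)" .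
  qed (use i in auto)
  also have "\<dots> = L * (\<Sum>i<n. \<bar>x i - y i\<bar>)" by (simp add: prob_space)
  finally show "\<bar>tail_average D H k x - tail_average D H k y\<bar> \<le> L * (\<Sum>i<n. \<bar>x i - y i\<bar>)" .
qed

lemma tail_average_bound:
  assumes H: "coord_lipschitz n L H" "\<And>x. \<bar>H x\<bar> \<le> B"
  shows "\<bar>tail_average D H k y\<bar> \<le> B"
proof -
  have "\<bar>tail_average D H k y\<bar> \<le> expectation (\<lambda>\<omega>. \<bar>H (\<lambda>i. if i < k then y i else D i \<omega>)\<bar>)"
    unfolding tail_average_def by (rule integral_abs_bound)
  also have "\<dots> \<le> expectation (\<lambda>\<omega>. B)"
    by (rule integral_mono) (use integrable_tail[OF H] H(2) in auto)
  finally show ?thesis by (simp add: prob_space)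
qed

text \<open>Fubini's theorem, since \<open>D k\<close> is independent of the later coordinates.\<close>

lemma tail_average_step:
  assumes H: "coord_lipschitz n L H" "\<And>x. \<bar>H x\<bar> \<le> B" and k: "k < n"
  shows "tail_average D H k y = (LINT x|std_normal_distribution. tail_average D H (Suc k) (\<lambda>i. if i < k then y i else \<sigma> * x))"
proof -
  let ?A = "{k}" and ?B = "{Suc k..<n}"
  let ?PA = "PiM ?A (\<lambda>_. borel :: real measure)" and ?PB = "PiM ?B (\<lambda>_. borel :: real measure)"
  define XA where "XA \<omega> = restrict (\<lambda>i. D i \<omega>) ?A" for \<omega>
  define XB where "XB \<omega> = restrict (\<lambda>i. D i \<omega>) ?B" for \<omega>
  have ind: "indep_var ?PA XA ?PB XB"
    unfolding XA_def XB_def by (rule indep_var_restrict[OF indep]) (use k in auto)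
  have mA [measurable]: "XA \<in> N \<rightarrow>\<^sub>M ?PA" and mB [measurable]: "XB \<in> N \<rightarrow>\<^sub>M ?PB"
    and eq: "distr N ?PA XA \<Otimes>\<^sub>M distr N ?PB XB = distr N (?PA \<Otimes>\<^sub>M ?PB) (\<lambda>x. (XA x, XB x))"
    using ind unfolding indep_var_distribution_eq by auto
  \<comment> \<open>Coordinates from \<open>n\<close> on do not influence \<open>H\<close>; the value 0 there makes the map measurable.\<close>
  define \<Phi> where "\<Phi> u v = H (\<lambda>i. if i < k then y i else if i = k then u k else if i < n then v i else (0::real))" for u v
  have Hm: "H \<in> borel_measurable borel" by (rule coord_lipschitz_measurable[OF H(1)])
  have Pm: "(\<lambda>p. \<Phi> (fst p) (snd p)) \<in> borel_measurable (?PA \<Otimes>\<^sub>M ?PB)"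
  proof -
    have "(\<lambda>p i. if i < k then y i else if i = k then fst p k else if i < n then snd p i else 0) \<in> (?PA \<Otimes>\<^sub>M ?PB) \<rightarrow>\<^sub>M borel"
    proof (rule borel_measurable_sequenceI)
      fix i
      have "(\<lambda>p. fst p k) \<in> borel_measurable (?PA \<Otimes>\<^sub>M ?PB)"
        by (rule measurable_compose[OF measurable_fst measurable_component_singleton]) simp
      moreover have "(\<lambda>p. snd p i) \<in> borel_measurable (?PA \<Otimes>\<^sub>M ?PB)" if "i \<in> ?B"
        by (rule measurable_compose[OF measurable_snd measurable_component_singleton[OF that]])
      ultimately show "(\<lambda>p. if i < k then y i else if i = k then fst p k else if i < n then snd p i else 0)
          \<in> borel_measurable (?PA \<Otimes>\<^sub>M ?PB)"
        by (cases "i < k"; cases "i = k"; cases "i < n") auto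
    qed
    then show ?thesis unfolding \<Phi>_def using Hm by (rule measurable_compose)
  qed
  interpret A: prob_space "distr N ?PA XA" by (rule prob_space_distr) measurable
  interpret B: prob_space "distr N ?PB XB" by (rule prob_space_distr) measurable
  interpret AB: pair_prob_space "distr N ?PA XA" "distr N ?PB XB" ..
  have Pm': "(\<lambda>p. \<Phi> (fst p) (snd p)) \<in> borel_measurable (distr N ?PA XA \<Otimes>\<^sub>M distr N ?PB XB)"
    using Pm by (simp add: measurable_cong_sets[OF sets_pair_measure_cong[OF sets_distr sets_distr] refl])
  have int: "integrable (distr N ?PA XA \<Otimes>\<^sub>M distr N ?PB XB) (\<lambda>p. \<Phi> (fst p) (snd p))"
    by (rule AB.integrable_const_bound[where B = B]) (use Pm' H(2) in \<open>auto simp: \<Phi>_def\<close>)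
  have PhiB: "\<Phi> u (XB \<omega>) = H (\<lambda>i. if i < k then y i else if i = k then u k else D i \<omega>)" for u \<omega>
    unfolding \<Phi>_def XB_def by (rule coord_lipschitz_cong[OF H(1)]) (use k in auto)
  have sect: "\<Phi> u \<in> borel_measurable ?PB" for u
  proof -
    have "(\<lambda>v. (\<lambda>i. if i < k then y i else if i = k then u k else if i < n then v i else (0::real))) \<in> ?PB \<rightarrow>\<^sub>M borel"
    proof (rule borel_measurable_sequenceI)
      fix i
      have "(\<lambda>v. v i) \<in> borel_measurable ?PB" if "i \<in> ?B"
        by (rule measurable_component_singleton[OF that])
      then show "(\<lambda>v. if i < k then y i else if i = k then u k else if i < n then v i else 0) \<in> borel_measurable ?PB"
        by (cases "i < k"; cases "i = k"; cases "i < n") auto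
    qed
    then show ?thesis unfolding \<Phi>_def using Hm by (rule measurable_compose)
  qed
  have inner: "(LINT v|distr N ?PB XB. \<Phi> u v) = tail_average D H (Suc k) (\<lambda>i. if i < k then y i else u k)" for u
  proof -
    have "(LINT v|distr N ?PB XB. \<Phi> u v) = expectation (\<lambda>\<omega>. \<Phi> u (XB \<omega>))"
      by (rule integral_distr[OF mB sect])
    also have "\<dots> = tail_average D H (Suc k) (\<lambda>i. if i < k then y i else u k)"
      unfolding PhiB tail_average_def
      by (rule Bochner_Integration.integral_cong[OF refl], rule arg_cong[where f = H]) (auto simp: less_Suc_eq)
    finally show ?thesis .
  qed
  define G where "G x = tail_average D H (Suc k) (\<lambda>i. if i < k then y i else x)" for x
  have Gm [measurable]: "G \<in> borel_measurable borel"
  proof -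
    have "(\<lambda>x i. if i < k then y i else x) \<in> borel \<rightarrow>\<^sub>M (borel :: (nat \<Rightarrow> real) measure)"
      by (rule borel_measurable_sequenceI) simp
    then show ?thesis unfolding G_def
      using coord_lipschitz_measurable[OF tail_average_lipschitz[OF H]] by (rule measurable_compose)
  qed
  have "tail_average D H k y = expectation (\<lambda>\<omega>. \<Phi> (XA \<omega>) (XB \<omega>))"
    unfolding PhiB tail_average_def
    by (rule Bochner_Integration.integral_cong[OF refl], rule arg_cong[where f = H]) (auto simp: XA_def)
  also have "\<dots> = (LINT p|distr N (?PA \<Otimes>\<^sub>M ?PB) (\<lambda>x. (XA x, XB x)). \<Phi> (fst p) (snd p))"
    by (subst integral_distr) (use Pm in auto)
  also have "\<dots> = (LINT u|distr N ?PA XA. LINT v|distr N ?PB XB. \<Phi> u v)"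
    unfolding eq[symmetric] using AB.integral_fst'[OF int] by simp
  also have "\<dots> = (LINT u|distr N ?PA XA. G (u k))" by (simp add: inner G_def)
  also have "\<dots> = expectation (\<lambda>\<omega>. G (XA \<omega> k))"
    by (rule integral_distr[OF mA]) (rule measurable_compose[where g = G and N = borel], simp_all)
  also have "\<dots> = expectation (\<lambda>\<omega>. G (D k \<omega>))" by (simp add: XA_def)
  also have "\<dots> = (LINT x|std_normal_distribution. G (\<sigma> * x))"
    by (rule normal_expectation[OF normal[OF k] sigma_pos Gm])
  finally show ?thesis by (simp add: G_def)
qed

end

context time_changed_martingale begin

text \<open>Interpolation in the coordinate \<open>k\<close> turns the functional into a finite sum of products of a
  weight that depends on the earlier increments and a function of the increment over the \<open>k\<close>-th
  cell, and \<open>weighted_clt\<close> treats each product.\<close>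

lemma finite_dimensional_step:
  fixes G :: "(nat \<Rightarrow> real) \<Rightarrow> real"
  assumes d: "0 < \<delta>" and G: "coord_lipschitz n L G" "\<And>x. \<bar>G x\<bar> \<le> B"
  defines "Y \<equiv> \<lambda>\<kappa> \<omega> i. incr \<kappa> (real i * \<delta>) (real (Suc i) * \<delta>) \<omega>"
  shows "((\<lambda>\<kappa>. expectation (\<lambda>\<omega>. G (\<lambda>i. if i < k then Y \<kappa> \<omega> i else Y \<kappa> \<omega> k))
      - expectation (\<lambda>\<omega>. LINT x|std_normal_distribution. G (\<lambda>i. if i < k then Y \<kappa> \<omega> i else sqrt \<delta> * x))) \<longlongrightarrow> 0) at_top"
    (is "(?d \<longlongrightarrow> 0) at_top")
proof (rule tendstoI)
  fix e :: real assume e: "0 < e"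
  define g where "g \<kappa> \<omega> z = G (\<lambda>i. if i < k then Y \<kappa> \<omega> i else z)" for \<kappa> \<omega> z
  have L0: "0 \<le> L" using G(1) by (simp add: coord_lipschitz_def)
  have B0: "0 \<le> B" using G(2)[of undefined] by linarith
  define L' where "L' = L * real n"
  have gL: "\<bar>g \<kappa> \<omega> x - g \<kappa> \<omega> y\<bar> \<le> L' * \<bar>x - y\<bar>" for \<kappa> \<omega> x y
  proof -
    have "\<bar>g \<kappa> \<omega> x - g \<kappa> \<omega> y\<bar> \<le> L * (\<Sum>i<n. \<bar>(if i < k then Y \<kappa> \<omega> i else x) - (if i < k then Y \<kappa> \<omega> i else y)\<bar>)"
      using G(1) by (simp add: g_def coord_lipschitz_def)
    also have "\<dots> \<le> L * (\<Sum>i<n. \<bar>x - y\<bar>)" using L0 by (intro mult_left_mono sum_mono) auto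
    finally show ?thesis by (simp add: L'_def)
  qed
  have gB: "\<bar>g \<kappa> \<omega> z\<bar> \<le> B" for \<kappa> \<omega> z unfolding g_def by (rule G(2))
  have L'0: "0 \<le> L'" using L0 by (simp add: L'_def)
  have ab: "0 \<le> real k * \<delta>" "real k * \<delta> < real (Suc k) * \<delta>" "real (Suc k) * \<delta> - real k * \<delta> = \<delta>"
    using d by (auto simp: algebra_simps)
  \<comment> \<open>The node distance \<open>\<eta>\<close> makes the interpolation error small, the number of nodes \<open>J\<close> the tail error.\<close>
  define \<eta> where "\<eta> = e / (8 * (L' + 1))"
  have eta: "0 < \<eta>" using e L'0 by (simp add: \<eta>_def)
  have L'e: "L' * \<eta> \<le> e / 8" using e L'0 by (simp add: \<eta>_def field_simps)
  obtain J :: int where J: "0 < J" "B * (\<delta> + 1) / (of_int J * \<eta>)\<^sup>2 \<le> e / 8"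
  proof -
    define a where "a = sqrt (B * (\<delta> + 1) * 8 / e) / \<eta>"
    define J where "J = \<lceil>a\<rceil> + 1"
    have a0: "a \<ge> 0" unfolding a_def using B0 d e eta by simp
    have J: "of_int J \<ge> a" "J > 0" unfolding J_def using a0 by linarith+
    have "(a * \<eta>)\<^sup>2 \<le> (of_int J * \<eta>)\<^sup>2" using J a0 eta by (intro power_mono mult_right_mono) auto
    moreover have "(a * \<eta>)\<^sup>2 = B * (\<delta> + 1) * 8 / e" using eta B0 d e by (simp add: a_def)
    ultimately have "B * (\<delta> + 1) * 8 / e \<le> (of_int J * \<eta>)\<^sup>2" by simp
    then have "B * (\<delta> + 1) * 8 \<le> e * (of_int J * \<eta>)\<^sup>2" using e by (simp only: pos_divide_le_eq mult.commute)
    moreover have "(of_int J * \<eta>)\<^sup>2 > 0" using J eta by simp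
    ultimately have "B * (\<delta> + 1) / (of_int J * \<eta>)\<^sup>2 \<le> e / 8" by (simp add: pos_divide_le_eq mult.commute)
    then show ?thesis using that J by blast
  qed
  define I where "I j = (LINT x|std_normal_distribution. hat \<eta> j (sqrt \<delta> * x))" for j
  define D where "D j \<kappa> = expectation (\<lambda>\<omega>. g \<kappa> \<omega> (of_int j * \<eta>) * hat \<eta> j (Y \<kappa> \<omega> k)) - expectation (\<lambda>\<omega>. g \<kappa> \<omega> (of_int j * \<eta>)) * I j" for j \<kappa>
  have Ymeas [measurable]: "(\<lambda>\<omega>. Y \<kappa> \<omega> i) \<in> borel_measurable M" for \<kappa> i unfolding Y_def by measurable
  have Gm [measurable]: "G \<in> borel_measurable borel" by (rule coord_lipschitz_measurable[OF G(1)])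
  have gM [measurable]: "(\<lambda>\<omega>. g \<kappa> \<omega> z) \<in> borel_measurable M" for \<kappa> z
  proof -
    have "(\<lambda>\<omega> i. if i < k then Y \<kappa> \<omega> i else z) \<in> M \<rightarrow>\<^sub>M borel"
      by (rule borel_measurable_sequenceI) simp
    then show ?thesis unfolding g_def using Gm by (rule measurable_compose)
  qed
  have gF: "(\<lambda>\<omega>. g \<kappa> \<omega> z) \<in> borel_measurable (F (\<tau> (\<kappa> * (real k * \<delta>))))" if "\<kappa> > 0" for \<kappa> z
  proof -
    have "(\<lambda>\<omega> i. if i < k then Y \<kappa> \<omega> i else z) \<in> F (\<tau> (\<kappa> * (real k * \<delta>))) \<rightarrow>\<^sub>M borel"
    proof (rule borel_measurable_sequenceI)
      fix i
      have "(\<lambda>\<omega>. Y \<kappa> \<omega> i) \<in> borel_measurable (F (\<tau> (\<kappa> * (real k * \<delta>))))" if "i < k"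
      proof -
        have "real (Suc i) \<le> real k" using that by simp
        then show ?thesis unfolding Y_def using \<open>\<kappa> > 0\<close> d
          by (intro incr_measurable_F mult_right_mono) auto
      qed
      then show "(\<lambda>\<omega>. if i < k then Y \<kappa> \<omega> i else z) \<in> borel_measurable (F (\<tau> (\<kappa> * (real k * \<delta>))))"
        by (cases "i < k") auto
    qed
    then show ?thesis unfolding g_def using Gm by (rule measurable_compose)
  qed
  have "(D j \<longlongrightarrow> 0) at_top" for j
    using weighted_clt[where w = "\<lambda>\<kappa> \<omega>. g \<kappa> \<omega> (of_int j * \<eta>)" and \<psi> = "hat \<eta> j", OF ab(1,2) gF gB hat_props(1,2)]
    unfolding ab(3) by (simp only: D_def[abs_def] I_def Y_def)
  then have "((\<lambda>\<kappa>. \<Sum>j\<in>{-J..J}. D j \<kappa>) \<longlongrightarrow> 0) at_top" by (intro tendsto_null_sum)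
  from tendstoD[OF this, of "e / 4"] e
  have ev1: "\<forall>\<^sub>F \<kappa> in at_top. \<bar>\<Sum>j\<in>{-J..J}. D j \<kappa>\<bar> < e / 4"
    by (simp add: dist_real_def del: zero_less_divide_iff)
  have "((\<lambda>\<kappa>. expectation (\<lambda>\<omega>. (Y \<kappa> \<omega> k)\<^sup>2)) \<longlongrightarrow> \<delta>) at_top"
    using second_moment[of "real k * \<delta>" "real (Suc k) * \<delta>"] ab d by (simp add: Y_def)
  then have ev2: "\<forall>\<^sub>F \<kappa> in at_top. expectation (\<lambda>\<omega>. (Y \<kappa> \<omega> k)\<^sup>2) < \<delta> + 1"
    by (rule order_tendstoD) simp
  from ev1 ev2 show "\<forall>\<^sub>F \<kappa> in at_top. dist (?d \<kappa>) 0 < e"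
  proof eventually_elim
    case (elim \<kappa>)
    interpret std: real_distribution std_normal_distribution by (rule real_dist_normal_dist)
    define T where "T = (\<Sum>j\<in>{-J..J}. expectation (\<lambda>\<omega>. g \<kappa> \<omega> (of_int j * \<eta>) * hat \<eta> j (Y \<kappa> \<omega> k)))"
    define T' where "T' = (\<Sum>j\<in>{-J..J}. expectation (\<lambda>\<omega>. g \<kappa> \<omega> (of_int j * \<eta>)) * I j)"
    have hm [measurable]: "hat \<eta> j \<in> borel_measurable borel" for j
      by (intro borel_measurable_continuous_onI continuous_at_imp_continuous_on ballI hat_props)
    have TT: "T - T' = (\<Sum>j\<in>{-J..J}. D j \<kappa>)" by (simp add: T_def T'_def D_def sum_subtractf)
    let ?E1 = "expectation (\<lambda>\<omega>. g \<kappa> \<omega> (Y \<kappa> \<omega> k))"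
    let ?E2 = "expectation (\<lambda>\<omega>. LINT x|std_normal_distribution. g \<kappa> \<omega> (sqrt \<delta> * x))"
    have igh: "integrable M (\<lambda>\<omega>. g \<kappa> \<omega> (of_int j * \<eta>) * hat \<eta> j (Y \<kappa> \<omega> k))" for j
    proof (rule integrable_boundedI[where B = "B * 1"])
      show "norm (g \<kappa> \<omega> (of_int j * \<eta>) * hat \<eta> j (Y \<kappa> \<omega> k)) \<le> B * 1" for \<omega>
        unfolding real_norm_def abs_mult by (intro mult_mono gB hat_props) (use B0 in auto)
    qed measurable
    have ig1: "integrable M (\<lambda>\<omega>. g \<kappa> \<omega> (Y \<kappa> \<omega> k))"
    proof (rule integrable_boundedI[where B = B])
      have "(\<lambda>\<omega> i. if i < k then Y \<kappa> \<omega> i else Y \<kappa> \<omega> k) \<in> M \<rightarrow>\<^sub>M borel"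
        by (rule borel_measurable_sequenceI) simp
      then show "(\<lambda>\<omega>. g \<kappa> \<omega> (Y \<kappa> \<omega> k)) \<in> borel_measurable M" unfolding g_def using Gm by (rule measurable_compose)
    qed (use gB in auto)
    have q1: "\<bar>?E1 - T\<bar> \<le> L' * \<eta> + B * (\<delta> + 1) / (of_int J * \<eta>)\<^sup>2"
    proof -
      have "?E1 - T = expectation (\<lambda>\<omega>. g \<kappa> \<omega> (Y \<kappa> \<omega> k) - (\<Sum>j\<in>{-J..J}. g \<kappa> \<omega> (of_int j * \<eta>) * hat \<eta> j (Y \<kappa> \<omega> k)))"
        using ig1 igh by (simp add: T_def)
      also have "\<bar>\<dots>\<bar> \<le> expectation (\<lambda>\<omega>. L' * \<eta> + B * (Y \<kappa> \<omega> k / (of_int J * \<eta>))\<^sup>2)"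
      proof (rule abs_expectation_le)
        show "integrable M (\<lambda>\<omega>. L' * \<eta> + B * (Y \<kappa> \<omega> k / (of_int J * \<eta>))\<^sup>2)"
          by (simp add: Y_def power_divide)
        show "integrable M (\<lambda>\<omega>. g \<kappa> \<omega> (Y \<kappa> \<omega> k) - (\<Sum>j\<in>{-J..J}. g \<kappa> \<omega> (of_int j * \<eta>) * hat \<eta> j (Y \<kappa> \<omega> k)))"
          using ig1 igh by simp
        show "\<bar>g \<kappa> \<omega> (Y \<kappa> \<omega> k) - (\<Sum>j\<in>{-J..J}. g \<kappa> \<omega> (of_int j * \<eta>) * hat \<eta> j (Y \<kappa> \<omega> k))\<bar>
            \<le> L' * \<eta> + B * (Y \<kappa> \<omega> k / (of_int J * \<eta>))\<^sup>2" for \<omega>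
          by (rule hat_approximation[OF gL gB eta J(1) L'0])
      qed
      also have "\<dots> = L' * \<eta> + B * expectation (\<lambda>\<omega>. (Y \<kappa> \<omega> k)\<^sup>2) / (of_int J * \<eta>)\<^sup>2"
        by (simp add: Y_def power_divide prob_space)
      also have "\<dots> \<le> L' * \<eta> + B * (\<delta> + 1) / (of_int J * \<eta>)\<^sup>2"
        using elim(2) B0 by (intro add_left_mono divide_right_mono mult_left_mono) auto
      finally show ?thesis .
    qed
    have gz [measurable]: "(\<lambda>z. g \<kappa> \<omega> z) \<in> borel_measurable borel" for \<omega>
    proof -
      have "(\<lambda>z i. if i < k then Y \<kappa> \<omega> i else z) \<in> borel \<rightarrow>\<^sub>M (borel :: (nat \<Rightarrow> real) measure)"
        by (rule borel_measurable_sequenceI) simp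
      then show ?thesis unfolding g_def using Gm by (rule measurable_compose)
    qed
    have igz: "integrable std_normal_distribution (\<lambda>x. g \<kappa> \<omega> (sqrt \<delta> * x))" for \<omega>
      by (rule std.integrable_const_bound[where B = B]) (use gB in auto)
    have ihz: "integrable std_normal_distribution (\<lambda>x. hat \<eta> j (sqrt \<delta> * x))" for j
      by (rule std.integrable_const_bound[where B = 1]) (use hat_props in auto)
    have pw: "\<bar>(LINT x|std_normal_distribution. g \<kappa> \<omega> (sqrt \<delta> * x)) - (\<Sum>j\<in>{-J..J}. g \<kappa> \<omega> (of_int j * \<eta>) * I j)\<bar>
       \<le> L' * \<eta> + B * (\<delta> + 1) / (of_int J * \<eta>)\<^sup>2" for \<omega>
    proof -
      define f where "f x = g \<kappa> \<omega> (sqrt \<delta> * x) - (\<Sum>j\<in>{-J..J}. g \<kappa> \<omega> (of_int j * \<eta>) * hat \<eta> j (sqrt \<delta> * x))" for x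
      define C where "C = B * \<delta> / (of_int J * \<eta>)\<^sup>2"
      have i2: "integrable std_normal_distribution (\<lambda>x. C * x\<^sup>2)"
        by (rule integrable_mult_right, rule integrable_std_normal_distribution_moment)
      have i3: "integrable std_normal_distribution (\<lambda>x. L' * \<eta> + C * x\<^sup>2)"
        by (rule Bochner_Integration.integrable_add[OF std.integrable_const i2])
      have ish: "integrable std_normal_distribution (\<lambda>x. \<Sum>j\<in>{-J..J}. g \<kappa> \<omega> (of_int j * \<eta>) * hat \<eta> j (sqrt \<delta> * x))"
        by (rule Bochner_Integration.integrable_sum, rule integrable_mult_right, rule ihz)
      have "integral\<^sup>L std_normal_distribution f = (LINT x|std_normal_distribution. g \<kappa> \<omega> (sqrt \<delta> * x))
          - (LINT x|std_normal_distribution. (\<Sum>j\<in>{-J..J}. g \<kappa> \<omega> (of_int j * \<eta>) * hat \<eta> j (sqrt \<delta> * x)))"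
        unfolding f_def[abs_def] by (rule Bochner_Integration.integral_diff[OF igz ish])
      moreover have "(LINT x|std_normal_distribution. (\<Sum>j\<in>{-J..J}. g \<kappa> \<omega> (of_int j * \<eta>) * hat \<eta> j (sqrt \<delta> * x)))
          = (\<Sum>j\<in>{-J..J}. g \<kappa> \<omega> (of_int j * \<eta>) * I j)"
        unfolding I_def
        by (subst Bochner_Integration.integral_sum) (simp_all only: integral_mult_right_zero integrable_mult_right[OF ihz])
      ultimately have eq: "(LINT x|std_normal_distribution. g \<kappa> \<omega> (sqrt \<delta> * x)) - (\<Sum>j\<in>{-J..J}. g \<kappa> \<omega> (of_int j * \<eta>) * I j)
          = integral\<^sup>L std_normal_distribution f" by linarith
      have fi: "integrable std_normal_distribution f"
        unfolding f_def[abs_def] by (rule Bochner_Integration.integrable_diff[OF igz ish])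
      have "\<bar>integral\<^sup>L std_normal_distribution f\<bar> \<le> (LINT x|std_normal_distribution. L' * \<eta> + C * x\<^sup>2)"
      proof (rule std.abs_expectation_le[OF fi i3])
        fix x
        have "\<bar>f x\<bar> \<le> L' * \<eta> + B * (sqrt \<delta> * x / (of_int J * \<eta>))\<^sup>2"
          unfolding f_def by (rule hat_approximation[OF gL gB eta J(1) L'0])
        moreover have "B * (sqrt \<delta> * x / (of_int J * \<eta>))\<^sup>2 = C * x\<^sup>2"
          using d by (simp add: C_def power_divide power_mult_distrib)
        ultimately show "\<bar>f x\<bar> \<le> L' * \<eta> + C * x\<^sup>2" by linarith
      qed
      moreover have "(LINT x|std_normal_distribution. L' * \<eta> + C * x\<^sup>2) = L' * \<eta> + C"
      proof -
        have "(LINT x|std_normal_distribution. x\<^sup>2) = (1::real)"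
          using std_normal_distribution_even_moments(1)[of 1] by simp
        then show ?thesis
          by (subst Bochner_Integration.integral_add[OF std.integrable_const i2])
            (simp only: integral_mult_right_zero lebesgue_integral_const std.prob_space scaleR_one mult_1_right)
      qed
      moreover have "C \<le> B * (\<delta> + 1) / (of_int J * \<eta>)\<^sup>2"
        unfolding C_def using B0 by (intro divide_right_mono mult_left_mono) auto
      ultimately show ?thesis unfolding eq by linarith
    qed
    have q2: "\<bar>?E2 - T'\<bar> \<le> L' * \<eta> + B * (\<delta> + 1) / (of_int J * \<eta>)\<^sup>2"
    proof -
      have igc: "integrable M (\<lambda>\<omega>. g \<kappa> \<omega> z)" for z
        by (rule integrable_boundedI[where B = B]) (use gB in auto)
      have ig2: "integrable M (\<lambda>\<omega>. LINT x|std_normal_distribution. g \<kappa> \<omega> (sqrt \<delta> * x))"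
      proof (rule integrable_boundedI[where B = B])
        have "(\<lambda>p i. if i < k then Y \<kappa> (fst p) i else sqrt \<delta> * snd p) \<in> (M \<Otimes>\<^sub>M std_normal_distribution) \<rightarrow>\<^sub>M borel"
          by (rule borel_measurable_sequenceI) simp
        then have "(\<lambda>p. g \<kappa> (fst p) (sqrt \<delta> * snd p)) \<in> borel_measurable (M \<Otimes>\<^sub>M std_normal_distribution)"
          unfolding g_def using Gm by (rule measurable_compose)
        then show "(\<lambda>\<omega>. LINT x|std_normal_distribution. g \<kappa> \<omega> (sqrt \<delta> * x)) \<in> borel_measurable M"
          by (intro std.borel_measurable_lebesgue_integral) (simp add: case_prod_beta')
        fix \<omega>
        have "\<bar>LINT x|std_normal_distribution. g \<kappa> \<omega> (sqrt \<delta> * x)\<bar> \<le> (LINT x|std_normal_distribution. \<bar>g \<kappa> \<omega> (sqrt \<delta> * x)\<bar>)"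
          by (rule integral_abs_bound)
        also have "\<dots> \<le> (LINT x|std_normal_distribution. B)"
          by (rule integral_mono) (use igz gB in auto)
        finally show "norm (LINT x|std_normal_distribution. g \<kappa> \<omega> (sqrt \<delta> * x)) \<le> B" using std.prob_space by simp
      qed
      have "?E2 - T' = expectation (\<lambda>\<omega>. (LINT x|std_normal_distribution. g \<kappa> \<omega> (sqrt \<delta> * x)) - (\<Sum>j\<in>{-J..J}. g \<kappa> \<omega> (of_int j * \<eta>) * I j))"
        using ig2 igc by (simp add: T'_def)
      also have "\<bar>\<dots>\<bar> \<le> expectation (\<lambda>\<omega>. L' * \<eta> + B * (\<delta> + 1) / (of_int J * \<eta>)\<^sup>2)"
        by (rule abs_expectation_le) (use ig2 igc pw in auto)
      finally show ?thesis by (simp add: prob_space)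
    qed
    have "?d \<kappa> = ?E1 - ?E2" by (simp add: g_def)
    also have "\<bar>\<dots>\<bar> < e" using q1 q2 elim(1) TT L'e J(2) e by linarith
    finally show ?case by (simp add: dist_real_def)
  qed
qed

lemma finite_dimensional_convergence:
  fixes N :: "'b measure" and H :: "(nat \<Rightarrow> real) \<Rightarrow> real"
  assumes d: "0 < \<delta>" and N: "gaussian_increments N D n (sqrt \<delta>)"
    and H: "coord_lipschitz n L H" "\<And>x. \<bar>H x\<bar> \<le> B"
  shows "((\<lambda>\<kappa>. expectation (\<lambda>\<omega>. H (\<lambda>i. incr \<kappa> (real i * \<delta>) (real (Suc i) * \<delta>) \<omega>)))
     \<longlongrightarrow> (LINT \<omega>|N. H (\<lambda>i. D i \<omega>))) at_top"
proof -
  interpret N: gaussian_increments N D n "sqrt \<delta>" by fact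
  define Y where "Y \<kappa> \<omega> i = incr \<kappa> (real i * \<delta>) (real (Suc i) * \<delta>) \<omega>" for \<kappa> \<omega> i
  let ?A = "N.tail_average D H"
  have "((\<lambda>\<kappa>. expectation (\<lambda>\<omega>. ?A k (Y \<kappa> \<omega>))) \<longlongrightarrow> (LINT \<omega>|N. H (\<lambda>i. D i \<omega>))) at_top" if "k \<le> n" for k
    using that
  proof (induction k)
    case 0
    then show ?case by (simp add: N.tail_average_def prob_space)
  next
    case (Suc k)
    have 1: "?A (Suc k) (\<lambda>i. if i < k then Y \<kappa> \<omega> i else Y \<kappa> \<omega> k) = ?A (Suc k) (Y \<kappa> \<omega>)" for \<kappa> \<omega>
      unfolding N.tail_average_def
      by (rule Bochner_Integration.integral_cong[OF refl], rule arg_cong[where f = H]) (auto simp: less_Suc_eq)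
    have 2: "(LINT x|std_normal_distribution. ?A (Suc k) (\<lambda>i. if i < k then Y \<kappa> \<omega> i else sqrt \<delta> * x)) = ?A k (Y \<kappa> \<omega>)" for \<kappa> \<omega>
      by (rule N.tail_average_step[OF H, symmetric]) (use Suc in auto)
    have "((\<lambda>\<kappa>. expectation (\<lambda>\<omega>. ?A (Suc k) (Y \<kappa> \<omega>)) - expectation (\<lambda>\<omega>. ?A k (Y \<kappa> \<omega>))) \<longlongrightarrow> 0) at_top"
      using finite_dimensional_step[where G = "?A (Suc k)" and k = k, OF d N.tail_average_lipschitz[OF H] N.tail_average_bound[OF H]]
      unfolding Y_def[symmetric] 1 2 .
    from tendsto_add[OF this Suc.IH] Suc.prems show ?case by simp
  qed
  from this[OF order_refl]
  have "((\<lambda>\<kappa>. expectation (\<lambda>\<omega>. ?A n (Y \<kappa> \<omega>))) \<longlongrightarrow> (LINT \<omega>|N. H (\<lambda>i. D i \<omega>))) at_top" .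
  moreover have "?A n y = H y" for y
  proof -
    have "?A n y = (LINT \<omega>|N. H y)" unfolding N.tail_average_def
      by (rule Bochner_Integration.integral_cong[OF refl], rule coord_lipschitz_cong[OF H(1)]) auto
    then show ?thesis by (simp add: N.prob_space)
  qed
  ultimately show ?thesis unfolding Y_def by simp
qed

end



section \<open>Step functions and Brownian motion\<close>

text \<open>Between consecutive changes of the index the path follows a continuous function.\<close>

lemma cadlag_piecewise:
  fixes q :: "nat \<Rightarrow> real \<Rightarrow> real"
  assumes right: "\<And>t. 0 \<le> t \<Longrightarrow> \<forall>\<^sub>F u in at_right t. K u = K t"
    and left: "\<And>t. 0 < t \<Longrightarrow> \<exists>k. \<forall>\<^sub>F u in at_left t. K u = k"
    and q: "\<And>k. continuous_on {0..} (q k)"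
  shows "(\<lambda>t\<in>{0..}. q (K t) t) \<in> cadlag_paths"
  unfolding cadlag_paths_def
proof (intro CollectI conjI allI impI)
  fix t :: real assume t: "0 \<le> t"
  have "(q (K t) \<longlongrightarrow> q (K t) t) (at t within {0..})" using q t by (auto simp: continuous_on_def)
  then have "(q (K t) \<longlongrightarrow> q (K t) t) (at_right t)" by (rule tendsto_within_subset) (use t in auto)
  moreover have "\<forall>\<^sub>F u in at_right t. q (K t) u = (\<lambda>t\<in>{0..}. q (K t) t) u"
    using right[OF t] eventually_at_right_less by eventually_elim (use t in auto)
  ultimately show "((\<lambda>t\<in>{0..}. q (K t) t) \<longlongrightarrow> (\<lambda>t\<in>{0..}. q (K t) t) t) (at_right t)"
    using t by (simp add: Lim_transform_eventually)
next
  fix t :: real assume t: "0 < t"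
  obtain k where k: "\<forall>\<^sub>F u in at_left t. K u = k" using left[OF t] by blast
  have "(q k \<longlongrightarrow> q k t) (at t within {0..})" using q t by (auto simp: continuous_on_def)
  then have "(q k \<longlongrightarrow> q k t) (at t within {0..<t})" by (rule tendsto_within_subset) auto
  moreover have "at t within {0..<t} = at_left t"
    by (rule at_within_nhd[of _ "{0<..}"]) (use t in auto)
  ultimately have "(q k \<longlongrightarrow> q k t) (at_left t)" by simp
  moreover have "\<forall>\<^sub>F u in at_left t. q k u = (\<lambda>t\<in>{0..}. q (K t) t) u"
    using k eventually_at_left_real[OF t] by eventually_elim auto
  ultimately show "\<exists>l. ((\<lambda>t\<in>{0..}. q (K t) t) \<longlongrightarrow> l) (at_left t)"
    using Lim_transform_eventually by blast
qed simp

text \<open>The path with start \<open>z\<close> and increment \<open>y i\<close> over the cell \<open>i\<close> of a grid of \<open>n\<close> cells of length \<open>\<delta>\<close>,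
  constant between the grid points.\<close>

definition step_path :: "real \<Rightarrow> real \<Rightarrow> nat \<Rightarrow> (nat \<Rightarrow> real) \<Rightarrow> real \<Rightarrow> real" where
  "step_path z \<delta> n y = (\<lambda>t\<in>{0..}. z + (\<Sum>i<min n (nat \<lfloor>t / \<delta>\<rfloor>). y i))"

lemma step_path_cadlag:
  assumes d: "0 < \<delta>"
  shows "step_path z \<delta> n y \<in> cadlag_paths"
  unfolding step_path_def
proof (rule cadlag_piecewise[where K = "\<lambda>t. nat \<lfloor>t / \<delta>\<rfloor>" and q = "\<lambda>k t. z + (\<Sum>i<min n k. y i)"])
  fix t :: real
  have "t < \<delta> * (of_int \<lfloor>t / \<delta>\<rfloor> + 1)"
  proof -
    have "t / \<delta> < of_int \<lfloor>t / \<delta>\<rfloor> + 1" by linarith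
    then show ?thesis using d by (simp add: field_simps)
  qed
  from eventually_at_right_real[OF this]
  show "\<forall>\<^sub>F u in at_right t. nat \<lfloor>u / \<delta>\<rfloor> = nat \<lfloor>t / \<delta>\<rfloor>"
  proof eventually_elim
    case (elim u)
    have "t / \<delta> < u / \<delta>" using elim d by (simp add: divide_strict_right_mono)
    moreover have "u / \<delta> < of_int \<lfloor>t / \<delta>\<rfloor> + 1" using elim d by (simp add: field_simps)
    ultimately have "\<lfloor>u / \<delta>\<rfloor> = \<lfloor>t / \<delta>\<rfloor>" by linarith
    then show ?case by simp
  qed
next
  fix t :: real
  have "\<delta> * (of_int \<lceil>t / \<delta>\<rceil> - 1) < t"
  proof -
    have "of_int \<lceil>t / \<delta>\<rceil> - 1 < t / \<delta>" by linarith
    then show ?thesis using d by (simp add: field_simps)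
  qed
  from eventually_at_left_real[OF this]
  have "\<forall>\<^sub>F u in at_left t. nat \<lfloor>u / \<delta>\<rfloor> = nat (\<lceil>t / \<delta>\<rceil> - 1)"
  proof eventually_elim
    case (elim u)
    have "u / \<delta> < t / \<delta>" using elim d by (simp add: divide_strict_right_mono)
    moreover have "of_int \<lceil>t / \<delta>\<rceil> - 1 < u / \<delta>" using elim d by (simp add: field_simps)
    ultimately have "\<lfloor>u / \<delta>\<rfloor> = \<lceil>t / \<delta>\<rceil> - 1" by linarith
    then show ?case by simp
  qed
  then show "\<exists>k. \<forall>\<^sub>F u in at_left t. nat \<lfloor>u / \<delta>\<rfloor> = k" by blast
qed auto

lemma step_path_dist:
  "path_dist (step_path z \<delta> n y) (step_path z' \<delta> n y') \<le> \<bar>z - z'\<bar> + (\<Sum>i<n. \<bar>y i - y' i\<bar>)"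
proof (rule path_dist_le)
  fix t :: real assume t: "0 \<le> t"
  let ?k = "min n (nat \<lfloor>t / \<delta>\<rfloor>)"
  have "\<bar>step_path z \<delta> n y t - step_path z' \<delta> n y' t\<bar> = \<bar>(z - z') + (\<Sum>i<?k. y i - y' i)\<bar>"
    using t by (simp add: step_path_def sum_subtractf algebra_simps)
  also have "\<dots> \<le> \<bar>z - z'\<bar> + (\<Sum>i<?k. \<bar>y i - y' i\<bar>)"
    by (intro order_trans[OF abs_triangle_ineq] add_left_mono sum_abs)
  also have "\<dots> \<le> \<bar>z - z'\<bar> + (\<Sum>i<n. \<bar>y i - y' i\<bar>)" by (intro add_left_mono sum_mono2) auto
  finally show "min \<bar>step_path z \<delta> n y t - step_path z' \<delta> n y' t\<bar> (1 / (1 + t)) \<le> \<bar>z - z'\<bar> + (\<Sum>i<n. \<bar>y i - y' i\<bar>)" by linarith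
qed

lemma step_path_lipschitz:
  assumes "path_lipschitz L h" "0 < \<delta>"
  shows "coord_lipschitz n L (\<lambda>y. h (step_path z \<delta> n y))"
    and "coord_lipschitz (Suc n) L (\<lambda>y. h (step_path (y n) \<delta> n y))"
proof -
  have L: "0 < L" "\<bar>h (step_path z \<delta> n y) - h (step_path z' \<delta> n y')\<bar> \<le> L * path_dist (step_path z \<delta> n y) (step_path z' \<delta> n y')" for z z' y y'
    using assms step_path_cadlag[OF assms(2)] by (auto simp: path_lipschitz_def)
  have le: "\<bar>h (step_path z \<delta> n y) - h (step_path z' \<delta> n y')\<bar> \<le> L * (\<bar>z - z'\<bar> + (\<Sum>i<n. \<bar>y i - y' i\<bar>))" for z z' y y'
    using L(1) by (intro order_trans[OF L(2)] mult_left_mono step_path_dist) auto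
  show "coord_lipschitz n L (\<lambda>y. h (step_path z \<delta> n y))"
    using le[of z _ z] L(1) by (simp add: coord_lipschitz_def)
  show "coord_lipschitz (Suc n) L (\<lambda>y. h (step_path (y n) \<delta> n y))"
    using le[of "_ n" _ "_ n"] L(1) by (simp add: coord_lipschitz_def add.commute)
qed

context standard_brownian_motion begin

text \<open>Grid \<open>m\<close> has \<open>(m + 1)\<^sup>3\<close> cells of length \<open>1 / (m + 1)\<^sup>2\<close>. It covers \<open>[0, m + 1)\<close>, while the number of cells times the
  squared cell length, which up to a factor bounds the probability of a large oscillation in some cell, tends to
  zero.\<close>

definition mesh :: "nat \<Rightarrow> real" where "mesh m = 1 / (real (Suc m))\<^sup>2"

definition increment :: "nat \<Rightarrow> nat \<Rightarrow> 'b \<Rightarrow> real" where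
  "increment m i \<omega> = W (real (Suc i) * mesh m) \<omega> - W (real i * mesh m) \<omega>"

definition skeleton :: "nat \<Rightarrow> 'b \<Rightarrow> real \<Rightarrow> real" where
  "skeleton m \<omega> = step_path (W 0 \<omega>) (mesh m) (Suc m ^ 3) (\<lambda>i. increment m i \<omega>)"

lemma mesh_pos: "0 < mesh m" by (simp add: mesh_def)

lemma mesh_length: "real (Suc m ^ 3) * mesh m = real (Suc m)"
proof -
  have "r ^ 3 * (1 / r\<^sup>2) = r" if "r \<noteq> 0" for r :: real
    using that by (simp add: power3_eq_cube power2_eq_square)
  from this[of "real (Suc m)"] show ?thesis by (simp only: mesh_def of_nat_power)
qed

lemma increment_measurable: "increment m i \<in> borel_measurable N"
  unfolding increment_def[abs_def] using mesh_pos[of m]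
  by (intro borel_measurable_diff random_variable_W mult_nonneg_nonneg) auto

lemma skeleton_eq: "0 \<le> t \<Longrightarrow> t < real (Suc m) \<Longrightarrow> skeleton m \<omega> t = W (of_int \<lfloor>t / mesh m\<rfloor> * mesh m) \<omega>"
proof -
  assume t: "0 \<le> t" "t < real (Suc m)"
  let ?k = "nat \<lfloor>t / mesh m\<rfloor>"
  have 0: "0 \<le> t / mesh m" using t mesh_pos[of m] by simp
  have "t / mesh m < real (Suc m ^ 3)"
    using t mesh_length[of m] mesh_pos[of m] by (simp add: pos_divide_less_eq)
  then have "?k < Suc m ^ 3" using 0 by (simp add: nat_less_iff floor_less_iff)
  then have "skeleton m \<omega> t = W 0 \<omega> + (\<Sum>i<?k. W (real (Suc i) * mesh m) \<omega> - W (real i * mesh m) \<omega>)"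
    using t by (simp add: skeleton_def step_path_def increment_def min_def)
  also have "\<dots> = W (real ?k * mesh m) \<omega>"
    by (subst sum_lessThan_telescope) simp
  also have "real ?k = of_int \<lfloor>t / mesh m\<rfloor>" using 0 by simp
  finally show ?thesis .
qed

lemma path_cadlag: "\<omega> \<in> space N \<Longrightarrow> (\<lambda>t\<in>{0..}. W t \<omega>) \<in> cadlag_paths"
  using cadlag_piecewise[of "\<lambda>_. 0" "\<lambda>_ t. W t \<omega>"] continuous_paths by simp

lemma skeleton_converges:
  assumes w: "\<omega> \<in> space N"
  shows "(\<lambda>m. path_dist (skeleton m \<omega>) (\<lambda>t\<in>{0..}. W t \<omega>)) \<longlonglongrightarrow> 0"
proof (rule LIMSEQ_I)
  fix e :: real assume e: "0 < e"
  define T where "T = 2 / e"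
  have T: "0 < T" "1 / (1 + T) \<le> e / 2" using e by (auto simp: T_def field_simps)
  have "uniformly_continuous_on {0..T} (\<lambda>t. W t \<omega>)"
    using continuous_paths[OF w] by (intro compact_uniformly_continuous) (auto intro: continuous_on_subset)
  then obtain d where d: "0 < d" "\<And>s t. s \<in> {0..T} \<Longrightarrow> t \<in> {0..T} \<Longrightarrow> dist s t < d \<Longrightarrow> dist (W s \<omega>) (W t \<omega>) < e / 2"
    using e unfolding uniformly_continuous_on_def by (metis half_gt_zero)
  obtain m0 where m0: "real m0 > max T (1 / d)" using reals_Archimedean2 by blast
  show "\<exists>m0. \<forall>m\<ge>m0. norm (path_dist (skeleton m \<omega>) (\<lambda>t\<in>{0..}. W t \<omega>) - 0) < e"
  proof (intro exI allI impI)
    fix m assume m: "m0 \<le> m"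
    have mT: "real (Suc m) > T" using m0 m by simp
    have md: "mesh m < d"
    proof -
      have "1 / d < real (Suc m)" using m0 m by simp
      also have "\<dots> \<le> (real (Suc m))\<^sup>2" by (simp add: power2_eq_square)
      finally show ?thesis using d(1) by (simp add: mesh_def field_simps)
    qed
    have "path_dist (skeleton m \<omega>) (\<lambda>t\<in>{0..}. W t \<omega>) \<le> e / 2"
    proof (rule path_dist_le_uniform[of T])
      fix t assume t: "0 \<le> t" "t < T"
      let ?s = "of_int \<lfloor>t / mesh m\<rfloor> * mesh m"
      have fl: "of_int \<lfloor>t / mesh m\<rfloor> \<le> t / mesh m" "t / mesh m < of_int \<lfloor>t / mesh m\<rfloor> + 1" "0 \<le> \<lfloor>t / mesh m\<rfloor>"
        using t mesh_pos[of m] by auto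
      have s: "?s \<le> t" using fl(1) mesh_pos[of m] by (simp only: pos_le_divide_eq)
      have s': "t < ?s + mesh m" using fl(2) mesh_pos[of m] by (simp only: pos_divide_less_eq distrib_right mult_1)
      have s'': "0 \<le> ?s" using fl(3) mesh_pos[of m] by simp
      then have "dist (W ?s \<omega>) (W t \<omega>) < e / 2"
        using t md s s' s'' by (intro d(2)) (auto simp: dist_real_def)
      then show "\<bar>skeleton m \<omega> t - (\<lambda>t\<in>{0..}. W t \<omega>) t\<bar> \<le> e / 2"
        using t mT by (simp add: skeleton_eq dist_real_def)
    qed (use T in auto)
    then show "norm (path_dist (skeleton m \<omega>) (\<lambda>t\<in>{0..}. W t \<omega>) - 0) < e"
      using e path_dist_nonneg[of "skeleton m \<omega>" "\<lambda>t\<in>{0..}. W t \<omega>"] by simp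
  qed
qed

lemma skeleton_measurable: "skeleton m \<in> N \<rightarrow>\<^sub>M borel_of cadlag_topology"
proof (rule measurable_cadlag_lipschitzI)
  show "skeleton m \<omega> \<in> cadlag_paths" for \<omega> unfolding skeleton_def by (rule step_path_cadlag[OF mesh_pos])
  fix g assume g: "path_lipschitz 1 g"
  let ?n = "Suc m ^ 3"
  \<comment> \<open>Coordinate \<open>?n\<close> carries the starting point, which is zero only almost surely.\<close>
  have "(\<lambda>\<omega> i. if i = ?n then W 0 \<omega> else increment m i \<omega>) \<in> N \<rightarrow>\<^sub>M borel"
  proof (rule borel_measurable_sequenceI)
    show "(\<lambda>\<omega>. if i = ?n then W 0 \<omega> else increment m i \<omega>) \<in> borel_measurable N" for i
      using random_variable_W[of 0] increment_measurable[of m i] by (cases "i = ?n") auto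
  qed
  from measurable_compose[OF this coord_lipschitz_measurable[OF step_path_lipschitz(2)[OF g mesh_pos[of m], of ?n]]]
  have "(\<lambda>\<omega>. g (step_path (W 0 \<omega>) (mesh m) ?n (\<lambda>i. if i = ?n then W 0 \<omega> else increment m i \<omega>))) \<in> borel_measurable N"
    by simp
  moreover have "step_path (W 0 \<omega>) (mesh m) ?n (\<lambda>i. if i = ?n then W 0 \<omega> else increment m i \<omega>) = skeleton m \<omega>" for \<omega>
    unfolding skeleton_def step_path_def by (intro restrict_ext arg_cong2[where f = "(+)"] refl sum.cong) auto
  ultimately show "(\<lambda>\<omega>. g (skeleton m \<omega>)) \<in> borel_measurable N" by simp
qed

lemma path_measurable: "(\<lambda>\<omega>. \<lambda>t\<in>{0..}. W t \<omega>) \<in> N \<rightarrow>\<^sub>M borel_of cadlag_topology"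
  by (rule measurable_cadlag_limit[OF skeleton_measurable path_cadlag skeleton_converges])

text \<open>The starting point can be replaced by 0, and then only the increments enter. Convergence
  follows from the continuity of the Brownian paths by dominated convergence.\<close>

lemma skeleton_expectation_converges:
  assumes h: "path_lipschitz L h" "\<And>x. x \<in> cadlag_paths \<Longrightarrow> \<bar>h x\<bar> \<le> B"
  shows "(\<lambda>m. LINT \<omega>|N. h (step_path 0 (mesh m) (Suc m ^ 3) (\<lambda>i. increment m i \<omega>)))
    \<longlonglongrightarrow> (LINT \<omega>|N. h (\<lambda>t\<in>{0..}. W t \<omega>))"
proof -
  have sc: "skeleton m \<omega> \<in> cadlag_paths" for m \<omega> unfolding skeleton_def by (rule step_path_cadlag[OF mesh_pos])
  have "(\<lambda>m. LINT \<omega>|N. h (skeleton m \<omega>)) \<longlonglongrightarrow> (LINT \<omega>|N. h (\<lambda>t\<in>{0..}. W t \<omega>))"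
  proof (rule integral_dominated_convergence[where w = "\<lambda>_. B"])
    show "AE \<omega> in N. (\<lambda>m. h (skeleton m \<omega>)) \<longlonglongrightarrow> h (\<lambda>t\<in>{0..}. W t \<omega>)"
      using path_lipschitz_limit[OF h(1) sc path_cadlag skeleton_converges] by (intro AE_I2) blast
  qed (use path_lipschitz_measurable[OF h(1)] path_measurable skeleton_measurable sc h(2) in auto)
  moreover have "(LINT \<omega>|N. h (skeleton m \<omega>)) = (LINT \<omega>|N. h (step_path 0 (mesh m) (Suc m ^ 3) (\<lambda>i. increment m i \<omega>)))" for m
  proof (rule integral_cong_AE)
    show "(\<lambda>\<omega>. h (skeleton m \<omega>)) \<in> borel_measurable N"
      by (rule path_lipschitz_measurable[OF h(1) skeleton_measurable])
    have "(\<lambda>\<omega> i. increment m i \<omega>) \<in> N \<rightarrow>\<^sub>M borel"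
      by (rule borel_measurable_sequenceI) (rule increment_measurable)
    from measurable_compose[OF this coord_lipschitz_measurable[OF step_path_lipschitz(1)[OF h(1) mesh_pos]]]
    show "(\<lambda>\<omega>. h (step_path 0 (mesh m) (Suc m ^ 3) (\<lambda>i. increment m i \<omega>))) \<in> borel_measurable N" .
    show "AE \<omega> in N. h (skeleton m \<omega>) = h (step_path 0 (mesh m) (Suc m ^ 3) (\<lambda>i. increment m i \<omega>))"
      using start by eventually_elim (simp add: skeleton_def)
  qed
  ultimately show ?thesis by simp
qed

lemma gaussian_skeleton: "gaussian_increments N (increment m) n (sqrt (mesh m))"
proof
  have "indep_vars (\<lambda>_. borel) (\<lambda>i \<omega>. W (real (Suc i) * mesh m) \<omega> - W (real i * mesh m) \<omega>) {..<n}"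
    using mesh_pos[of m] by (intro independent_increments[of "\<lambda>i. real i * mesh m"]) auto
  then show "indep_vars (\<lambda>_. borel) (increment m) {..<n}" by (simp add: increment_def[abs_def])
  show "0 < sqrt (mesh m)" using mesh_pos by simp
  show "increment m i \<in> borel_measurable N" for i by (rule increment_measurable)
  fix i
  have "real (Suc i) * mesh m - real i * mesh m = mesh m" by (simp add: algebra_simps)
  then show "distributed N lborel (increment m i) (normal_density 0 (sqrt (mesh m)))"
    using normal_increments[of "real i * mesh m" "real (Suc i) * mesh m"] mesh_pos[of m]
    by (simp add: increment_def[abs_def])
qed

end

section \<open>The functional central limit theorem\<close>

context time_changed_martingale begin

text \<open>Unless the martingale oscillates by \<open>2 e\<close> in one of the cells, the path stays within \<open>3 e\<close> of
  the step function through its values on the grid: \<open>2 e\<close> for the oscillation and \<open>e\<close> for the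
  distance of \<open>X\<close> to the rescaled martingale.\<close>

lemma skeleton_approximation:
  fixes h :: "(real \<Rightarrow> real) \<Rightarrow> real" and n :: nat
  assumes h: "path_lipschitz L h" "\<And>x. x \<in> cadlag_paths \<Longrightarrow> \<bar>h x\<bar> \<le> B"
    and d: "0 < \<delta>" and \<kappa>: "0 < \<kappa>" and X: "X \<in> M \<rightarrow>\<^sub>M borel_of cadlag_topology"
    and close: "\<And>\<omega> t. \<omega> \<in> space M \<Longrightarrow> 0 \<le> t \<Longrightarrow> \<bar>X \<omega> t - S (\<tau> (\<kappa> * t)) \<omega> / sqrt \<kappa>\<bar> \<le> e"
    and long: "1 / (1 + real n * \<delta>) \<le> 3 * e" and e: "0 < e"
  shows "\<bar>expectation (\<lambda>\<omega>. h (X \<omega>)) - expectation (\<lambda>\<omega>. h (step_path 0 \<delta> n (\<lambda>i. incr \<kappa> (real i * \<delta>) (real (Suc i) * \<delta>) \<omega>)))\<bar>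
    \<le> L * (3 * e) + 2 * B * (\<Sum>i<n. prob {\<omega> \<in> space M. \<exists>l\<in>{\<tau> (\<kappa> * (real i * \<delta>))..\<tau> (\<kappa> * (real (Suc i) * \<delta>))}.
        \<bar>S l \<omega> - S (\<tau> (\<kappa> * (real i * \<delta>))) \<omega>\<bar> \<ge> 2 * (e * sqrt \<kappa>)})"
proof -
  define P where "P \<omega> = step_path 0 \<delta> n (\<lambda>i. incr \<kappa> (real i * \<delta>) (real (Suc i) * \<delta>) \<omega>)" for \<omega>
  define bad where "bad i = {\<omega> \<in> space M. \<exists>l\<in>{\<tau> (\<kappa> * (real i * \<delta>))..\<tau> (\<kappa> * (real (Suc i) * \<delta>))}.
        \<bar>S l \<omega> - S (\<tau> (\<kappa> * (real i * \<delta>))) \<omega>\<bar> \<ge> 2 * (e * sqrt \<kappa>)}" for i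
  have bad [measurable]: "bad i \<in> events" for i unfolding bad_def by measurable
  have PC: "P \<omega> \<in> cadlag_paths" for \<omega> unfolding P_def by (rule step_path_cadlag[OF d])
  have XC: "X \<omega> \<in> cadlag_paths" if "\<omega> \<in> space M" for \<omega> by (rule cadlag_random_element_in_paths[OF X that])
  have hX [measurable]: "(\<lambda>\<omega>. h (X \<omega>)) \<in> borel_measurable M" by (rule path_lipschitz_measurable[OF h(1) X])
  have "(\<lambda>\<omega> i. incr \<kappa> (real i * \<delta>) (real (Suc i) * \<delta>) \<omega>) \<in> M \<rightarrow>\<^sub>M borel"
    by (rule borel_measurable_sequenceI) measurable
  from measurable_compose[OF this coord_lipschitz_measurable[OF step_path_lipschitz(1)[OF h(1) d]]]
  have hP [measurable]: "(\<lambda>\<omega>. h (P \<omega>)) \<in> borel_measurable M" unfolding P_def .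
  have iX: "integrable M (\<lambda>\<omega>. h (X \<omega>))" by (rule integrable_boundedI[where B = B]) (use h(2) XC in auto)
  have iP: "integrable M (\<lambda>\<omega>. h (P \<omega>))" by (rule integrable_boundedI[where B = B]) (use h(2) PC in auto)
  have ib: "integrable M (\<lambda>\<omega>. indicator (bad i) \<omega> :: real)" for i
    by (rule integrable_boundedI[where B = 1]) (auto simp: indicator_def)
  have L: "0 < L" using h(1) by (simp add: path_lipschitz_def)
  have B: "0 \<le> B" using h(2)[OF PC] abs_ge_zero order_trans by blast
  have pw: "\<bar>h (X \<omega>) - h (P \<omega>)\<bar> \<le> L * (3 * e) + 2 * B * (\<Sum>i<n. indicator (bad i) \<omega>)" if w: "\<omega> \<in> space M" for \<omega>
  proof (cases "\<exists>i<n. \<omega> \<in> bad i")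
    case True
    then obtain i where i: "i < n" "\<omega> \<in> bad i" by blast
    have "1 \<le> (\<Sum>i<n. indicator (bad i) \<omega> :: real)"
      using member_le_sum[of i "{..<n}" "\<lambda>i. indicator (bad i) \<omega> :: real"] i by simp
    then have "2 * B * 1 \<le> 2 * B * (\<Sum>i<n. indicator (bad i) \<omega>)" using B by (intro mult_left_mono) auto
    moreover have "\<bar>h (X \<omega>) - h (P \<omega>)\<bar> \<le> 2 * B" using h(2)[OF XC[OF w]] h(2)[OF PC[of \<omega>]] by linarith
    moreover have "0 \<le> L * (3 * e)" using L e by simp
    ultimately show ?thesis by linarith
  next
    case False
    have "path_dist (X \<omega>) (P \<omega>) \<le> 3 * e"
    proof (rule path_dist_le_uniform[OF _ long])
      show "0 \<le> real n * \<delta>" using d by simp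
      fix t assume t: "0 \<le> t" "t < real n * \<delta>"
      define i where "i = nat \<lfloor>t / \<delta>\<rfloor>"
      have i0: "0 \<le> t / \<delta>" "t / \<delta> < real n" using t d by (auto simp: pos_divide_less_eq)
      then have ilt: "i < n" by (simp add: i_def nat_less_iff floor_less_iff)
      have ri: "real i = of_int \<lfloor>t / \<delta>\<rfloor>" using i0 by (simp add: i_def)
      have "real i \<le> t / \<delta>" "t / \<delta> < real (Suc i)" unfolding of_nat_Suc ri by linarith+
      then have it: "real i * \<delta> \<le> t" "t \<le> real (Suc i) * \<delta>"
        using d by (auto simp: pos_le_divide_eq pos_divide_less_eq)
      have "P \<omega> t = (\<Sum>j<i. incr \<kappa> (real j * \<delta>) (real (Suc j) * \<delta>) \<omega>)"
        using t ilt by (simp add: P_def step_path_def i_def[symmetric] min_def)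
      also have "\<dots> = (\<Sum>j<i. S (\<tau> (\<kappa> * (real (Suc j) * \<delta>))) \<omega> / sqrt \<kappa> - S (\<tau> (\<kappa> * (real j * \<delta>))) \<omega> / sqrt \<kappa>)"
        by (simp add: incr_def diff_divide_distrib)
      also have "\<dots> = S (\<tau> (\<kappa> * (real i * \<delta>))) \<omega> / sqrt \<kappa>"
        by (subst sum_lessThan_telescope) (simp add: tau_0 S_def)
      finally have Pt: "P \<omega> t = S (\<tau> (\<kappa> * (real i * \<delta>))) \<omega> / sqrt \<kappa>" .
      have "\<tau> (\<kappa> * t) \<in> {\<tau> (\<kappa> * (real i * \<delta>))..\<tau> (\<kappa> * (real (Suc i) * \<delta>))}"
        using it t \<kappa> d by (auto intro!: tau_mono mult_left_mono)
      then have "\<bar>S (\<tau> (\<kappa> * t)) \<omega> - S (\<tau> (\<kappa> * (real i * \<delta>))) \<omega>\<bar> < 2 * (e * sqrt \<kappa>)"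
        using False ilt w unfolding bad_def by (metis (mono_tags, lifting) mem_Collect_eq not_le)
      then have "\<bar>S (\<tau> (\<kappa> * t)) \<omega> - S (\<tau> (\<kappa> * (real i * \<delta>))) \<omega>\<bar> / sqrt \<kappa> \<le> 2 * e"
        using \<kappa> by (simp add: pos_divide_le_eq)
      then have "\<bar>S (\<tau> (\<kappa> * t)) \<omega> / sqrt \<kappa> - P \<omega> t\<bar> \<le> 2 * e"
        using \<kappa> unfolding Pt by (simp add: diff_divide_distrib[symmetric] abs_divide)
      then show "\<bar>X \<omega> t - P \<omega> t\<bar> \<le> 3 * e" using close[OF w t(1)] by linarith
    qed
    then have "L * path_dist (X \<omega>) (P \<omega>) \<le> L * (3 * e)" using L by (intro mult_left_mono) auto
    moreover have "\<bar>h (X \<omega>) - h (P \<omega>)\<bar> \<le> L * path_dist (X \<omega>) (P \<omega>)"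
      using h(1) XC[OF w] PC by (simp add: path_lipschitz_def)
    moreover have "0 \<le> 2 * B * (\<Sum>i<n. indicator (bad i) \<omega>)" using B by (intro mult_nonneg_nonneg sum_nonneg) auto
    ultimately show ?thesis by linarith
  qed
  have "\<bar>expectation (\<lambda>\<omega>. h (X \<omega>)) - expectation (\<lambda>\<omega>. h (P \<omega>))\<bar> = \<bar>expectation (\<lambda>\<omega>. h (X \<omega>) - h (P \<omega>))\<bar>"
    using iX iP by simp
  also have "\<dots> \<le> expectation (\<lambda>\<omega>. L * (3 * e) + 2 * B * (\<Sum>i<n. indicator (bad i) \<omega>))"
    using iX iP ib pw by (intro abs_expectation_le) auto
  also have "\<dots> = L * (3 * e) + 2 * B * (\<Sum>i<n. prob (bad i))"
    using ib by (simp add: prob_space)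
  finally show ?thesis by (simp add: P_def bad_def)
qed

text \<open>The grid is chosen first, fine and long enough for Brownian motion to be close to its
  skeleton and for the oscillation bounds to add up to little; only then does \<open>\<kappa>\<close> tend to
  infinity.\<close>

theorem functional_clt:
  fixes N :: "'b measure" and X :: "real \<Rightarrow> 'a \<Rightarrow> real \<Rightarrow> real"
  assumes W: "standard_brownian_motion N W"
    and X: "\<And>\<kappa>. 0 < \<kappa> \<Longrightarrow> X \<kappa> \<in> M \<rightarrow>\<^sub>M borel_of cadlag_topology"
    and close: "\<And>\<kappa> \<omega> t. 0 < \<kappa> \<Longrightarrow> \<omega> \<in> space M \<Longrightarrow> 0 \<le> t \<Longrightarrow> \<bar>X \<kappa> \<omega> t - S (\<tau> (\<kappa> * t)) \<omega> / sqrt \<kappa>\<bar> \<le> C / sqrt \<kappa>"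
  shows "converges_in_distribution cadlag_topology at_top M X N (\<lambda>\<omega>. \<lambda>t\<in>{0..}. W t \<omega>)"
proof -
  interpret W: standard_brownian_motion N W by fact
  show ?thesis
  proof (rule converges_in_distribution_lipschitzI)
    show "prob_space M" "prob_space N" by unfold_locales
    show "\<forall>\<^sub>F \<kappa> in at_top. X \<kappa> \<in> M \<rightarrow>\<^sub>M borel_of cadlag_topology"
      using eventually_gt_at_top[of 0] by eventually_elim (rule X)
    show "(\<lambda>\<omega>. \<lambda>t\<in>{0..}. W t \<omega>) \<in> N \<rightarrow>\<^sub>M borel_of cadlag_topology" by (rule W.path_measurable)
    fix L B h assume h: "path_lipschitz L h" "\<And>x. x \<in> cadlag_paths \<Longrightarrow> \<bar>h x\<bar> \<le> B"
    show "((\<lambda>\<kappa>. LINT \<omega>|M. h (X \<kappa> \<omega>)) \<longlongrightarrow> (LINT \<omega>|N. h (\<lambda>t\<in>{0..}. W t \<omega>))) at_top"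
    proof (rule tendstoI)
      fix \<eta> :: real assume eta: "0 < \<eta>"
      have L: "0 < L" using h(1) by (simp add: path_lipschitz_def)
      have B: "0 \<le> B" using h(2)[OF step_path_cadlag[of 1 0 0 undefined]] by force
      \<comment> \<open>Each of the four error terms gets a quarter of \<open>\<eta>\<close>: path versus skeleton (discretization and oscillation), skeleton versus Gaussian skeleton, Gaussian skeleton versus Brownian motion.\<close>
      define e where "e = \<eta> / (12 * L)"
      have e: "0 < e" "L * (3 * e) = \<eta> / 4" using eta L by (auto simp: e_def)
      have "(\<lambda>m. 1 / (2 + real m)) \<longlonglongrightarrow> 0" "(\<lambda>m. 6 * B / e^4 / real (Suc m)) \<longlonglongrightarrow> 0"
        by real_asymp+
      from order_tendstoD(2)[OF this(1), of "3 * e"] order_tendstoD(2)[OF this(2), of "\<eta> / 8"] e(1) eta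
      have "\<forall>\<^sub>F m in sequentially. 1 / (2 + real m) < 3 * e" "\<forall>\<^sub>F m in sequentially. 6 * B / e^4 / real (Suc m) < \<eta> / 8"
        by (simp_all only: mult_pos_pos zero_less_numeral zero_less_divide_iff simp_thms)
      moreover have "\<forall>\<^sub>F m in sequentially. \<bar>(LINT \<omega>|N. h (step_path 0 (W.mesh m) (Suc m ^ 3) (\<lambda>i. W.increment m i \<omega>)))
          - (LINT \<omega>|N. h (\<lambda>t\<in>{0..}. W t \<omega>))\<bar> < \<eta> / 4"
        using tendstoD[OF W.skeleton_expectation_converges[OF h], of "\<eta> / 4"] eta by (simp add: dist_real_def)
      ultimately have "\<forall>\<^sub>F m in sequentially. 1 / (2 + real m) < 3 * e \<and> 6 * B / e^4 / real (Suc m) < \<eta> / 8 \<and>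
        \<bar>(LINT \<omega>|N. h (step_path 0 (W.mesh m) (Suc m ^ 3) (\<lambda>i. W.increment m i \<omega>)))
          - (LINT \<omega>|N. h (\<lambda>t\<in>{0..}. W t \<omega>))\<bar> < \<eta> / 4" by eventually_elim simp
      then obtain m where m: "1 / (2 + real m) < 3 * e" "6 * B / e^4 / real (Suc m) < \<eta> / 8"
        "\<bar>(LINT \<omega>|N. h (step_path 0 (W.mesh m) (Suc m ^ 3) (\<lambda>i. W.increment m i \<omega>)))
          - (LINT \<omega>|N. h (\<lambda>t\<in>{0..}. W t \<omega>))\<bar> < \<eta> / 4"
        using eventually_happens trivial_limit_sequentially by blast
      define n where "n = Suc m ^ 3"
      define \<delta> where "\<delta> = W.mesh m"
      have d: "0 < \<delta>" by (simp add: \<delta>_def W.mesh_pos)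
      have n: "0 < n" by (simp add: n_def)
      define \<eta>' where "\<eta>' = \<eta> / (16 * (B + 1) * real n)"
      have eta': "0 < \<eta>'" using eta B n by (simp add: \<eta>'_def)
      define bad where "bad \<kappa> i = {\<omega> \<in> space M. \<exists>l\<in>{\<tau> (\<kappa> * (real i * \<delta>))..\<tau> (\<kappa> * (real (Suc i) * \<delta>))}.
        \<bar>S l \<omega> - S (\<tau> (\<kappa> * (real i * \<delta>))) \<omega>\<bar> \<ge> 2 * (e * sqrt \<kappa>)}" for \<kappa> i
      have "\<forall>\<^sub>F \<kappa> in at_top. prob (bad \<kappa> i) < 3 * \<delta>\<^sup>2 / e^4 + \<eta>'" for i
      proof -
        have "real (Suc i) * \<delta> - real i * \<delta> = \<delta>" by (simp add: algebra_simps)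
        then show ?thesis
          using oscillation_bound[of "real i * \<delta>" "real (Suc i) * \<delta>" e \<eta>'] d e(1) eta' unfolding bad_def by simp
      qed
      then have ev1: "\<forall>\<^sub>F \<kappa> in at_top. \<forall>i\<in>{..<n}. prob (bad \<kappa> i) < 3 * \<delta>\<^sup>2 / e^4 + \<eta>'"
        by (simp add: eventually_ball_finite)
      have "((\<lambda>\<kappa>. expectation (\<lambda>\<omega>. h (step_path 0 \<delta> n (\<lambda>i. incr \<kappa> (real i * \<delta>) (real (Suc i) * \<delta>) \<omega>))))
          \<longlongrightarrow> (LINT \<omega>|N. h (step_path 0 \<delta> n (\<lambda>i. W.increment m i \<omega>)))) at_top"
        by (rule finite_dimensional_convergence[OF d W.gaussian_skeleton[of m n, folded \<delta>_def] step_path_lipschitz(1)[OF h(1) d] h(2)[OF step_path_cadlag[OF d]]])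
      from tendstoD[OF this, of "\<eta> / 4"] eta
      have ev2: "\<forall>\<^sub>F \<kappa> in at_top. \<bar>expectation (\<lambda>\<omega>. h (step_path 0 \<delta> n (\<lambda>i. incr \<kappa> (real i * \<delta>) (real (Suc i) * \<delta>) \<omega>)))
          - (LINT \<omega>|N. h (step_path 0 \<delta> n (\<lambda>i. W.increment m i \<omega>)))\<bar> < \<eta> / 4"
        by (simp add: dist_real_def)
      have "((\<lambda>\<kappa>. C / sqrt \<kappa>) \<longlongrightarrow> 0) at_top" by real_asymp
      then have ev3: "\<forall>\<^sub>F \<kappa> in at_top. C / sqrt \<kappa> < e" using e(1) by (rule order_tendstoD)
      from ev1 ev2 ev3 eventually_gt_at_top[of 0]
      show "\<forall>\<^sub>F \<kappa> in at_top. dist (LINT \<omega>|M. h (X \<kappa> \<omega>)) (LINT \<omega>|N. h (\<lambda>t\<in>{0..}. W t \<omega>)) < \<eta>"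
      proof eventually_elim
        case (elim \<kappa>)
        have "real n * \<delta> = real (Suc m)" unfolding n_def \<delta>_def by (rule W.mesh_length)
        then have long: "1 / (1 + real n * \<delta>) \<le> 3 * e" using m(1) by simp
        have "\<bar>X \<kappa> \<omega> t - S (\<tau> (\<kappa> * t)) \<omega> / sqrt \<kappa>\<bar> \<le> e" if "\<omega> \<in> space M" "0 \<le> t" for \<omega> t
          using close[OF elim(4) that] elim(3) by linarith
        from skeleton_approximation[OF h d elim(4) X[OF elim(4)] this long e(1)]
        have 1: "\<bar>expectation (\<lambda>\<omega>. h (X \<kappa> \<omega>)) - expectation (\<lambda>\<omega>. h (step_path 0 \<delta> n (\<lambda>i. incr \<kappa> (real i * \<delta>) (real (Suc i) * \<delta>) \<omega>)))\<bar>
          \<le> \<eta> / 4 + 2 * B * (\<Sum>i<n. prob (bad \<kappa> i))" unfolding bad_def e(2) .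
        have "(\<Sum>i<n. prob (bad \<kappa> i)) \<le> (\<Sum>i<n. 3 * \<delta>\<^sup>2 / e^4 + \<eta>')"
          using elim(1) by (intro sum_mono less_imp_le) auto
        then have "2 * B * (\<Sum>i<n. prob (bad \<kappa> i)) \<le> 2 * B * (real n * (3 * \<delta>\<^sup>2 / e^4 + \<eta>'))"
          using B by (intro mult_left_mono) auto
        also have "\<dots> = 6 * B / e^4 * (real n * \<delta>\<^sup>2) + 2 * B * real n * \<eta>'" by (simp add: algebra_simps)
        also have "real n * \<delta>\<^sup>2 = 1 / real (Suc m)"
        proof -
          have "real n * \<delta>\<^sup>2 = (real n * \<delta>) * \<delta>" by (simp add: power2_eq_square)
          also have "\<dots> = real (Suc m) * (1 / (real (Suc m))\<^sup>2)"
            unfolding \<open>real n * \<delta> = real (Suc m)\<close> by (simp add: \<delta>_def W.mesh_def)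
          finally show ?thesis by (simp add: power2_eq_square)
        qed
        also have "2 * B * real n * \<eta>' \<le> \<eta> / 8"
        proof -
          have "2 * B * real n * \<eta>' = \<eta> / 8 * (B / (B + 1))" 
          proof -
            have "2 * B * k * (\<eta> / (16 * x * k)) = \<eta> / 8 * (B / x)" if "k \<noteq> 0" "x \<noteq> 0" for k x :: real
              using that by (simp add: field_simps)
            from this[of "real n" "B + 1"] show ?thesis using n B by (simp add: \<eta>'_def)
          qed
          also have "\<dots> \<le> \<eta> / 8 * 1" using eta B by (intro mult_left_mono) auto
          finally show ?thesis by simp
        qed
        finally have "2 * B * (\<Sum>i<n. prob (bad \<kappa> i)) < \<eta> / 4" using m(2) by simp
        then show ?case using 1 elim(2) m(3) unfolding dist_real_def n_def[symmetric] \<delta>_def[symmetric] by linarith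
      qed
    qed
  qed
qed

end



section \<open>The artificial scales\<close>

lemma step_integral:
  fixes G :: "nat \<Rightarrow> real"
  shows "((\<lambda>v. G (nat \<lfloor>v\<rfloor>)) has_integral G j) {real j..real (Suc j)}"
proof (rule has_integral_spike[where S = "{real (Suc j)}" and f = "\<lambda>_. G j"])
  fix x assume "x \<in> {real j..real (Suc j)} - {real (Suc j)}"
  then have "\<lfloor>x\<rfloor> = int j" by (intro floor_unique) auto
  then show "G (nat \<lfloor>x\<rfloor>) = G j" by simp
qed (use has_integral_const_real[of "G j" "real j" "real (Suc j)"] in auto)

text \<open>A monotone map with open range is continuous; extending \<open>F\<close> by the identity to the left of 0
  makes the range open.\<close>

lemma bij_mono_continuous:
  fixes F :: "real \<Rightarrow> real"
  assumes "bij_betw F {0..} {0..}" and mono: "\<And>x y. 0 \<le> x \<Longrightarrow> x \<le> y \<Longrightarrow> F x \<le> F y"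
  shows "continuous_on {0..} F"
proof -
  define E where "E x = (if 0 \<le> x then F x else x)" for x
  have im: "F ` {0..} = {0..}" using assms(1) by (simp add: bij_betw_def)
  have F0: "0 \<le> F x" if "0 \<le> x" for x using im that by auto
  have "y \<in> range E" for y
  proof (cases "0 \<le> y")
    case True
    then obtain x where "0 \<le> x" "y = F x" using im by (metis atLeast_iff imageE)
    then show ?thesis by (intro image_eqI[of _ _ x]) (auto simp: E_def)
  next
    case False then show ?thesis by (intro image_eqI[of _ _ y]) (auto simp: E_def)
  qed
  then have "range E = UNIV" by blast
  moreover have "E x \<le> E y" if "x \<le> y" for x y
    using mono[of x y] F0[of y] that by (auto simp: E_def)
  ultimately have "continuous_on UNIV E" by (intro continuous_onI_mono) auto
  then have "continuous_on {0..} E" by (rule continuous_on_subset) simp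
  then show ?thesis by (rule continuous_on_eq) (simp add: E_def)
qed

text \<open>The common part of \<open>\<Phi>\<close> and of the integral in \<open>\<phi>\<close>: integrals of step functions with positive
  decreasing steps \<open>G k\<close>, for \<open>G k = 1 / f k\<close> and \<open>G k = 1 / (f k)\<^sup>2\<close>.\<close>

locale decreasing_weight =
  fixes G :: "nat \<Rightarrow> real"
  assumes pos: "\<And>k. 0 < G k" and antimono: "\<And>j k. j \<le> k \<Longrightarrow> G k \<le> G j"
begin

definition g :: "real \<Rightarrow> real" where "g v = G (nat \<lfloor>v\<rfloor>)"

definition P :: "real \<Rightarrow> real" where "P u = integral {0..u} g"

lemma g_antimono: "u \<le> v \<Longrightarrow> g v \<le> g u"
  unfolding g_def by (intro antimono nat_mono floor_mono)

lemma g_pos: "0 < g v" by (simp add: g_def pos)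

lemma integrable_g: "g integrable_on {a..b}"
proof -
  have "mono_on {a..b} (\<lambda>v. - g v)" by (auto simp: mono_on_def g_antimono)
  then have "(\<lambda>v. - g v) integrable_on {a..b}" by (rule integrable_on_mono_on)
  from integrable_neg[OF this] show ?thesis by simp
qed

lemma P_diff: "0 \<le> a \<Longrightarrow> a \<le> b \<Longrightarrow> P b - P a = integral {a..b} g"
  unfolding P_def using Henstock_Kurzweil_Integration.integral_combine[of 0 a b g] integrable_g by (simp add: algebra_simps)

lemma P_lower: "0 \<le> a \<Longrightarrow> a \<le> b \<Longrightarrow> g b * (b - a) \<le> P b - P a"
proof -
  assume ab: "0 \<le> a" "a \<le> b"
  have "integral {a..b} (\<lambda>_. g b) \<le> integral {a..b} g"
    by (rule integral_le) (auto intro: integrable_g g_antimono)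
  then show ?thesis using ab by (simp add: P_diff mult.commute)
qed

lemma P_strict_mono: "0 \<le> a \<Longrightarrow> a < b \<Longrightarrow> P a < P b"
  using P_lower[of a b] mult_pos_pos[OF g_pos[of b], of "b - a"] by simp

lemma P_mono: "0 \<le> a \<Longrightarrow> a \<le> b \<Longrightarrow> P a \<le> P b"
  using P_strict_mono[of a b] by (cases "a = b") auto

lemma P_0 [simp]: "P 0 = 0" by (simp add: P_def)

lemma P_nat: "P (real n) = (\<Sum>k<n. G k)"
proof (induction n)
  case (Suc n)
  have "P (real (Suc n)) - P (real n) = integral {real n..real (Suc n)} g" by (rule P_diff) auto
  also have "\<dots> = G n" unfolding g_def by (rule integral_unique[OF step_integral])
  finally show ?case using Suc by simp
qed simp

lemma P_bij: assumes "\<not> summable G" shows "bij_betw P {0..} {0..}"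
  unfolding bij_betw_def
proof
  show "inj_on P {0..}"
    by (rule linorder_inj_onI') (use P_strict_mono in force)
  show "P ` {0..} = {0..}"
  proof (intro set_eqI iffI)
    fix y assume "y \<in> P ` {0..}"
    then show "y \<in> {0..}" using P_mono[of 0] by auto
  next
    fix y :: real assume "y \<in> {0..}"
    then have y: "0 \<le> y" by simp
    have "\<exists>n. y \<le> P (real n)"
    proof (rule ccontr)
      assume "\<not> (\<exists>n. y \<le> P (real n))"
      then have "(\<Sum>k<n. G k) \<le> y" for n unfolding P_nat by (meson less_imp_le not_le)
      then have "summable G" by (intro bounded_imp_summable[where B = y]) (auto simp: pos less_imp_le lessThan_Suc_atMost[symmetric] simp del: sum.lessThan_Suc)
      then show False using assms by simp
    qed
    then obtain n where n: "y \<le> P (real n)" by blast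
    have "continuous_on {0..real n} P"
      unfolding P_def[abs_def] by (rule indefinite_integral_continuous_1[OF integrable_g])
    then obtain x where "0 \<le> x" "P x = y"
      using IVT'[of P 0 y "real n"] y n by auto
    then show "y \<in> P ` {0..}" by auto
  qed
qed

end

locale weak_preference_rule =
  fixes f :: "nat \<Rightarrow> real"
  assumes attachment: "attachment_rule f" and weak: "\<not> summable (\<lambda>k. 1 / (f k)\<^sup>2)"
begin

lemma f_pos: "0 < f n" and f_mono: "m \<le> n \<Longrightarrow> f m \<le> f n" and f_le: "f n \<le> real n + 1"
  using attachment by (auto simp: attachment_rule_def mono_def)

definition C :: real where "C = 1 / f 0"

lemma C_pos: "0 < C" by (simp add: C_def f_pos)

lemma inverse_f_le: "1 / f n \<le> C"
  unfolding C_def using f_pos f_mono[of 0 n] by (intro divide_left_mono) auto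

sublocale P1: decreasing_weight "\<lambda>k. 1 / f k"
  using f_pos f_mono by unfold_locales (auto intro: divide_left_mono)

sublocale P2: decreasing_weight "\<lambda>k. 1 / (f k)\<^sup>2"
proof
  show "0 < 1 / (f k)\<^sup>2" for k using f_pos[of k] by simp
  show "1 / (f k)\<^sup>2 \<le> 1 / (f j)\<^sup>2" if "j \<le> k" for j k
    using f_mono[OF that] f_pos[of j] f_pos[of k] by (intro divide_left_mono power_mono) auto
qed

lemma Phi_eq: "Phi f = P1.P"
  by (simp add: fun_eq_iff Phi_def P1.P_def P1.g_def[abs_def] extend_def)

lemma phi_eq: "phi f t = P2.P (the_inv_into {0..} P1.P t)"
  by (simp add: phi_def Phi_eq P2.P_def P2.g_def[abs_def] extend_def)

text \<open>As \<open>1 / (f k)\<^sup>2\<close> is at most a multiple of \<open>1 / f k\<close>, weak preference also makes \<open>\<Phi>\<close> unbounded.\<close>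

lemma P1_bij: "bij_betw P1.P {0..} {0..}"
proof (rule P1.P_bij)
  show "\<not> summable (\<lambda>k. 1 / f k)"
  proof
    assume "summable (\<lambda>k. 1 / f k)"
    then have s: "summable (\<lambda>k. C * (1 / f k))" by (rule summable_mult)
    have "summable (\<lambda>k. 1 / (f k)\<^sup>2)"
    proof (rule summable_comparison_test'[OF s, of 0])
      fix k
      have "1 / f k * (1 / f k) \<le> C * (1 / f k)" using f_pos[of k] by (intro mult_right_mono inverse_f_le) auto
      then show "norm (1 / (f k)\<^sup>2) \<le> C * (1 / f k)" by (simp add: power2_eq_square)
    qed
    then show False using weak by simp
  qed
qed

lemma P2_bij: "bij_betw P2.P {0..} {0..}"
  by (rule P2.P_bij[OF weak])

lemma Phi_inverse:
  assumes "0 \<le> t" shows "0 \<le> the_inv_into {0..} P1.P t" "P1.P (the_inv_into {0..} P1.P t) = t"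
proof -
  show "0 \<le> the_inv_into {0..} P1.P t"
    using bij_betw_the_inv_into[OF P1_bij] assms by (auto simp: bij_betw_def)
  show "P1.P (the_inv_into {0..} P1.P t) = t"
    using f_the_inv_into_f_bij_betw[OF P1_bij] assms by auto
qed

lemma phi_Phi: "0 \<le> u \<Longrightarrow> phi f (Phi f u) = P2.P u"
  unfolding phi_eq Phi_eq using the_inv_into_f_f[of P1.P "{0..}" u] P1_bij by (simp add: bij_betw_def)

lemma P2_le_P1: "0 \<le> a \<Longrightarrow> a \<le> b \<Longrightarrow> P2.P b - P2.P a \<le> C * (P1.P b - P1.P a)"
proof -
  assume ab: "0 \<le> a" "a \<le> b"
  have "integral {a..b} P2.g \<le> integral {a..b} (\<lambda>v. C * P1.g v)"
  proof (rule integral_le)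
    show "(\<lambda>v. C * P1.g v) integrable_on {a..b}" using P1.integrable_g by (intro integrable_on_mult_right) auto
    fix v :: real
    let ?k = "nat \<lfloor>v\<rfloor>"
    have "1 / f ?k * (1 / f ?k) \<le> C * (1 / f ?k)" using f_pos[of ?k] by (intro mult_right_mono inverse_f_le) auto
    then show "P2.g v \<le> C * P1.g v" unfolding P2.g_def P1.g_def by (simp add: power2_eq_square)
  qed (rule P2.integrable_g)
  also have "\<dots> = C * integral {a..b} P1.g" by simp
  finally show ?thesis using ab by (simp add: P1.P_diff P2.P_diff)
qed

text \<open>In the variable \<open>\<Phi>\<close> the derivative of \<open>\<phi>\<close> is \<open>(1 / f\<^sup>2) / (1 / f) = 1 / f\<close>, at most \<open>C\<close>.\<close>

lemma phi_lipschitz: "0 \<le> s \<Longrightarrow> 0 \<le> t \<Longrightarrow> \<bar>phi f s - phi f t\<bar> \<le> C * \<bar>s - t\<bar>"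
proof (induction s t rule: linorder_wlog)
  case (le s t)
  let ?a = "the_inv_into {0..} P1.P s" and ?b = "the_inv_into {0..} P1.P t"
  note a = Phi_inverse[OF le(2)] and b = Phi_inverse[OF le(3)]
  have ab: "?a \<le> ?b"
  proof (rule ccontr)
    assume "\<not> ?a \<le> ?b"
    then have "P1.P ?b < P1.P ?a" by (intro P1.P_strict_mono[OF b(1)]) simp
    then show False using a(2) b(2) le(1) by simp
  qed
  have "phi f t - phi f s \<le> C * (t - s)" unfolding phi_eq using P2_le_P1[OF a(1) ab] a(2) b(2) by simp
  moreover have "phi f s \<le> phi f t" unfolding phi_eq by (rule P2.P_mono[OF a(1) ab])
  ultimately show ?case using le(1) by simp
next
  case (sym s t) then show ?case by (simp add: abs_minus_commute)
qed

lemma phi_bij: "bij_betw (phi f) {0..} {0..}"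
  using bij_betw_trans[OF bij_betw_the_inv_into[OF P1_bij] P2_bij]
  by (rule bij_betw_cong[THEN iffD1, rotated]) (simp add: phi_eq)

lemma phi_strict_mono: "0 \<le> s \<Longrightarrow> s < t \<Longrightarrow> phi f s < phi f t"
proof -
  assume st: "0 \<le> s" "s < t"
  let ?a = "the_inv_into {0..} P1.P s" and ?b = "the_inv_into {0..} P1.P t"
  have "0 \<le> t" using st by simp
  note a = Phi_inverse[OF st(1)] and b = Phi_inverse[OF this]
  have "?a < ?b"
  proof (rule ccontr)
    assume "\<not> ?a < ?b"
    then have "P1.P ?b \<le> P1.P ?a" by (intro P1.P_mono[OF b(1)]) simp
    then show False using a(2) b(2) st(2) by simp
  qed
  then show ?thesis unfolding phi_eq using a(1) by (intro P2.P_strict_mono)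
qed

lemma phi_star_bij: "bij_betw (phi_star f) {0..} {0..}"
  unfolding phi_star_def by (rule bij_betw_the_inv_into[OF phi_bij])

lemma phi_star_nonneg: "0 \<le> r \<Longrightarrow> 0 \<le> phi_star f r"
  using phi_star_bij by (auto simp: bij_betw_def)

lemma phi_phi_star: "0 \<le> r \<Longrightarrow> phi f (phi_star f r) = r"
  unfolding phi_star_def using f_the_inv_into_f_bij_betw[OF phi_bij] by auto

lemma phi_star_strict_mono:
  assumes "0 \<le> r" "r < r'"
  shows "phi_star f r < phi_star f r'"
proof (rule ccontr)
  have r': "0 \<le> r'" using assms by simp
  assume "\<not> phi_star f r < phi_star f r'"
  then consider "phi_star f r' < phi_star f r" | "phi_star f r' = phi_star f r" by linarith
  then have "phi f (phi_star f r') \<le> phi f (phi_star f r)"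
    using phi_strict_mono[OF phi_star_nonneg[OF r']] by cases (auto intro: less_imp_le)
  then show False using assms by (simp add: phi_phi_star[OF r'] phi_phi_star[OF assms(1)])
qed

lemma phi_star_mono: "0 \<le> r \<Longrightarrow> r \<le> r' \<Longrightarrow> phi_star f r \<le> phi_star f r'"
  using phi_star_strict_mono[of r r'] by (cases "r = r'") auto

lemma phi_star_continuous: "continuous_on {0..} (phi_star f)"
  by (rule bij_mono_continuous[OF phi_star_bij phi_star_mono])

lemma phi_0: "phi f 0 = 0"
  using phi_Phi[of 0] by (simp add: Phi_eq)

lemma phi_star_0: "phi_star f 0 = 0"
  using phi_phi_star[of 0] phi_strict_mono[of 0 "phi_star f 0"] phi_star_nonneg[of 0] phi_0
  by (cases "phi_star f 0 = 0") auto

end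

lemma Psi_Suc: "1 \<le> n \<Longrightarrow> Psi (Suc n) = Psi n + 1 / real n"
  by (simp add: Psi_def)

lemma Psi_1 [simp]: "Psi (Suc 0) = 0" by (simp add: Psi_def)

lemma Psi_strict_mono: assumes "1 \<le> m" "m < n" shows "Psi m < Psi n"
proof -
  have "{1..<n} = {1..<m} \<union> {m..<n}" using assms by auto
  then have "Psi n = Psi m + (\<Sum>k\<in>{m..<n}. 1 / real k)"
    unfolding Psi_def by (simp add: sum.union_disjoint)
  moreover have "0 < (\<Sum>k\<in>{m..<n}. 1 / real k)" using assms by (intro sum_pos) auto
  ultimately show ?thesis by simp
qed

lemma Psi_mono: "1 \<le> m \<Longrightarrow> m \<le> n \<Longrightarrow> Psi m \<le> Psi n"
  using Psi_strict_mono[of m n] by (cases "m = n") auto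

lemma Psi_nonneg: "0 \<le> Psi n" unfolding Psi_def by (intro sum_nonneg) auto

lemma Psi_inj: "inj_on Psi {1..}"
  by (rule linorder_inj_onI') (use Psi_strict_mono in force)

lemma vertex_at_Psi: "1 \<le> n \<Longrightarrow> vertex_at (Psi n) = n"
  by (rule the_inv_into_f_f[OF Psi_inj]) simp

lemma Psi_unbounded: "\<exists>n\<ge>1. t < Psi n"
proof (rule ccontr)
  assume "\<not> (\<exists>n\<ge>1. t < Psi n)"
  then have le: "Psi n \<le> t" if "1 \<le> n" for n using that by (meson not_le)
  have "Psi (Suc n) = (\<Sum>k<n. 1 / real (Suc k))" for n
    unfolding Psi_def by (induction n) (auto simp: atLeastLessThanSuc)
  then have "(\<Sum>k<n. 1 / real (Suc k)) \<le> t" for n using le[of "Suc n"] by simp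
  then have "summable (\<lambda>k. 1 / real (Suc k))"
    by (intro bounded_imp_summable[where B = t]) (auto simp: lessThan_Suc_atMost[symmetric] simp del: sum.lessThan_Suc)
  then have "summable (\<lambda>k. inverse (real k))"
    using summable_Suc_iff[of "\<lambda>k. inverse (real k)"] by (simp add: inverse_eq_divide)
  then show False using not_summable_harmonic[where 'a = real] by simp
qed

text \<open>The number of vertices of the network at time \<open>t\<close> of the scale \<open>\<Psi>\<close>.\<close>

definition youngest :: "real \<Rightarrow> nat" where
  "youngest t = Max {n. 1 \<le> n \<and> Psi n \<le> t}"

lemma youngest_finite: "finite {n. 1 \<le> n \<and> Psi n \<le> t}"
proof -
  obtain k where k: "1 \<le> k" "t < Psi k" using Psi_unbounded by blast
  have "{n. 1 \<le> n \<and> Psi n \<le> t} \<subseteq> {..k}"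
  proof (intro subsetI)
    fix n assume "n \<in> {n. 1 \<le> n \<and> Psi n \<le> t}"
    then show "n \<in> {..k}" using k Psi_mono[of k n] by (cases "n \<le> k") auto
  qed
  then show ?thesis by (rule finite_subset) simp
qed

lemma youngest:
  assumes "0 \<le> t"
  shows "1 \<le> youngest t" "Psi (youngest t) \<le> t" "t < Psi (Suc (youngest t))"
    and youngest_ge: "\<And>n. 1 \<le> n \<Longrightarrow> Psi n \<le> t \<Longrightarrow> n \<le> youngest t"
proof -
  have ne: "{n. 1 \<le> n \<and> Psi n \<le> t} \<noteq> {}" using assms Psi_1 by (metis (mono_tags, lifting) One_nat_def empty_iff le_refl mem_Collect_eq)
  have "youngest t \<in> {n. 1 \<le> n \<and> Psi n \<le> t}" unfolding youngest_def by (rule Max_in[OF youngest_finite ne])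
  then show "1 \<le> youngest t" "Psi (youngest t) \<le> t" by auto
  show ge: "n \<le> youngest t" if "1 \<le> n" "Psi n \<le> t" for n
    unfolding youngest_def by (rule Max_ge[OF youngest_finite]) (use that in auto)
  show "t < Psi (Suc (youngest t))" using ge[of "Suc (youngest t)"] by (cases "t < Psi (Suc (youngest t))") auto
qed

lemma youngest_eqI: "1 \<le> n \<Longrightarrow> Psi n \<le> t \<Longrightarrow> t < Psi (Suc n) \<Longrightarrow> youngest t = n"
proof (rule antisym)
  assume n: "1 \<le> n" "Psi n \<le> t" "t < Psi (Suc n)"
  have t: "0 \<le> t" using n Psi_nonneg[of n] by linarith
  show "n \<le> youngest t" using youngest_ge[OF t] n by blast
  show "youngest t \<le> n"
    using Psi_mono[of "Suc n" "youngest t"] youngest[OF t] n by (cases "youngest t \<le> n") (auto simp: not_le Suc_le_eq)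
qed

lemma youngest_mono: "0 \<le> t \<Longrightarrow> t \<le> t' \<Longrightarrow> youngest t \<le> youngest t'"
  using youngest[of t] youngest_ge[of t' "youngest t"] by simp

lemma Max_time_set:
  assumes "0 \<le> t"
  shows "Max (time_set \<inter> {0..t}) = Psi (youngest t)"
proof (rule Max_eqI)
  have "time_set \<inter> {0..t} \<subseteq> Psi ` {n. 1 \<le> n \<and> Psi n \<le> t}" by (auto simp: time_set_def)
  then show "finite (time_set \<inter> {0..t})" using youngest_finite finite_subset by blast
  show "Psi (youngest t) \<in> time_set \<inter> {0..t}" using youngest[OF assms] by (auto simp: time_set_def Psi_nonneg)
  fix y assume "y \<in> time_set \<inter> {0..t}"
  then obtain n where "1 \<le> n" "y = Psi n" "Psi n \<le> t" by (auto simp: time_set_def)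
  then show "y \<le> Psi (youngest t)" using youngest_ge[OF assms] Psi_mono by auto
qed

lemma scaled_indegree_eq:
  assumes m: "1 \<le> m" and r: "0 \<le> r"
  shows "scaled_indegree f \<Gamma> (Psi m) (Psi m + r) = Phi f (real (in_degree (with_proj (\<Gamma> (youngest (Psi m + r)))) m))"
proof -
  let ?t = "Psi m + r"
  have t: "0 \<le> ?t" using r Psi_nonneg[of m] by simp
  have "m \<le> youngest ?t" using youngest_ge[OF t m] r by simp
  then have "max (Psi m) (Max (time_set \<inter> {0..?t})) = Psi (youngest ?t)"
    unfolding Max_time_set[OF t] using Psi_mono[OF m] by (simp add: max_absorb2)
  then show ?thesis using youngest(1)[OF t] m by (simp only: scaled_indegree_def vertex_at_Psi)
qed



section \<open>The indegree of a fixed vertex as a Markov chain\<close>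

lemma measurable_map_upt:
  fixes X :: "nat \<Rightarrow> 'a \<Rightarrow> 'b::countable"
  assumes X: "\<And>l. l < n \<Longrightarrow> X l \<in> M \<rightarrow>\<^sub>M count_space UNIV"
  shows "(\<lambda>\<omega>. map (\<lambda>l. X l \<omega>) [0..<n]) \<in> M \<rightarrow>\<^sub>M count_space UNIV"
proof (subst measurable_count_space_eq_countable[OF countableI_type], intro conjI ballI)
  fix h :: "'b list"
  have eq: "map (\<lambda>l. X l \<omega>) [0..<n] = h \<longleftrightarrow> length h = n \<and> (\<forall>l\<in>{..<n}. X l \<omega> = h ! l)" for \<omega>
    by (subst list_eq_iff_nth_eq) auto
  have "(\<lambda>\<omega>. map (\<lambda>l. X l \<omega>) [0..<n]) -` {h} \<inter> space M =
     {\<omega> \<in> space M. length h = n \<and> (\<forall>l\<in>{..<n}. X l \<omega> = h ! l)}"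
    unfolding eq[symmetric] by blast
  also have "\<dots> \<in> sets M"
  proof (cases "length h = n")
    case True
    have "{\<omega> \<in> space M. X l \<omega> = h ! l} \<in> sets M" if "l < n" for l
    proof -
      have "{\<omega> \<in> space M. X l \<omega> = h ! l} = X l -` {h ! l} \<inter> space M" by blast
      then show ?thesis using measurable_sets[OF X[OF that], of "{h ! l}"] by simp
    qed
    then have "{\<omega> \<in> space M. \<forall>l\<in>{..<n}. X l \<omega> = h ! l} \<in> sets M"
      by (cases "n = 0") (simp, intro sets.sets_Collect_finite_All', auto simp: lessThan_empty_iff)
    moreover have "{\<omega> \<in> space M. length h = n \<and> (\<forall>l\<in>{..<n}. X l \<omega> = h ! l)} = {\<omega> \<in> space M. \<forall>l\<in>{..<n}. X l \<omega> = h ! l}"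
      using True by blast
    ultimately show ?thesis by (simp only:)
  next
    case False
    then have "{\<omega> \<in> space M. length h = n \<and> (\<forall>l\<in>{..<n}. X l \<omega> = h ! l)} = {}" by blast
    then show ?thesis by (simp only: sets.empty_sets)
  qed
  finally show "(\<lambda>\<omega>. map (\<lambda>l. X l \<omega>) [0..<n]) -` {h} \<inter> space M \<in> sets M" .
qed (rule Pi_I, rule UNIV_I)

text \<open>In the network, \<open>J i\<close> tells whether vertex \<open>m + i + 1\<close> sends an edge to vertex \<open>m\<close>; then \<open>Z i\<close> is
  the indegree of \<open>m\<close> at time \<open>m + i\<close>. Counting jumps, rather than using the indegree itself,
  gives increments 0 and 1 everywhere and not only almost surely.\<close>

locale jump_chain = prob_space M + weak_preference_rule f
  for M :: "'a measure" and f :: "nat \<Rightarrow> real" +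
  fixes J :: "nat \<Rightarrow> 'a \<Rightarrow> bool" and m :: nat
  assumes m_pos: "1 \<le> m" and J_measurable: "\<And>i. J i \<in> M \<rightarrow>\<^sub>M count_space UNIV"
begin

definition Z :: "nat \<Rightarrow> 'a \<Rightarrow> nat" where "Z i \<omega> = (\<Sum>l<i. of_bool (J l \<omega>))"

definition history :: "nat \<Rightarrow> 'a \<Rightarrow> bool list" where "history i \<omega> = map (\<lambda>l. J l \<omega>) [0..<i]"

definition F :: "nat \<Rightarrow> 'a measure" where "F i = vimage_algebra (space M) (history i) (count_space UNIV)"

definition p :: "nat \<Rightarrow> 'a \<Rightarrow> real" where "p i \<omega> = f (Z i \<omega>) / real (m + i)"

lemma space_F [simp]: "space (F i) = space M" by (simp add: F_def)

lemma sets_F: "sets (F i) = {history i -` A \<inter> space M |A. True}"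
  by (simp add: F_def sets_vimage_algebra2)

lemma history_measurable [measurable]: "history i \<in> M \<rightarrow>\<^sub>M count_space UNIV"
  unfolding history_def by (rule measurable_map_upt[OF J_measurable])

lemma history_measurable_F: "history i \<in> F i \<rightarrow>\<^sub>M count_space UNIV"
  unfolding F_def by (rule measurable_vimage_algebra1) auto

lemma function_of_history: "(\<lambda>\<omega>. y (history i \<omega>)) \<in> F i \<rightarrow>\<^sub>M borel"
  by (rule measurable_compose[OF history_measurable_F]) simp

lemma history_nth: "l < i \<Longrightarrow> history i \<omega> ! l = J l \<omega>" by (simp add: history_def)

lemma take_history: "l \<le> i \<Longrightarrow> take l (history i \<omega>) = history l \<omega>"
  by (simp add: history_def take_map)

lemma Z_history: "Z i \<omega> = (\<Sum>l<i. of_bool (history i \<omega> ! l))"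
  unfolding Z_def by (rule sum.cong) (auto simp: history_nth)

lemma Z_le: "Z i \<omega> \<le> i"
proof -
  have "Z i \<omega> \<le> (\<Sum>l<i. 1)" unfolding Z_def by (rule sum_mono) auto
  then show ?thesis by simp
qed

lemma Z_Suc: "Z (Suc i) \<omega> = Z i \<omega> + of_bool (J i \<omega>)" by (simp add: Z_def)

lemma p_bounds: "0 \<le> p i \<omega>" "p i \<omega> \<le> 1"
proof -
  show "0 \<le> p i \<omega>" using f_pos[of "Z i \<omega>"] by (simp add: p_def less_imp_le)
  have "f (Z i \<omega>) \<le> real (m + i)" using f_le[of "Z i \<omega>"] Z_le[of i \<omega>] m_pos by linarith
  then show "p i \<omega> \<le> 1" using m_pos by (simp add: p_def)
qed

lemma subalgebra_M: "subalgebra M (F i)"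
  unfolding subalgebra_def
proof (intro conjI subsetI)
  fix B assume "B \<in> sets (F i)"
  then obtain A where B: "B = history i -` A \<inter> space M" unfolding sets_F by blast
  show "B \<in> sets M" unfolding B by (rule measurable_sets[OF history_measurable]) simp
qed simp

lemma subalgebra_Suc: "subalgebra (F (Suc i)) (F i)"
  unfolding subalgebra_def
proof (intro conjI subsetI)
  fix B assume "B \<in> sets (F i)"
  then obtain A where B: "B = history i -` A \<inter> space M" unfolding sets_F by blast
  have "B = history (Suc i) -` {h. take i h \<in> A} \<inter> space M"
    unfolding B using take_history[of i "Suc i"] by auto
  then show "B \<in> sets (F (Suc i))" unfolding sets_F by blast
qed simp

text \<open>A function that is measurable with respect to the past is constant on the finitely many
  atoms of the past.\<close>

lemma factor_history:
  assumes Y: "Y \<in> borel_measurable (F i)"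
  obtains y :: "bool list \<Rightarrow> real" where "\<And>\<omega>. \<omega> \<in> space M \<Longrightarrow> Y \<omega> = y (history i \<omega>)"
proof
  fix \<omega> assume w: "\<omega> \<in> space M"
  define \<omega>' where "\<omega>' = (SOME \<omega>'. \<omega>' \<in> space M \<and> history i \<omega>' = history i \<omega>)"
  have w': "\<omega>' \<in> space M" "history i \<omega>' = history i \<omega>"
    unfolding \<omega>'_def using someI[of "\<lambda>\<omega>'. \<omega>' \<in> space M \<and> history i \<omega>' = history i \<omega>" \<omega>] w by auto
  have "Y -` {Y \<omega>} \<inter> space (F i) \<in> sets (F i)" by (rule measurable_sets[OF Y]) simp
  then obtain A where "Y -` {Y \<omega>} \<inter> space M = history i -` A \<inter> space M" by (auto simp: sets_F)
  then have "Y \<omega>' = Y \<omega>" using w w' by blast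
  then show "Y \<omega> = (\<lambda>h. Y (SOME \<omega>'. \<omega>' \<in> space M \<and> history i \<omega>' = h)) (history i \<omega>)"
    by (simp add: \<omega>'_def)
qed

end

locale preferential_chain = jump_chain +
  assumes jump: "\<And>i (y :: bool list \<Rightarrow> real). expectation (\<lambda>\<omega>. y (history i \<omega>) * of_bool (J i \<omega>))
      = expectation (\<lambda>\<omega>. y (history i \<omega>) * p i \<omega>)"
begin

text \<open>The jumps of the chain, with height \<open>g k\<close> out of state \<open>k\<close>, minus their conditional means. The
  choice \<open>g = 1 / f\<close> gives the martingale part of the degree evolution on the artificial scales,
  \<open>g = 1 / f\<^sup>2\<close> that of the sum of its squared jumps.\<close>

definition compensated :: "(nat \<Rightarrow> real) \<Rightarrow> nat \<Rightarrow> 'a \<Rightarrow> real" where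
  "compensated g i \<omega> = g (Z i \<omega>) * (of_bool (J i \<omega>) - p i \<omega>)"

definition jump_variance :: "(nat \<Rightarrow> real) \<Rightarrow> nat \<Rightarrow> 'a \<Rightarrow> real" where
  "jump_variance g i \<omega> = (g (Z i \<omega>))\<^sup>2 * (p i \<omega> * (1 - p i \<omega>))"

definition recip :: "nat \<Rightarrow> real" where "recip k = 1 / f k"
definition recip_sq :: "nat \<Rightarrow> real" where "recip_sq k = 1 / (f k)\<^sup>2"

lemma finite_histories: "finite (range (history i))"
proof -
  have "range (history i) \<subseteq> {h. set h \<subseteq> UNIV \<and> length h = i}" by (auto simp: history_def)
  then show ?thesis by (rule finite_subset) (rule finite_lists_length_eq, simp)
qed

lemma integrable_history:
  fixes u :: "bool list \<Rightarrow> bool \<Rightarrow> real"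
  shows "integrable M (\<lambda>\<omega>. u (history i \<omega>) (J i \<omega>))"
proof -
  define B where "B = (\<Sum>h\<in>range (history i). \<bar>u h True\<bar> + \<bar>u h False\<bar>)"
  show ?thesis
  proof (rule integrable_const_bound[where B = B])
    have "\<bar>u (history i \<omega>) (J i \<omega>)\<bar> \<le> B" for \<omega>
    proof -
      have "\<bar>u (history i \<omega>) (J i \<omega>)\<bar> \<le> \<bar>u (history i \<omega>) True\<bar> + \<bar>u (history i \<omega>) False\<bar>"
        by (cases "J i \<omega>") auto
      also have "\<dots> \<le> B" unfolding B_def
        by (rule member_le_sum[OF _ _ finite_histories]) auto
      finally show ?thesis .
    qed
    then show "AE \<omega> in M. norm (u (history i \<omega>) (J i \<omega>)) \<le> B" by simp
    have "(\<lambda>\<omega>. u (history i \<omega>) (J i \<omega>)) = (\<lambda>\<omega>. (\<lambda>h. u (butlast h) (last h)) (history (Suc i) \<omega>))"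
      by (auto simp: history_def)
    also have "\<dots> \<in> borel_measurable M"
      by (rule measurable_compose[OF history_measurable]) simp
    finally show "(\<lambda>\<omega>. u (history i \<omega>) (J i \<omega>)) \<in> borel_measurable M" .
  qed
qed

definition Zh :: "nat \<Rightarrow> bool list \<Rightarrow> nat" where "Zh i h = (\<Sum>l<i. of_bool (h ! l))"
definition ph :: "nat \<Rightarrow> bool list \<Rightarrow> real" where "ph i h = f (Zh i h) / real (m + i)"

lemma Zh: "Z i \<omega> = Zh i (history i \<omega>)" by (simp add: Zh_def Z_history)
lemma ph: "p i \<omega> = ph i (history i \<omega>)" by (simp add: ph_def p_def Zh)

lemma compensated_jumps:
  assumes g: "\<And>k. 0 \<le> g k" "\<And>k. g k \<le> c"
  shows "martingale_differences M F (compensated g) (jump_variance g) c"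
  unfolding compensated_def[abs_def] jump_variance_def[abs_def]
proof
  show "subalgebra M (F n)" "subalgebra (F (Suc n)) (F n)" for n
    by (rule subalgebra_M subalgebra_Suc)+
  show "(\<lambda>\<omega>. g (Z n \<omega>) * (of_bool (J n \<omega>) - p n \<omega>)) \<in> borel_measurable (F (Suc n))" for n
  proof -
    have "(\<lambda>\<omega>. g (Z n \<omega>) * (of_bool (J n \<omega>) - p n \<omega>)) =
        (\<lambda>\<omega>. (\<lambda>h. g (Zh n (butlast h)) * (of_bool (last h) - ph n (butlast h))) (history (Suc n) \<omega>))"
      by (auto simp: Zh ph fun_eq_iff history_def butlast_append)
    then show ?thesis
      using function_of_history[of "\<lambda>h. g (Zh n (butlast h)) * (of_bool (last h) - ph n (butlast h))" "Suc n"]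
      by (simp only:)
  qed
  show "(\<lambda>\<omega>. (g (Z n \<omega>))\<^sup>2 * (p n \<omega> * (1 - p n \<omega>))) \<in> borel_measurable (F n)" for n
    unfolding Zh ph by (rule function_of_history[of "\<lambda>h. (g (Zh n h))\<^sup>2 * (ph n h * (1 - ph n h))"])
  fix n \<omega>
  show "\<bar>g (Z n \<omega>) * (of_bool (J n \<omega>) - p n \<omega>)\<bar> \<le> c"
  proof -
    have "\<bar>of_bool (J n \<omega>) - p n \<omega>\<bar> \<le> 1" using p_bounds[of n \<omega>] by auto
    then have "\<bar>g (Z n \<omega>)\<bar> * \<bar>of_bool (J n \<omega>) - p n \<omega>\<bar> \<le> c * 1"
      using g[of "Z n \<omega>"] by (intro mult_mono) auto
    then show ?thesis by (simp add: abs_mult)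
  qed
  show "0 \<le> (g (Z n \<omega>))\<^sup>2 * (p n \<omega> * (1 - p n \<omega>))" using p_bounds[of n \<omega>] by simp
  show "(g (Z n \<omega>))\<^sup>2 * (p n \<omega> * (1 - p n \<omega>)) \<le> c\<^sup>2"
  proof -
    have "(g (Z n \<omega>))\<^sup>2 * (p n \<omega> * (1 - p n \<omega>)) \<le> c\<^sup>2 * 1"
      using g[of "Z n \<omega>"] p_bounds[of n \<omega>] by (intro mult_mono power_mono mult_le_one) auto
    then show ?thesis by simp
  qed
next
  fix n and Y :: "'a \<Rightarrow> real" and B :: real assume Y: "Y \<in> borel_measurable (F n)"
  obtain y where y: "\<And>\<omega>. \<omega> \<in> space M \<Longrightarrow> Y \<omega> = y (history n \<omega>)" using factor_history[OF Y] by blast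
  have "expectation (\<lambda>\<omega>. Y \<omega> * (g (Z n \<omega>) * (of_bool (J n \<omega>) - p n \<omega>)))
    = expectation (\<lambda>\<omega>. (y (history n \<omega>) * g (Zh n (history n \<omega>))) * of_bool (J n \<omega>) - (y (history n \<omega>) * g (Zh n (history n \<omega>))) * p n \<omega>)"
    by (rule Bochner_Integration.integral_cong) (auto simp: y Zh algebra_simps)
  also have "\<dots> = expectation (\<lambda>\<omega>. (y (history n \<omega>) * g (Zh n (history n \<omega>))) * of_bool (J n \<omega>)) - expectation (\<lambda>\<omega>. (y (history n \<omega>) * g (Zh n (history n \<omega>))) * p n \<omega>)"
    unfolding ph
    by (rule Bochner_Integration.integral_diff)
      (rule integrable_history[of "\<lambda>h b. y h * g (Zh n h) * of_bool b"], rule integrable_history[of "\<lambda>h b. y h * g (Zh n h) * ph n h"])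
  also have "\<dots> = 0" by (simp only: jump[of "\<lambda>h. y h * g (Zh n h)"] diff_self)
  finally show "expectation (\<lambda>\<omega>. Y \<omega> * (g (Z n \<omega>) * (of_bool (J n \<omega>) - p n \<omega>))) = 0" .
  define u where "u h = y h * (g (Zh n h))\<^sup>2 * (1 - 2 * ph n h)" for h
  define w where "w h = y h * (g (Zh n h))\<^sup>2 * (ph n h)\<^sup>2" for h
  have iu: "integrable M (\<lambda>\<omega>. u (history n \<omega>) * of_bool (J n \<omega>))" "integrable M (\<lambda>\<omega>. u (history n \<omega>) * p n \<omega>)"
      "integrable M (\<lambda>\<omega>. w (history n \<omega>))"
    unfolding ph by (rule integrable_history[of "\<lambda>h b. u h * of_bool b"] integrable_history[of "\<lambda>h b. u h * ph n h"] integrable_history[of "\<lambda>h b. w h"])+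
  have "expectation (\<lambda>\<omega>. Y \<omega> * (g (Z n \<omega>) * (of_bool (J n \<omega>) - p n \<omega>))\<^sup>2)
    = expectation (\<lambda>\<omega>. u (history n \<omega>) * of_bool (J n \<omega>) + w (history n \<omega>))"
    by (rule Bochner_Integration.integral_cong)
      (auto simp: y Zh ph u_def w_def power2_eq_square algebra_simps)
  also have "\<dots> = expectation (\<lambda>\<omega>. u (history n \<omega>) * of_bool (J n \<omega>)) + expectation (\<lambda>\<omega>. w (history n \<omega>))"
    using iu by simp
  also have "\<dots> = expectation (\<lambda>\<omega>. u (history n \<omega>) * p n \<omega> + w (history n \<omega>))"
    using iu by (simp add: jump[of u])
  also have "\<dots> = expectation (\<lambda>\<omega>. Y \<omega> * ((g (Z n \<omega>))\<^sup>2 * (p n \<omega> * (1 - p n \<omega>))))"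
    by (rule Bochner_Integration.integral_cong)
      (auto simp: y Zh ph u_def w_def power2_eq_square algebra_simps)
  finally show "expectation (\<lambda>\<omega>. Y \<omega> * (g (Z n \<omega>) * (of_bool (J n \<omega>) - p n \<omega>))\<^sup>2) =
    expectation (\<lambda>\<omega>. Y \<omega> * ((g (Z n \<omega>))\<^sup>2 * (p n \<omega> * (1 - p n \<omega>))))" .
qed

sublocale D: martingale_differences M F "compensated recip" "jump_variance recip" C
  by (rule compensated_jumps) (auto simp: recip_def inverse_f_le f_pos less_imp_le)

sublocale Q: martingale_differences M F "compensated recip_sq" "jump_variance recip_sq" "C\<^sup>2"
proof (rule compensated_jumps)
  show "recip_sq k \<le> C\<^sup>2" for k
    using power_mono[OF inverse_f_le[of k], of 2] f_pos[of k] by (simp add: recip_sq_def power_divide less_imp_le)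
qed (simp add: recip_sq_def)

text \<open>The compensator of the sum of squared jumps; it exceeds the accumulated variance by a part
  of the convergent series \<open>K\<close>.\<close>

definition A :: "nat \<Rightarrow> 'a \<Rightarrow> real" where "A i \<omega> = (\<Sum>l<i. 1 / (real (m + l) * f (Z l \<omega>)))"

definition K :: real where "K = (\<Sum>k. 1 / (real (Suc k))\<^sup>2)"

lemma f_nz: "f k \<noteq> 0" using f_pos[of k] by simp

lemma D_S: "D.S i \<omega> = Phi f (real (Z i \<omega>)) - (Psi (m + i) - Psi m)"
proof (induction i)
  case 0 then show ?case by (simp add: D.S_def Z_def Phi_eq)
next
  case (Suc i)
  have "Phi f (real (Z (Suc i) \<omega>)) = Phi f (real (Z i \<omega>)) + of_bool (J i \<omega>) / f (Z i \<omega>)"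
    unfolding Phi_eq P1.P_nat Z_Suc by (cases "J i \<omega>") auto
  moreover have "Psi (m + Suc i) = Psi (m + i) + 1 / real (m + i)" using Psi_Suc[of "m + i"] m_pos by simp
  moreover have "compensated recip i \<omega> = of_bool (J i \<omega>) / f (Z i \<omega>) - 1 / real (m + i)"
  proof -
    have "1 / f (Z i \<omega>) * p i \<omega> = 1 / real (m + i)" using f_nz by (simp add: p_def)
    then show ?thesis by (simp add: compensated_def recip_def right_diff_distrib)
  qed
  ultimately show ?case unfolding D.S_Suc using Suc by linarith
qed

lemma Q_S: "Q.S i \<omega> = P2.P (real (Z i \<omega>)) - A i \<omega>"
proof (induction i)
  case 0 then show ?case by (simp add: Q.S_def Z_def A_def)
next
  case (Suc i)
  have "P2.P (real (Z (Suc i) \<omega>)) = P2.P (real (Z i \<omega>)) + of_bool (J i \<omega>) / (f (Z i \<omega>))\<^sup>2"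
    unfolding P2.P_nat Z_Suc by (cases "J i \<omega>") auto
  moreover have "compensated recip_sq i \<omega> = of_bool (J i \<omega>) / (f (Z i \<omega>))\<^sup>2 - 1 / (real (m + i) * f (Z i \<omega>))"
  proof -
    have "1 / (f (Z i \<omega>))\<^sup>2 * p i \<omega> = 1 / (real (m + i) * f (Z i \<omega>))"
      using f_nz by (simp add: p_def power2_eq_square)
    then show ?thesis by (simp add: compensated_def recip_sq_def right_diff_distrib)
  qed
  moreover have "A (Suc i) \<omega> = A i \<omega> + 1 / (real (m + i) * f (Z i \<omega>))" by (simp add: A_def)
  ultimately show ?case unfolding Q.S_Suc using Suc by linarith
qed

lemma K: "(\<Sum>l<i. 1 / (real (m + l))\<^sup>2) \<le> K" "0 \<le> K"
proof -
  have s: "summable (\<lambda>k. 1 / (real (Suc k))\<^sup>2)"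
    using inverse_power_summable[of 2, where 'a = real] summable_Suc_iff[of "\<lambda>k. inverse (real k ^ 2)"]
    by (simp add: inverse_eq_divide)
  have "(\<Sum>l<i. 1 / (real (m + l))\<^sup>2) \<le> (\<Sum>l<i. 1 / (real (Suc l))\<^sup>2)"
    using m_pos by (intro sum_mono divide_left_mono power_mono) auto
  also have "\<dots> \<le> K" unfolding K_def by (rule sum_le_suminf[OF s]) auto
  finally show "(\<Sum>l<i. 1 / (real (m + l))\<^sup>2) \<le> K" .
  show "0 \<le> K" unfolding K_def by (rule suminf_nonneg[OF s]) auto
qed

lemma D_V: "D.V i \<omega> = A i \<omega> - (\<Sum>l<i. 1 / (real (m + l))\<^sup>2)"
proof -
  have "(1 / f k)\<^sup>2 * (f k / r * (1 - f k / r)) = 1 / (r * f k) - 1 / r\<^sup>2" if "r \<noteq> 0" for k and r :: real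
    using that f_nz[of k] by (simp add: field_simps power2_eq_square)
  then show ?thesis using m_pos unfolding D.V_def A_def p_def jump_variance_def recip_def
    by (simp add: sum_subtractf[symmetric] del: of_nat_add)
qed

lemma Q_V_le: "Q.V i \<omega> \<le> C\<^sup>2 * A i \<omega>"
  unfolding Q.V_def A_def sum_distrib_left jump_variance_def recip_sq_def
proof (rule sum_mono)
  fix l
  let ?x = "f (Z l \<omega>)" and ?r = "real (m + l)"
  have "(1 / ?x\<^sup>2)\<^sup>2 * (p l \<omega> * (1 - p l \<omega>)) \<le> (1 / ?x\<^sup>2)\<^sup>2 * p l \<omega>"
    using p_bounds[of l \<omega>] by (intro mult_left_mono) (auto simp: mult_left_le)
  also have "\<dots> = (1 / ?x)\<^sup>2 * (1 / (?r * ?x))"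
    using f_nz[of "Z l \<omega>"] by (simp add: p_def power2_eq_square)
  also have "\<dots> \<le> C\<^sup>2 * (1 / (?r * ?x))"
    using inverse_f_le[of "Z l \<omega>"] f_pos[of "Z l \<omega>"] by (intro mult_right_mono power_mono) auto
  finally show "(1 / ?x\<^sup>2)\<^sup>2 * (p l \<omega> * (1 - p l \<omega>)) \<le> C\<^sup>2 * (1 / (?r * ?x))" .
qed

text \<open>Let \<open>a\<close> be \<open>\<phi>\<close> at the clock and \<open>R\<close> be \<open>\<phi>\<close> at the position, that is the sum of squared jumps. The
  accumulated variance differs from \<open>A\<close> by at most \<open>K\<close>, \<open>A\<close> differs from \<open>R\<close> by the martingale \<open>Q.S\<close>,
  and \<open>R\<close> differs from \<open>a\<close> by at most \<open>C \<bar>D.S\<bar>\<close>. Both martingales have second moments of order \<open>b = E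
  A = E R\<close>, and the last comparison also bounds \<open>b\<close> by \<open>2 a + C\<^sup>2\<close>. The parameter \<open>\<theta>\<close> trades first
  against second moments.\<close>

lemma bracket_estimate:
  assumes \<theta>: "0 < \<theta>"
  shows "expectation (\<lambda>\<omega>. \<bar>D.V i \<omega> - phi f (Psi (m + i) - Psi m)\<bar>)
    \<le> K + \<theta> + C\<^sup>2 * (2 * phi f (Psi (m + i) - Psi m) + C\<^sup>2) / \<theta>"
proof -
  define \<psi> where "\<psi> = Psi (m + i) - Psi m"
  define a where "a = phi f \<psi>"
  define R where "R \<omega> = P2.P (real (Z i \<omega>))" for \<omega>
  have psi0: "0 \<le> \<psi>" unfolding \<psi>_def using Psi_mono[OF m_pos, of "m + i"] by simp
  have RA: "Q.S i \<omega> = R \<omega> - A i \<omega>" for \<omega> by (simp add: Q_S R_def)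
  have Ra: "\<bar>R \<omega> - a\<bar> \<le> C * \<bar>D.S i \<omega>\<bar>" for \<omega>
  proof -
    have "R \<omega> = phi f (Phi f (real (Z i \<omega>)))" by (simp add: phi_Phi R_def)
    moreover have "0 \<le> Phi f (real (Z i \<omega>))" unfolding Phi_eq using P1.P_mono[of 0] by simp
    ultimately show ?thesis using phi_lipschitz[of "Phi f (real (Z i \<omega>))" \<psi>] psi0
      by (simp add: D_S a_def \<psi>_def)
  qed
  have iA: "integrable M (A i)"
  proof -
    have "A i = (\<lambda>\<omega>. D.V i \<omega> + (\<Sum>l<i. 1 / (real (m + l))\<^sup>2))" by (simp add: D_V fun_eq_iff)
    then show ?thesis by simp
  qed
  have iR: "integrable M R"
  proof -
    have "R = (\<lambda>\<omega>. Q.S i \<omega> + A i \<omega>)" by (simp add: RA fun_eq_iff)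
    then show ?thesis using iA by simp
  qed
  have iS2: "integrable M (\<lambda>\<omega>. (D.S i \<omega>)\<^sup>2)" "integrable M (\<lambda>\<omega>. (Q.S i \<omega>)\<^sup>2)"
  proof -
    show "integrable M (\<lambda>\<omega>. (D.S i \<omega>)\<^sup>2)"
      by (rule integrable_const_bound[where B = "(real i * C)\<^sup>2"])
        (use power_mono[OF D.S_bound abs_ge_zero, of _ i 2] in auto)
    show "integrable M (\<lambda>\<omega>. (Q.S i \<omega>)\<^sup>2)"
      by (rule integrable_const_bound[where B = "(real i * C\<^sup>2)\<^sup>2"])
        (use power_mono[OF Q.S_bound abs_ge_zero, of _ i 2] in auto)
  qed
  define b where "b = expectation (A i)"
  have b: "expectation R = b"
  proof -
    have "expectation (\<lambda>\<omega>. 1 * (Q.S i \<omega> - Q.S 0 \<omega>)) = 0" by (rule Q.centred_sum[where B = 1]) auto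
    then have "expectation (\<lambda>\<omega>. R \<omega> - A i \<omega>) = 0" by (simp add: RA Q.S_def[of 0] lessThan_0)
    then show ?thesis using iR iA by (simp add: b_def)
  qed
  have S2: "expectation (\<lambda>\<omega>. (D.S i \<omega>)\<^sup>2) \<le> b"
  proof -
    have "expectation (\<lambda>\<omega>. (D.S i \<omega>)\<^sup>2) = expectation (D.V i)"
      using D.variance_sum[of 0 i] by (simp add: D.S_def[of 0] D.V_def[of 0])
    also have "\<dots> \<le> b" unfolding b_def
      by (rule integral_mono) (use iA in \<open>auto simp: D_V intro!: sum_nonneg\<close>)
    finally show ?thesis .
  qed
  have Q2: "expectation (\<lambda>\<omega>. (Q.S i \<omega>)\<^sup>2) \<le> C\<^sup>2 * b"
  proof -
    have "expectation (\<lambda>\<omega>. (Q.S i \<omega>)\<^sup>2) = expectation (Q.V i)"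
      using Q.variance_sum[of 0 i] by (simp add: Q.S_def[of 0] Q.V_def[of 0])
    also have "\<dots> \<le> expectation (\<lambda>\<omega>. C\<^sup>2 * A i \<omega>)"
      by (rule integral_mono) (use iA Q_V_le in auto)
    finally show ?thesis by (simp add: b_def)
  qed
  have young: "\<bar>x\<bar> \<le> (t + x\<^sup>2 / t) / 2" if "0 < t" for t x :: real
  proof -
    have "0 \<le> (\<bar>x\<bar> - t)\<^sup>2" by simp
    then have "2 * t * \<bar>x\<bar> \<le> t * t + x\<^sup>2" by (simp add: power2_eq_square algebra_simps)
    then show ?thesis using that by (simp add: field_simps power2_eq_square)
  qed
  have b_le: "b \<le> 2 * a + C\<^sup>2"
  proof -
    have "b - a = expectation (\<lambda>\<omega>. R \<omega> - a)" using iR b by (simp add: prob_space)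
    also have "\<dots> \<le> expectation (\<lambda>\<omega>. (C\<^sup>2 + (D.S i \<omega>)\<^sup>2) / 2)"
    proof (rule integral_mono)
      fix \<omega>
      have "C * \<bar>D.S i \<omega>\<bar> \<le> (C\<^sup>2 + (D.S i \<omega>)\<^sup>2) / 2"
      proof -
        have "0 \<le> (\<bar>D.S i \<omega>\<bar> - C)\<^sup>2" by simp
        then show ?thesis by (simp add: power2_eq_square algebra_simps)
      qed
      then show "R \<omega> - a \<le> (C\<^sup>2 + (D.S i \<omega>)\<^sup>2) / 2" using Ra[of \<omega>] by linarith
    qed (use iR iS2 in auto)
    also have "\<dots> = (C\<^sup>2 + expectation (\<lambda>\<omega>. (D.S i \<omega>)\<^sup>2)) / 2" using iS2 by (simp add: prob_space)
    finally show ?thesis using S2 by simp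
  qed
  have "expectation (\<lambda>\<omega>. \<bar>D.V i \<omega> - a\<bar>) \<le>
    expectation (\<lambda>\<omega>. K + ((\<theta> + (Q.S i \<omega>)\<^sup>2 / \<theta>) / 2 + (\<theta> + C\<^sup>2 * (D.S i \<omega>)\<^sup>2 / \<theta>) / 2))"
  proof (rule integral_mono)
    fix \<omega>
    have "\<bar>D.V i \<omega> - a\<bar> \<le> (\<Sum>l<i. 1 / (real (m + l))\<^sup>2) + \<bar>Q.S i \<omega>\<bar> + \<bar>R \<omega> - a\<bar>"
      using sum_nonneg[of "{..<i}" "\<lambda>l. 1 / (real (m + l))\<^sup>2"] unfolding D_V RA by simp
    also have "\<dots> \<le> K + (\<theta> + (Q.S i \<omega>)\<^sup>2 / \<theta>) / 2 + \<bar>C * D.S i \<omega>\<bar>"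
      using Ra[of \<omega>] C_pos by (intro add_mono K(1) young[OF \<theta>]) (simp add: abs_mult)
    also have "\<dots> \<le> K + (\<theta> + (Q.S i \<omega>)\<^sup>2 / \<theta>) / 2 + (\<theta> + (C * D.S i \<omega>)\<^sup>2 / \<theta>) / 2"
      by (intro add_left_mono young[OF \<theta>])
    finally show "\<bar>D.V i \<omega> - a\<bar> \<le> K + ((\<theta> + (Q.S i \<omega>)\<^sup>2 / \<theta>) / 2 + (\<theta> + C\<^sup>2 * (D.S i \<omega>)\<^sup>2 / \<theta>) / 2)"
      by (simp add: power_mult_distrib)
  qed (use iS2 in auto)
  also have "\<dots> = K + \<theta> + (expectation (\<lambda>\<omega>. (Q.S i \<omega>)\<^sup>2) + C\<^sup>2 * expectation (\<lambda>\<omega>. (D.S i \<omega>)\<^sup>2)) / (2 * \<theta>)"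
    using iS2 \<theta> by (simp add: prob_space add_divide_distrib)
  also have "\<dots> \<le> K + \<theta> + (C\<^sup>2 * (2 * a + C\<^sup>2) + C\<^sup>2 * (2 * a + C\<^sup>2)) / (2 * \<theta>)"
  proof (intro add_left_mono divide_right_mono add_mono)
    show "expectation (\<lambda>\<omega>. (Q.S i \<omega>)\<^sup>2) \<le> C\<^sup>2 * (2 * a + C\<^sup>2)"
      using Q2 mult_left_mono[OF b_le, of "C\<^sup>2"] by simp
    show "C\<^sup>2 * expectation (\<lambda>\<omega>. (D.S i \<omega>)\<^sup>2) \<le> C\<^sup>2 * (2 * a + C\<^sup>2)"
      using S2 b_le by (intro mult_left_mono) auto
  qed (use \<theta> in auto)
  also have "\<dots> = K + \<theta> + C\<^sup>2 * (2 * a + C\<^sup>2) / \<theta>" using \<theta> by (simp add: field_simps)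
  finally show ?thesis unfolding a_def \<psi>_def .
qed

text \<open>The index of the chain at time \<open>\<phi>\<^sup>* r\<close> after the birth of vertex \<open>m\<close>.\<close>

definition \<tau> :: "real \<Rightarrow> nat" where "\<tau> r = youngest (Psi m + phi_star f r) - m"

lemma tau_add: "0 \<le> r \<Longrightarrow> m + \<tau> r = youngest (Psi m + phi_star f r)"
  using youngest_ge[of "Psi m + phi_star f r" m] m_pos Psi_nonneg[of m] phi_star_nonneg[of r] by (simp add: \<tau>_def)

lemma tau_clock:
  assumes "0 \<le> r"
  shows "Psi (m + \<tau> r) - Psi m \<le> phi_star f r" "phi_star f r < Psi (m + \<tau> r) - Psi m + 1"
proof -
  have t: "0 \<le> Psi m + phi_star f r" using Psi_nonneg[of m] phi_star_nonneg[OF assms] by simp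
  note y = youngest[OF t, folded tau_add[OF assms]]
  show "Psi (m + \<tau> r) - Psi m \<le> phi_star f r" using y(2) by simp
  have "1 / real (m + \<tau> r) \<le> 1" using y(1) by simp
  then show "phi_star f r < Psi (m + \<tau> r) - Psi m + 1"
    using y(3) unfolding Psi_Suc[OF y(1)] by linarith
qed

sublocale T: time_changed_martingale M F "compensated recip" "jump_variance recip" C \<tau>
proof
  show "\<tau> r \<le> \<tau> r'" if "0 \<le> r" "r \<le> r'" for r r'
    unfolding \<tau>_def using that Psi_nonneg[of m] phi_star_nonneg[of r] phi_star_mono[of r r']
    by (intro diff_le_mono youngest_mono) auto
  show "\<tau> 0 = 0"
    using youngest_eqI[of m "Psi m"] Psi_strict_mono[OF m_pos, of "Suc m"] m_pos by (simp add: \<tau>_def phi_star_0)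
  show "((\<lambda>r. expectation (\<lambda>\<omega>. \<bar>D.V (\<tau> r) \<omega> - r\<bar>) / r) \<longlongrightarrow> 0) at_top"
  proof (rule Lim_null_comparison)
    \<comment> \<open>The choice \<open>\<theta> = sqrt r\<close> balances the two error terms.\<close>
    define B where "B r = (K + C + sqrt r + C\<^sup>2 * (2 * (r + C) + C\<^sup>2) / sqrt r) / r" for r
    define b where "b = C\<^sup>2"
    define d where "d = 2 * C + b"
    have "((\<lambda>r. 1 / r) \<longlongrightarrow> (0::real)) at_top" by real_asymp
    moreover have "((\<lambda>r. 1 / sqrt r) \<longlongrightarrow> (0::real)) at_top" by real_asymp
    ultimately have "((\<lambda>r. (K + C) * (1 / r) + (1 + 2 * b + b * d * (1 / r)) * (1 / sqrt r)) \<longlongrightarrow> (K + C) * 0 + (1 + 2 * b + b * d * 0) * 0) at_top"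
      by (intro tendsto_intros)
    moreover have "\<forall>\<^sub>F r in at_top. (K + C) * (1 / r) + (1 + 2 * b + b * d * (1 / r)) * (1 / sqrt r) = B r"
      using eventually_gt_at_top[of 0]
    proof eventually_elim
      case (elim r)
      define q where "q = sqrt r"
      have q: "0 < q" "r = q * q" using elim by (auto simp: q_def)
      have "B r = (K + C + q + b * (2 * (q * q) + d) / q) / (q * q)"
        unfolding B_def q_def[symmetric] b_def[symmetric] d_def using q by (simp add: algebra_simps)
      also have "\<dots> = (K + C) * (1 / (q * q)) + (1 + 2 * b + b * d * (1 / (q * q))) * (1 / q)"
        using q(1) by (simp add: field_simps)
      finally show ?case using q by (simp add: q_def[symmetric])
    qed
    ultimately show "(B \<longlongrightarrow> 0) at_top" by (simp add: tendsto_cong)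
    show "\<forall>\<^sub>F r in at_top. norm (expectation (\<lambda>\<omega>. \<bar>D.V (\<tau> r) \<omega> - r\<bar>) / r) \<le> B r"
      using eventually_gt_at_top[of 0]
    proof eventually_elim
      case (elim r)
      then have r0: "0 \<le> r" by simp
      define a where "a = phi f (Psi (m + \<tau> r) - Psi m)"
      have "\<bar>a - r\<bar> \<le> C * \<bar>(Psi (m + \<tau> r) - Psi m) - phi_star f r\<bar>"
        using phi_lipschitz[of "Psi (m + \<tau> r) - Psi m" "phi_star f r"] phi_phi_star[OF r0] phi_star_nonneg[OF r0]
          Psi_mono[OF m_pos, of "m + \<tau> r"] by (simp add: a_def)
      also have "\<dots> \<le> C * 1" using tau_clock[OF r0] C_pos by (intro mult_left_mono) auto
      finally have ar: "\<bar>a - r\<bar> \<le> C" by simp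
      have "expectation (\<lambda>\<omega>. \<bar>D.V (\<tau> r) \<omega> - r\<bar>) \<le> expectation (\<lambda>\<omega>. \<bar>D.V (\<tau> r) \<omega> - a\<bar> + C)"
        using ar by (intro integral_mono) auto
      also have "\<dots> = expectation (\<lambda>\<omega>. \<bar>D.V (\<tau> r) \<omega> - a\<bar>) + C" by (simp add: prob_space)
      also have "\<dots> \<le> K + sqrt r + C\<^sup>2 * (2 * a + C\<^sup>2) / sqrt r + C"
        using bracket_estimate[of "sqrt r" "\<tau> r"] elim by (simp add: a_def)
      also have "\<dots> \<le> K + sqrt r + C\<^sup>2 * (2 * (r + C) + C\<^sup>2) / sqrt r + C"
        using ar elim by (intro add_mono divide_right_mono mult_left_mono) auto
      finally have "expectation (\<lambda>\<omega>. \<bar>D.V (\<tau> r) \<omega> - r\<bar>) / r \<le> B r"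
        unfolding B_def using elim by (intro divide_right_mono) auto
      moreover have "0 \<le> expectation (\<lambda>\<omega>. \<bar>D.V (\<tau> r) \<omega> - r\<bar>)" by (rule integral_nonneg_AE) simp
      ultimately show ?case using elim by simp
    qed
  qed
qed

end



section \<open>The rescaled degree process\<close>

lemma converges_in_distribution_AE_cong:
  assumes conv: "converges_in_distribution T F M X N Y"
    and X': "\<forall>\<^sub>F i in F. X' i \<in> M \<rightarrow>\<^sub>M borel_of T"
    and eq: "\<forall>\<^sub>F i in F. AE \<omega> in M. X i \<omega> = X' i \<omega>"
  shows "converges_in_distribution T F M X' N Y"
  unfolding converges_in_distribution_def
proof (intro conjI allI impI X')
  show "Y \<in> N \<rightarrow>\<^sub>M borel_of T" using conv by (simp add: converges_in_distribution_def)
  fix h assume h: "continuous_map T euclideanreal h \<and> bounded (h ` topspace T)"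
  have m: "h \<in> borel_measurable (borel_of T)" using h by (intro measurable_borel_of_continuous) simp
  have X: "\<forall>\<^sub>F i in F. X i \<in> M \<rightarrow>\<^sub>M borel_of T" using conv by (simp add: converges_in_distribution_def)
  have lim: "((\<lambda>i. LINT \<omega>|M. h (X i \<omega>)) \<longlongrightarrow> (LINT \<omega>|N. h (Y \<omega>))) F"
    using conv h unfolding converges_in_distribution_def by blast
  have "\<forall>\<^sub>F i in F. (LINT \<omega>|M. h (X i \<omega>)) = (LINT \<omega>|M. h (X' i \<omega>))"
    using X X' eq
  proof eventually_elim
    case (elim i)
    show ?case
      by (rule integral_cong_AE[OF measurable_compose[OF elim(1) m] measurable_compose[OF elim(2) m]])
        (use elim(3) in eventually_elim, simp)
  qed
  then show "((\<lambda>i. LINT \<omega>|M. h (X' i \<omega>)) \<longlongrightarrow> (LINT \<omega>|N. h (Y \<omega>))) F"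
    using lim by (rule Lim_transform_eventually[rotated])
qed

context weak_preference_rule begin

text \<open>The map from the sequence of indegrees to the path. The jump times are deterministic, so up
  to a given time the path depends on finitely many indegrees, which makes it measurable.\<close>

definition rescaled_path :: "nat \<Rightarrow> real \<Rightarrow> (nat \<Rightarrow> nat) \<Rightarrow> real \<Rightarrow> real" where
  "rescaled_path m \<kappa> d = (\<lambda>t\<in>{0..}. (Phi f (real (d (youngest (Psi m + phi_star f (\<kappa> * t))))) - phi_star f (\<kappa> * t)) / sqrt \<kappa>)"

lemma rescaled_path_cadlag:
  assumes m: "1 \<le> m" and \<kappa>: "0 < \<kappa>"
  shows "rescaled_path m \<kappa> d \<in> cadlag_paths"
proof -
  define u where "u t = Psi m + phi_star f (\<kappa> * t)" for t
  have u0: "Psi m \<le> u t" "0 \<le> u t" if "0 \<le> t" for t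
    using phi_star_nonneg[of "\<kappa> * t"] Psi_nonneg[of m] that \<kappa> by (auto simp: u_def)
  have mono: "u t < u t'" if "0 \<le> t" "t < t'" for t t'
    using phi_star_strict_mono[of "\<kappa> * t" "\<kappa> * t'"] that \<kappa> by (simp add: u_def)
  have cp: "continuous_on {0..} (\<lambda>t. phi_star f (\<kappa> * t))"
    by (rule continuous_on_compose2[OF phi_star_continuous]) (use \<kappa> in \<open>auto intro!: continuous_intros\<close>)
  have cu: "(u \<longlongrightarrow> u t) (at t within {0..})" if "0 \<le> t" for t
  proof -
    have "continuous_on {0..} u" unfolding u_def[abs_def] by (intro continuous_intros cp)
    then show ?thesis using that by (auto simp: continuous_on_def)
  qed
  have "(\<lambda>t\<in>{0..}. (\<lambda>k t. (Phi f (real (d k)) - phi_star f (\<kappa> * t)) / sqrt \<kappa>) (youngest (u t)) t) \<in> cadlag_paths"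
  proof (rule cadlag_piecewise[where K = "\<lambda>t. youngest (u t)" and q = "\<lambda>k t. (Phi f (real (d k)) - phi_star f (\<kappa> * t)) / sqrt \<kappa>"])
    fix t :: real assume t: "0 \<le> t"
    note y = youngest[OF u0(2)[OF t]]
    have "(u \<longlongrightarrow> u t) (at_right t)" by (rule tendsto_within_subset[OF cu[OF t]]) (use t in auto)
    then have "\<forall>\<^sub>F v in at_right t. u v < Psi (Suc (youngest (u t)))" using y(3) by (rule order_tendstoD)
    then show "\<forall>\<^sub>F v in at_right t. youngest (u v) = youngest (u t)"
      using eventually_at_right_less
    proof eventually_elim
      case (elim v)
      show ?case by (rule youngest_eqI[OF y(1) _ elim(1)]) (use y(2) mono[OF t elim(2)] in linarith)
    qed
  next
    fix t :: real assume t: "0 < t"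
    then have t0: "0 \<le> t" by simp
    note y = youngest[OF u0(2)[OF t0]]
    have "at t within {0..<t} = at_left t" by (rule at_within_nhd[of _ "{0<..}"]) (use t in auto)
    moreover have "(u \<longlongrightarrow> u t) (at t within {0..<t})" by (rule tendsto_within_subset[OF cu[OF t0]]) auto
    ultimately have lim: "(u \<longlongrightarrow> u t) (at_left t)" by simp
    have ev: "\<forall>\<^sub>F v in at_left t. v \<in> {0<..<t}" using eventually_at_left_real[OF t] .
    show "\<exists>k. \<forall>\<^sub>F v in at_left t. youngest (u v) = k"
    proof (cases "Psi (youngest (u t)) < u t")
      case True
      have "\<forall>\<^sub>F v in at_left t. Psi (youngest (u t)) < u v" by (rule order_tendstoD(1)[OF lim True])
      then have "\<forall>\<^sub>F v in at_left t. youngest (u v) = youngest (u t)" using ev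
      proof eventually_elim
        case (elim v)
        show ?case by (rule youngest_eqI[OF y(1)]) (use elim(1) y(3) mono[of v t] elim(2) in auto)
      qed
      then show ?thesis by blast
    next
      case False
      then have eq: "Psi (youngest (u t)) = u t" using y(2) by simp
      \<comment> \<open>At \<open>t\<close> itself a new vertex arrives, so the index to the left of \<open>t\<close> is smaller by one.\<close>
      define k where "k = youngest (u t) - 1"
      have "Psi m < u t" using mono[of 0 t] t u0(1)[of 0] by simp
      then have "youngest (u t) \<noteq> 1" using eq Psi_nonneg[of m] by auto
      then have k: "1 \<le> k" "Suc k = youngest (u t)" using y(1) by (auto simp: k_def)
      have "Psi k < Psi (Suc k)" by (rule Psi_strict_mono[OF k(1)]) simp
      then have "Psi k < u t" by (simp only: k(2) eq)
      then have "\<forall>\<^sub>F v in at_left t. Psi k < u v" by (rule order_tendstoD(1)[OF lim])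
      then have "\<forall>\<^sub>F v in at_left t. youngest (u v) = k" using ev
      proof eventually_elim
        case (elim v)
        show ?case by (rule youngest_eqI[OF k(1)]) (use elim(1) eq k(2) mono[of v t] elim(2) in auto)
      qed
      then show ?thesis by blast
    qed
  next
    show "continuous_on {0..} (\<lambda>t. (Phi f (real (d k)) - phi_star f (\<kappa> * t)) / sqrt \<kappa>)" for k
      unfolding divide_inverse by (intro continuous_intros cp)
  qed
  then show ?thesis by (simp add: rescaled_path_def u_def)
qed

lemma rescaled_path_measurable:
  assumes m: "1 \<le> m" and \<kappa>: "0 < \<kappa>" and d: "\<And>n. (\<lambda>\<omega>. d n \<omega>) \<in> M \<rightarrow>\<^sub>M count_space UNIV"
  shows "(\<lambda>\<omega>. rescaled_path m \<kappa> (\<lambda>n. d n \<omega>)) \<in> M \<rightarrow>\<^sub>M borel_of cadlag_topology"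
proof (rule measurable_cadlag_limit)
  let ?X = "\<lambda>k \<omega>. rescaled_path m \<kappa> (\<lambda>n. d (min n k) \<omega>)"
  show "rescaled_path m \<kappa> (\<lambda>n. d n \<omega>) \<in> cadlag_paths" for \<omega> by (rule rescaled_path_cadlag[OF m \<kappa>])
  show "?X k \<in> M \<rightarrow>\<^sub>M borel_of cadlag_topology" for k
  proof -
    have "(\<lambda>h :: nat list. rescaled_path m \<kappa> (\<lambda>n. h ! min n k)) \<in> count_space UNIV \<rightarrow>\<^sub>M borel_of cadlag_topology"
      by (simp add: space_borel_of topspace_cadlag_topology rescaled_path_cadlag[OF m \<kappa>])
    from measurable_compose[OF measurable_map_upt[where X = d and n = "Suc k", OF d] this]
    have "(\<lambda>\<omega>. rescaled_path m \<kappa> (\<lambda>n. map (\<lambda>l. d l \<omega>) [0..<Suc k] ! min n k)) \<in> M \<rightarrow>\<^sub>M borel_of cadlag_topology" .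
    moreover have "map (\<lambda>l. d l \<omega>) [0..<Suc k] ! min n k = d (min n k) \<omega>" for n \<omega>
      by (subst nth_map) (auto simp del: upt_Suc)
    ultimately show ?thesis by (simp only:)
  qed
  fix \<omega>
  show "(\<lambda>k. path_dist (?X k \<omega>) (rescaled_path m \<kappa> (\<lambda>n. d n \<omega>))) \<longlonglongrightarrow> 0"
  proof (rule LIMSEQ_I)
    fix e :: real assume e: "0 < e"
    define T where "T = 2 / e"
    have T: "0 < T" "1 / (1 + T) \<le> e / 2" using e by (auto simp: T_def field_simps)
    define k0 where "k0 = youngest (Psi m + phi_star f (\<kappa> * T))"
    have "path_dist (?X k \<omega>) (rescaled_path m \<kappa> (\<lambda>n. d n \<omega>)) \<le> e / 2" if "k0 \<le> k" for k
    proof (rule path_dist_le_uniform[of T])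
      fix t assume t: "0 \<le> t" "t < T"
      have "youngest (Psi m + phi_star f (\<kappa> * t)) \<le> k0" unfolding k0_def
        using t \<kappa> Psi_nonneg[of m] phi_star_nonneg[of "\<kappa> * t"] phi_star_mono[of "\<kappa> * t" "\<kappa> * T"]
        by (intro youngest_mono) auto
      then have "min (youngest (Psi m + phi_star f (\<kappa> * t))) k = youngest (Psi m + phi_star f (\<kappa> * t))" using that by simp
      then have "?X k \<omega> t = rescaled_path m \<kappa> (\<lambda>n. d n \<omega>) t" by (simp add: rescaled_path_def)
      then show "\<bar>?X k \<omega> t - rescaled_path m \<kappa> (\<lambda>n. d n \<omega>) t\<bar> \<le> e / 2" using e by simp
    qed (use T in auto)
    then show "\<exists>k0. \<forall>k\<ge>k0. norm (path_dist (?X k \<omega>) (rescaled_path m \<kappa> (\<lambda>n. d n \<omega>)) - 0) < e"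
    proof (intro exI allI impI)
      fix k assume "k0 \<le> k"
      then have "path_dist (?X k \<omega>) (rescaled_path m \<kappa> (\<lambda>n. d n \<omega>)) \<le> e / 2" by fact
      then show "norm (path_dist (?X k \<omega>) (rescaled_path m \<kappa> (\<lambda>n. d n \<omega>)) - 0) < e"
        using e path_dist_nonneg[of "?X k \<omega>" "rescaled_path m \<kappa> (\<lambda>n. d n \<omega>)"] by simp
    qed
  qed
qed

end

context preferential_chain begin

text \<open>The rescaled path differs from the rescaled martingale only by the distance of \<open>\<phi>\<^sup>*\<close> to the
  last tick of the clock, which is at most 1 before rescaling.\<close>

lemma chain_convergence:
  assumes W: "standard_brownian_motion N W"
  shows "converges_in_distribution cadlag_topology at_top M (\<lambda>\<kappa> \<omega>. rescaled_path m \<kappa> (\<lambda>n. Z (n - m) \<omega>)) N (\<lambda>\<omega>. \<lambda>t\<in>{0..}. W t \<omega>)"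
proof (rule T.functional_clt[OF W, where C = 1])
  fix \<kappa> :: real assume \<kappa>: "0 < \<kappa>"
  show "(\<lambda>\<omega>. rescaled_path m \<kappa> (\<lambda>n. Z (n - m) \<omega>)) \<in> M \<rightarrow>\<^sub>M borel_of cadlag_topology"
  proof (rule rescaled_path_measurable[OF m_pos \<kappa>])
    show "Z (n - m) \<in> M \<rightarrow>\<^sub>M count_space UNIV" for n
      unfolding Zh by (rule measurable_compose[OF history_measurable]) simp
  qed
  fix \<omega> t assume t: "0 \<le> (t::real)"
  let ?r = "\<kappa> * t"
  have r: "0 \<le> ?r" using \<kappa> t by simp
  have "rescaled_path m \<kappa> (\<lambda>n. Z (n - m) \<omega>) t = (Phi f (real (Z (\<tau> ?r) \<omega>)) - phi_star f ?r) / sqrt \<kappa>"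
    using t by (simp add: rescaled_path_def tau_add[OF r, symmetric])
  then have "rescaled_path m \<kappa> (\<lambda>n. Z (n - m) \<omega>) t - D.S (\<tau> ?r) \<omega> / sqrt \<kappa>
      = ((Psi (m + \<tau> ?r) - Psi m) - phi_star f ?r) / sqrt \<kappa>"
    by (simp add: D_S diff_divide_distrib)
  also have "\<bar>\<dots>\<bar> \<le> 1 / sqrt \<kappa>"
    using tau_clock[OF r] \<kappa> by (simp add: abs_divide divide_right_mono)
  finally show "\<bar>rescaled_path m \<kappa> (\<lambda>n. Z (n - m) \<omega>) t - D.S (\<tau> ?r) \<omega> / sqrt \<kappa>\<bar> \<le> 1 / sqrt \<kappa>" .
qed

end

section \<open>The network\<close>

lemma (in prob_space) expectation_finite_range:
  fixes u :: "'c \<Rightarrow> real"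
  assumes A: "finite A" and X: "\<And>a. a \<in> A \<Longrightarrow> {\<omega> \<in> space M. X \<omega> = a} \<in> events"
    and AE: "AE \<omega> in M. X \<omega> \<in> A" and Y: "Y \<in> borel_measurable M" "AE \<omega> in M. Y \<omega> = u (X \<omega>)"
  shows "expectation Y = (\<Sum>a\<in>A. u a * prob {\<omega> \<in> space M. X \<omega> = a})"
proof -
  let ?i = "\<lambda>a \<omega>. indicator {\<omega> \<in> space M. X \<omega> = a} \<omega> :: real"
  have ii: "integrable M (?i a)" if "a \<in> A" for a
    using X[OF that] by (intro integrable_real_indicator) (auto simp: emeasure_eq_measure)
  have "expectation Y = expectation (\<lambda>\<omega>. \<Sum>a\<in>A. u a * ?i a \<omega>)"
  proof (rule integral_cong_AE[OF Y(1)])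
    show "(\<lambda>\<omega>. \<Sum>a\<in>A. u a * ?i a \<omega>) \<in> borel_measurable M"
      using X by (intro borel_measurable_sum borel_measurable_times borel_measurable_const borel_measurable_indicator) auto
    show "AE \<omega> in M. Y \<omega> = (\<Sum>a\<in>A. u a * ?i a \<omega>)"
      using AE Y(2) AE_space
    proof eventually_elim
      case (elim \<omega>)
      have "(\<Sum>a\<in>A. u a * ?i a \<omega>) = (\<Sum>a\<in>A. if a = X \<omega> then u a else 0)"
        using elim(3) by (intro sum.cong) (auto simp: indicator_def)
      also have "\<dots> = u (X \<omega>)" using A elim(1) by simp
      finally show ?case using elim(2) by simp
    qed
  qed
  also have "\<dots> = (\<Sum>a\<in>A. expectation (\<lambda>\<omega>. u a * ?i a \<omega>))"
    using ii by (intro Bochner_Integration.integral_sum) auto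
  also have "\<dots> = (\<Sum>a\<in>A. u a * prob {\<omega> \<in> space M. X \<omega> = a})" 
  proof (intro sum.cong refl)
    fix a
    have "{\<omega> \<in> space M. X \<omega> = a} \<inter> space M = {\<omega> \<in> space M. X \<omega> = a}" by blast
    then show "expectation (\<lambda>\<omega>. u a * ?i a \<omega>) = u a * prob {\<omega> \<in> space M. X \<omega> = a}" by simp
  qed
  finally show ?thesis .
qed

lemma sum_Sigma_pairs:
  "finite A \<Longrightarrow> (\<And>x. x \<in> A \<Longrightarrow> finite (B x)) \<Longrightarrow> (\<Sum>a\<in>Sigma A B. u a) = (\<Sum>x\<in>A. \<Sum>y\<in>B x. u (x, y))"
  by (subst sum.Sigma) (auto simp: split_def)

text \<open>A finite set that almost surely contains the network at time \<open>n\<close>.\<close>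

definition admissible :: "nat \<Rightarrow> nat pair_pre_digraph set" where
  "admissible n = {g. pverts g = {1..n} \<and> (\<forall>(k, l)\<in>parcs g. 1 \<le> l \<and> l < k \<and> k \<le> n)}"

lemma finite_admissible: "finite (admissible n)"
proof (rule finite_subset)
  show "admissible n \<subseteq> (\<lambda>E. \<lparr>pverts = {1..n}, parcs = E\<rparr>) ` Pow ({1..n} \<times> {1..n})"
  proof
    fix g assume g: "g \<in> admissible n"
    have "g = \<lparr>pverts = {1..n}, parcs = parcs g\<rparr>" using g by (simp add: admissible_def)
    moreover have "parcs g \<subseteq> {1..n} \<times> {1..n}" using g by (force simp: admissible_def)
    ultimately show "g \<in> (\<lambda>E. \<lparr>pverts = {1..n}, parcs = E\<rparr>) ` Pow ({1..n} \<times> {1..n})" by blast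
  qed
qed auto

lemma finite_step: "finite (set_pmf (step_law f n g))"
proof -
  have "finite (set_pmf (Pi_pmf {1..n} False (\<lambda>m. bernoulli_pmf (f (in_degree (with_proj g) m) / real n))))"
    by (rule finite_subset[OF set_Pi_pmf_subset']) (auto intro: finite_PiE_dflt)
  then show ?thesis by (simp add: step_law_def)
qed

lemma step_support: "h \<in> set_pmf (step_law f n g) \<Longrightarrow> \<exists>b. h = add_vertex (Suc n) b g"
  by (auto simp: step_law_def)

lemma add_vertex_admissible: "g \<in> admissible n \<Longrightarrow> add_vertex (Suc n) b g \<in> admissible (Suc n)"
  by (auto simp: admissible_def add_vertex_def)

lemma add_vertex_arcs:
  assumes g: "g \<in> admissible n" and m: "1 \<le> m" "m \<le> n"
  shows "(Suc n, m) \<in> parcs (add_vertex (Suc n) b g) \<longleftrightarrow> b m"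
    and "\<And>k. k \<le> n \<Longrightarrow> (k, l) \<in> parcs (add_vertex (Suc n) b g) \<longleftrightarrow> (k, l) \<in> parcs g"
  using g m by (auto simp: admissible_def add_vertex_def)

lemma in_degree_eq: "in_degree (with_proj g) m = card {k. (k, m) \<in> parcs g}"
proof -
  have "in_arcs (with_proj g) m = (\<lambda>k. (k, m)) ` {k. (k, m) \<in> parcs g}"
    by (auto simp: in_arcs_def)
  then show ?thesis by (simp add: in_degree_def card_image inj_on_def)
qed

text \<open>The indegree of \<open>m\<close> is at most \<open>n - m\<close>, so \<open>f\<close> of it is at most \<open>n\<close> and the Bernoulli parameter is a
  probability.\<close>

lemma step_jump_probability:
  assumes f: "attachment_rule f" and g: "g \<in> admissible n" and m: "1 \<le> m" "m \<le> n"
  shows "measure_pmf.prob (step_law f n g) {h. (Suc n, m) \<in> parcs h} = f (in_degree (with_proj g) m) / real n"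
proof -
  let ?d = "in_degree (with_proj g)"
  have "{k. (k, m) \<in> parcs g} \<subseteq> {m<..n}" using g by (auto simp: admissible_def)
  then have "?d m \<le> card {m<..n}" unfolding in_degree_eq by (intro card_mono) auto
  then have "real (?d m) + 1 \<le> real n" using m by simp
  moreover have "0 < f (?d m)" "f (?d m) \<le> real (?d m) + 1" using f by (auto simp: attachment_rule_def)
  ultimately have p: "0 \<le> f (?d m) / real n" "f (?d m) / real n \<le> 1" using m by auto
  have "measure_pmf.prob (step_law f n g) {h. (Suc n, m) \<in> parcs h}
    = measure_pmf.prob (Pi_pmf {1..n} False (\<lambda>m. bernoulli_pmf (f (?d m) / real n))) {b. b m}"
    unfolding step_law_def measure_map_pmf by (simp add: vimage_def add_vertex_arcs(1)[OF g m])
  also have "\<dots> = measure_pmf.prob (map_pmf (\<lambda>b. b m) (Pi_pmf {1..n} False (\<lambda>m. bernoulli_pmf (f (?d m) / real n)))) {True}"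
    by (simp add: vimage_def)
  also have "map_pmf (\<lambda>b. b m) (Pi_pmf {1..n} False (\<lambda>m. bernoulli_pmf (f (?d m) / real n))) = bernoulli_pmf (f (?d m) / real n)"
    using m by (subst Pi_pmf_component) auto
  also have "measure_pmf.prob (bernoulli_pmf (f (?d m) / real n)) {True} = f (?d m) / real n"
    using p by (simp add: measure_pmf_single)
  finally show ?thesis .
qed

context preferential_attachment begin

lemma event_G: "1 \<le> n \<Longrightarrow> {\<omega> \<in> space M. G n \<omega> = g} \<in> events"
proof -
  assume "1 \<le> n"
  then have "G n -` {g} \<inter> space M \<in> events" using measurable_sets[OF random_network, of n "{g}"] by simp
  moreover have "G n -` {g} \<inter> space M = {\<omega> \<in> space M. G n \<omega> = g}" by blast
  ultimately show ?thesis by simp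
qed

lemma event_pair: "1 \<le> n \<Longrightarrow> {\<omega> \<in> space M. (G n \<omega>, G (Suc n) \<omega>) = a} \<in> events"
proof -
  assume n: "1 \<le> n"
  have "{\<omega> \<in> space M. (G n \<omega>, G (Suc n) \<omega>) = a} = {\<omega> \<in> space M. G n \<omega> = fst a} \<inter> {\<omega> \<in> space M. G (Suc n) \<omega> = snd a}"
    by (cases a) auto
  then show ?thesis using event_G[OF n] event_G[of "Suc n"] by auto
qed

lemma joint_law:
  assumes n: "1 \<le> n"
  shows "prob {\<omega> \<in> space M. (G n \<omega>, G (Suc n) \<omega>) = (g, h)} = prob {\<omega> \<in> space M. G n \<omega> = g} * pmf (step_law f n g) h"
proof (cases "prob {\<omega> \<in> space M. G n \<omega> = g} > 0")
  case True
  have "prob {\<omega> \<in> space M. (G n \<omega>, G (Suc n) \<omega>) = (g, h)} = prob {\<omega> \<in> space M. G (Suc n) \<omega> = h \<and> G n \<omega> = g}"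
    by (rule arg_cong[where f = prob]) auto
  then show ?thesis using step[OF n True, of h] True by (simp add: cond_prob_def field_simps)
next
  case False
  then have z: "prob {\<omega> \<in> space M. G n \<omega> = g} = 0" using measure_nonneg[of M] by (simp add: antisym_conv not_less)
  have "prob {\<omega> \<in> space M. (G n \<omega>, G (Suc n) \<omega>) = (g, h)} \<le> prob {\<omega> \<in> space M. G n \<omega> = g}"
    by (rule finite_measure_mono) (use event_G[OF n] in auto)
  then have "prob {\<omega> \<in> space M. (G n \<omega>, G (Suc n) \<omega>) = (g, h)} = 0"
    unfolding z by (rule antisym) (rule measure_nonneg)
  then show ?thesis unfolding z by (simp only: mult_zero_left)
qed

definition transitions :: "nat \<Rightarrow> (nat pair_pre_digraph \<times> nat pair_pre_digraph) set" where
  "transitions n = (SIGMA g : admissible n. set_pmf (step_law f n g))"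

lemma finite_transitions: "finite (transitions n)"
  unfolding transitions_def by (intro finite_SigmaI finite_admissible finite_step)

text \<open>Conditionally on each admissible graph the step law has total mass one on its finite
  support, and summing over the admissible graphs exhausts the probability.\<close>

lemma AE_transitions_step:
  assumes n: "1 \<le> n" and AE: "AE \<omega> in M. G n \<omega> \<in> admissible n"
  shows "AE \<omega> in M. (G n \<omega>, G (Suc n) \<omega>) \<in> transitions n"
proof -
  let ?X = "\<lambda>\<omega>. (G n \<omega>, G (Suc n) \<omega>)"
  have one: "(\<Sum>g\<in>admissible n. prob {\<omega> \<in> space M. G n \<omega> = g}) = 1"
    using expectation_finite_range[OF finite_admissible event_G[OF n] AE, of "\<lambda>_. 1" "\<lambda>_. 1"] by (simp add: prob_space)
  have E: "{\<omega> \<in> space M. ?X \<omega> \<in> transitions n} = (\<Union>a\<in>transitions n. {\<omega> \<in> space M. ?X \<omega> = a})" by auto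
  have "prob {\<omega> \<in> space M. ?X \<omega> \<in> transitions n} = (\<Sum>a\<in>transitions n. prob {\<omega> \<in> space M. ?X \<omega> = a})"
    unfolding E using event_pair[OF n]
    by (intro finite_measure_finite_Union finite_transitions) (auto simp: disjoint_family_on_def)
  also have "\<dots> = (\<Sum>g\<in>admissible n. \<Sum>h\<in>set_pmf (step_law f n g). prob {\<omega> \<in> space M. G n \<omega> = g} * pmf (step_law f n g) h)"
    unfolding transitions_def
    by (subst sum_Sigma_pairs[OF finite_admissible finite_step]) (simp only: joint_law[OF n])
  also have "\<dots> = (\<Sum>g\<in>admissible n. prob {\<omega> \<in> space M. G n \<omega> = g})"
    by (intro sum.cong refl) (simp add: sum_distrib_left[symmetric] sum_pmf_eq_1[OF finite_step])
  finally have "prob {\<omega> \<in> space M. ?X \<omega> \<in> transitions n} = 1" using one by simp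
  moreover have "{\<omega> \<in> space M. ?X \<omega> \<in> transitions n} \<in> events"
    unfolding E using event_pair[OF n] finite_transitions by (intro sets.finite_UN) auto
  ultimately show ?thesis by (subst (asm) prob_Collect_eq_1) auto
qed

lemma AE_admissible: "1 \<le> n \<Longrightarrow> AE \<omega> in M. G n \<omega> \<in> admissible n"
proof (induction n rule: dec_induct)
  case base
  have "initial_network \<in> admissible 1" by (auto simp: initial_network_def admissible_def)
  then show ?case using initial by (auto elim!: eventually_mono)
next
  case (step n)
  then have "AE \<omega> in M. (G n \<omega>, G (Suc n) \<omega>) \<in> transitions n" by (intro AE_transitions_step) auto
  then show ?case
  proof eventually_elim
    case (elim \<omega>)
    then obtain b where "G n \<omega> \<in> admissible n" "G (Suc n) \<omega> = add_vertex (Suc n) b (G n \<omega>)"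
      using step_support by (fastforce simp: transitions_def)
    then show ?case using add_vertex_admissible by simp
  qed
qed

lemma AE_transitions: "AE \<omega> in M. \<forall>n\<ge>1. (G n \<omega>, G (Suc n) \<omega>) \<in> transitions n"
proof -
  have "AE \<omega> in M. 1 \<le> n \<longrightarrow> (G n \<omega>, G (Suc n) \<omega>) \<in> transitions n" for n
    using AE_transitions_step[OF _ AE_admissible] by (cases "1 \<le> n") auto
  then show ?thesis by (simp add: AE_all_countable)
qed

definition arrow :: "nat \<Rightarrow> nat \<Rightarrow> 'a \<Rightarrow> bool" where
  "arrow m i \<omega> \<longleftrightarrow> (Suc (m + i), m) \<in> parcs (G (Suc (m + i)) \<omega>)"

text \<open>Edges are never removed, and new ones start in the new vertex; hence the present network
  determines the past arrows into \<open>m\<close>.\<close>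

lemma arrow_persists:
  assumes tr: "\<forall>n\<ge>1. (G n \<omega>, G (Suc n) \<omega>) \<in> transitions n" and m: "1 \<le> m"
  shows "i < j \<Longrightarrow> arrow m i \<omega> \<longleftrightarrow> (Suc (m + i), m) \<in> parcs (G (m + j) \<omega>)"
proof (induction j)
  case (Suc j)
  have "(G (m + j) \<omega>, G (Suc (m + j)) \<omega>) \<in> transitions (m + j)" using tr m by simp
  then obtain b where b: "G (m + j) \<omega> \<in> admissible (m + j)" "G (Suc (m + j)) \<omega> = add_vertex (Suc (m + j)) b (G (m + j) \<omega>)"
    using step_support by (fastforce simp: transitions_def)
  show ?case
  proof (cases "i = j")
    case True then show ?thesis by (simp add: arrow_def)
  next
    case False
    then have "i < j" using Suc by simp
    then show ?thesis using Suc.IH add_vertex_arcs(2)[OF b(1) m, of "Suc (m + i)" m b] m by (simp add: b(2))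
  qed
qed simp

lemma in_degree_arrows:
  assumes tr: "\<forall>n\<ge>1. (G n \<omega>, G (Suc n) \<omega>) \<in> transitions n" and m: "1 \<le> m"
  shows "in_degree (with_proj (G (m + i) \<omega>)) m = (\<Sum>l<i. of_bool (arrow m l \<omega>))"
proof -
  have "(G (m + i) \<omega>, G (Suc (m + i)) \<omega>) \<in> transitions (m + i)" using tr m by simp
  then have adm: "G (m + i) \<omega> \<in> admissible (m + i)" by (auto simp: transitions_def)
  have "{k. (k, m) \<in> parcs (G (m + i) \<omega>)} = (\<lambda>l. Suc (m + l)) ` {l. l < i \<and> arrow m l \<omega>}"
  proof (intro set_eqI iffI)
    fix k assume k: "k \<in> {k. (k, m) \<in> parcs (G (m + i) \<omega>)}"
    then have mk: "m < k" "k \<le> m + i" using adm by (auto simp: admissible_def)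
    define l where "l = k - Suc m"
    have l: "k = Suc (m + l)" "l < i" using mk by (auto simp: l_def)
    then show "k \<in> (\<lambda>l. Suc (m + l)) ` {l. l < i \<and> arrow m l \<omega>}"
      using k arrow_persists[OF tr m l(2)] by auto
  qed (use arrow_persists[OF tr m] in auto)
  then have "in_degree (with_proj (G (m + i) \<omega>)) m = card {l. l < i \<and> arrow m l \<omega>}"
    unfolding in_degree_eq by (simp add: card_image inj_on_def)
  also have "{l. l < i \<and> arrow m l \<omega>} = {..<i} \<inter> {l. arrow m l \<omega>}" by auto
  finally show ?thesis by (simp add: sum.If_cases of_bool_def)
qed

lemma arrow_measurable: "1 \<le> m \<Longrightarrow> arrow m i \<in> M \<rightarrow>\<^sub>M count_space UNIV"
  unfolding arrow_def by (rule measurable_compose[OF random_network]) auto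

text \<open>The past arrows and the present indegree are almost surely functions of the present network,
  so it suffices to condition on the present network and to sum over its finitely many values.\<close>

lemma arrows_form_chain:
  assumes f: "attachment_rule f" "\<not> summable (\<lambda>k. 1 / (f k)\<^sup>2)" and m: "1 \<le> m"
  shows "preferential_chain M f (arrow m) m"
proof -
  interpret weak_preference_rule f using f by unfold_locales
  interpret C: jump_chain M f "arrow m" m
    by unfold_locales (use m arrow_measurable[OF m] in auto)
  show ?thesis
  proof
    fix i and y :: "bool list \<Rightarrow> real"
    define n where "n = m + i"
    have n: "1 \<le> n" "m \<le> n" using m by (auto simp: n_def)
    define H where "H g = map (\<lambda>l. (Suc (m + l), m) \<in> parcs g) [0..<i]" for g :: "nat pair_pre_digraph"
    have past: "AE \<omega> in M. C.history i \<omega> = H (G n \<omega>) \<and> C.p i \<omega> = f (in_degree (with_proj (G n \<omega>)) m) / real n"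
      using AE_transitions
    proof eventually_elim
      case (elim \<omega>)
      have "C.history i \<omega> = H (G n \<omega>)"
        unfolding C.history_def H_def n_def using arrow_persists[OF elim m] by (intro map_cong) auto
      then show ?case by (simp add: C.p_def C.Z_def n_def in_degree_arrows[OF elim m])
    qed
    have ym: "(\<lambda>\<omega>. y (C.history i \<omega>)) \<in> borel_measurable M"
      by (rule measurable_compose[OF C.history_measurable]) simp
    have Jm: "(\<lambda>\<omega>. of_bool (arrow m i \<omega>) :: real) \<in> borel_measurable M"
      by (rule measurable_compose[OF arrow_measurable[OF m]]) simp
    have pm: "C.p i \<in> borel_measurable M"
    proof -
      have "C.p i = (\<lambda>\<omega>. (\<lambda>h. f (\<Sum>l<i. of_bool (h ! l)) / real (m + i)) (C.history i \<omega>))"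
        by (simp add: C.p_def C.Z_history fun_eq_iff)
      also have "\<dots> \<in> borel_measurable M" by (rule measurable_compose[OF C.history_measurable]) simp
      finally show ?thesis .
    qed
    define P where "P g = prob {\<omega> \<in> space M. G n \<omega> = g}" for g
    define q where "q g = f (in_degree (with_proj g) m) / real n" for g
    have "expectation (\<lambda>\<omega>. y (C.history i \<omega>) * of_bool (arrow m i \<omega>))
      = (\<Sum>a\<in>transitions n. (y (H (fst a)) * of_bool ((Suc n, m) \<in> parcs (snd a))) * prob {\<omega> \<in> space M. (G n \<omega>, G (Suc n) \<omega>) = a})"
    proof (rule expectation_finite_range[OF finite_transitions event_pair[OF n(1)] AE_transitions_step[OF n(1) AE_admissible[OF n(1)]]])
      show "(\<lambda>\<omega>. y (C.history i \<omega>) * of_bool (arrow m i \<omega>)) \<in> borel_measurable M"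
        by (intro borel_measurable_times ym Jm)
      show "AE \<omega> in M. y (C.history i \<omega>) * of_bool (arrow m i \<omega>) =
         y (H (fst (G n \<omega>, G (Suc n) \<omega>))) * of_bool ((Suc n, m) \<in> parcs (snd (G n \<omega>, G (Suc n) \<omega>)))"
        using past by eventually_elim (simp add: arrow_def n_def)
    qed
    also have "\<dots> = (\<Sum>g\<in>admissible n. \<Sum>h\<in>set_pmf (step_law f n g). (y (H g) * of_bool ((Suc n, m) \<in> parcs h)) * (P g * pmf (step_law f n g) h))"
      unfolding transitions_def
      by (subst sum_Sigma_pairs[OF finite_admissible finite_step]) (simp only: joint_law[OF n(1)] P_def fst_conv snd_conv)
    also have "\<dots> = (\<Sum>g\<in>admissible n. y (H g) * q g * P g)"
    proof (rule sum.cong[OF refl])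
      fix g assume g: "g \<in> admissible n"
      have "(\<Sum>h\<in>set_pmf (step_law f n g). of_bool ((Suc n, m) \<in> parcs h) * pmf (step_law f n g) h)
          = measure_pmf.expectation (step_law f n g) (\<lambda>h. of_bool ((Suc n, m) \<in> parcs h))"
        by (subst integral_measure_pmf[OF finite_step]) (auto simp: mult.commute)
      also have "\<dots> = measure_pmf.prob (step_law f n g) {h. (Suc n, m) \<in> parcs h}"
      proof -
        have "(\<lambda>h. of_bool ((Suc n, m) \<in> parcs h)) = (indicator {h. (Suc n, m) \<in> parcs h} :: nat pair_pre_digraph \<Rightarrow> real)"
          by (auto simp: indicator_def)
        then show ?thesis by simp
      qed
      also have "\<dots> = q g" unfolding q_def by (rule step_jump_probability[OF f(1) g m n(2)])
      finally have "(\<Sum>h\<in>set_pmf (step_law f n g). of_bool ((Suc n, m) \<in> parcs h) * pmf (step_law f n g) h) = q g" .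
      then have "y (H g) * q g * P g = (y (H g) * P g) * (\<Sum>h\<in>set_pmf (step_law f n g). of_bool ((Suc n, m) \<in> parcs h) * pmf (step_law f n g) h)"
        by simp
      also have "\<dots> = (\<Sum>h\<in>set_pmf (step_law f n g). (y (H g) * of_bool ((Suc n, m) \<in> parcs h)) * (P g * pmf (step_law f n g) h))"
        unfolding sum_distrib_left by (intro sum.cong refl) (simp only: mult_ac)
      finally show "(\<Sum>h\<in>set_pmf (step_law f n g). (y (H g) * of_bool ((Suc n, m) \<in> parcs h)) * (P g * pmf (step_law f n g) h)) = y (H g) * q g * P g" by simp
    qed
    also have "\<dots> = expectation (\<lambda>\<omega>. y (C.history i \<omega>) * C.p i \<omega>)"
      unfolding P_def
    proof (rule expectation_finite_range[symmetric, OF finite_admissible event_G[OF n(1)] AE_admissible[OF n(1)]])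
      show "(\<lambda>\<omega>. y (C.history i \<omega>) * C.p i \<omega>) \<in> borel_measurable M"
        by (intro borel_measurable_times ym pm)
      show "AE \<omega> in M. y (C.history i \<omega>) * C.p i \<omega> = y (H (G n \<omega>)) * q (G n \<omega>)"
        using past by eventually_elim (simp add: q_def)
    qed
    finally show "expectation (\<lambda>\<omega>. y (C.history i \<omega>) * of_bool (arrow m i \<omega>)) = expectation (\<lambda>\<omega>. y (C.history i \<omega>) * C.p i \<omega>)" .
  qed
qed

end

theorem proposition1p6:
  fixes f :: "nat \<Rightarrow> real"
    and M :: "'a measure" and G :: "nat \<Rightarrow> 'a \<Rightarrow> nat pair_pre_digraph"
    and N :: "'b measure" and W :: "real \<Rightarrow> 'b \<Rightarrow> real"
    and s :: real
  assumes "attachment_rule f"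
    and weak_preference: "\<not> summable (\<lambda>k. 1 / (f k)\<^sup>2)"
    and "preferential_attachment M f G"
    and "standard_brownian_motion N W"
    and "s \<in> time_set"
  shows "converges_in_distribution cadlag_topology at_top
    M (\<lambda>(\<kappa>::real) \<omega>. \<lambda>t\<in>{0..}.
         (scaled_indegree f (\<lambda>n. G n \<omega>) s (s + phi_star f (\<kappa> * t)) - phi_star f (\<kappa> * t)) / sqrt \<kappa>)
    N (\<lambda>\<omega>. \<lambda>t\<in>{0..}. W t \<omega>)"
proof -
  obtain m where m: "1 \<le> m" "s = Psi m" using \<open>s \<in> time_set\<close> by (auto simp: time_set_def)
  interpret G: preferential_attachment M f G by fact
  interpret C: preferential_chain M f "G.arrow m" m
    by (rule G.arrows_form_chain[OF assms(1,2) m(1)])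
  define X where "X \<kappa> \<omega> = C.rescaled_path m \<kappa> (\<lambda>n. in_degree (with_proj (G (max m n) \<omega>)) m)" for \<kappa> \<omega>
  have X: "(\<lambda>t\<in>{0..}. (scaled_indegree f (\<lambda>n. G n \<omega>) s (s + phi_star f (\<kappa> * t)) - phi_star f (\<kappa> * t)) / sqrt \<kappa>) = X \<kappa> \<omega>"
    if \<kappa>: "0 < \<kappa>" for \<kappa> \<omega>
    unfolding X_def C.rescaled_path_def
  proof (rule restrict_ext)
    fix t :: real assume "t \<in> {0..}"
    then have t: "0 \<le> \<kappa> * t" using \<kappa> by simp
    note nn = C.phi_star_nonneg[OF t]
    have "m \<le> youngest (Psi m + phi_star f (\<kappa> * t))" using C.tau_add[OF t] by (metis le_add1)
    then show "(scaled_indegree f (\<lambda>n. G n \<omega>) s (s + phi_star f (\<kappa> * t)) - phi_star f (\<kappa> * t)) / sqrt \<kappa> =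
      (Phi f (real (in_degree (with_proj (G (max m (youngest (Psi m + phi_star f (\<kappa> * t)))) \<omega>)) m)) - phi_star f (\<kappa> * t)) / sqrt \<kappa>"
      unfolding m(2) scaled_indegree_eq[OF m(1) nn] by (simp only: max_absorb2)
  qed
  have XM: "X \<kappa> \<in> M \<rightarrow>\<^sub>M borel_of cadlag_topology" if "0 < \<kappa>" for \<kappa>
    unfolding X_def
  proof (rule C.rescaled_path_measurable[OF m(1) that])
    fix n
    have "1 \<le> max m n" using m(1) by simp
    then show "(\<lambda>\<omega>. in_degree (with_proj (G (max m n) \<omega>)) m) \<in> M \<rightarrow>\<^sub>M count_space UNIV"
      by (rule measurable_compose[OF G.random_network]) (rule measurable_count_space)
  qed
  have eq: "AE \<omega> in M. C.rescaled_path m \<kappa> (\<lambda>n. C.Z (n - m) \<omega>) = X \<kappa> \<omega>" for \<kappa>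
    using G.AE_transitions
  proof eventually_elim
    case (elim \<omega>)
    have "in_degree (with_proj (G (max m n) \<omega>)) m = C.Z (n - m) \<omega>" for n
      using G.in_degree_arrows[OF elim m(1), of "n - m"] unfolding C.Z_def
      by (cases "m \<le> n") (simp_all add: max_absorb1 max_absorb2)
    then show ?case by (simp add: X_def)
  qed
  show ?thesis
  proof (rule converges_in_distribution_AE_cong[OF C.chain_convergence[OF assms(4)]])
    show "\<forall>\<^sub>F \<kappa> in at_top. (\<lambda>\<omega>. \<lambda>t\<in>{0..}. (scaled_indegree f (\<lambda>n. G n \<omega>) s (s + phi_star f (\<kappa> * t)) - phi_star f (\<kappa> * t)) / sqrt \<kappa>)
        \<in> M \<rightarrow>\<^sub>M borel_of cadlag_topology"
      using eventually_gt_at_top[of 0] by eventually_elim (simp only: X XM)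
    show "\<forall>\<^sub>F \<kappa> in at_top. AE \<omega> in M. C.rescaled_path m \<kappa> (\<lambda>n. C.Z (n - m) \<omega>)
        = (\<lambda>t\<in>{0..}. (scaled_indegree f (\<lambda>n. G n \<omega>) s (s + phi_star f (\<kappa> * t)) - phi_star f (\<kappa> * t)) / sqrt \<kappa>)"
      using eventually_gt_at_top[of 0] by eventually_elim (simp only: X eq)
  qed
qed

end
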